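(* Let $h>0$, $\omega_h=(-h,h)$, and let $\lambda,\mu,\rho,\omega$ be real numbers with $\mu>0$, $3\lambda+2\mu>0$, $\rho>0$, $\omega>0$. Put $$A=\begin{pmatrix}\lambda+2\mu&0\\0&\mu\end{pmatrix},\quad B=\begin{pmatrix}0&\lambda+\mu\\\lambda+\mu&0\end{pmatrix},\quad C=\begin{pmatrix}\mu&0\\0&\lambda+2\mu\end{pmatrix},\quad D=\begin{pmatrix}0&\lambda\\\mu&0\end{pmatrix}.$$ For $z\in\mathbb C$ and $v\in H^2(\omega_h,\mathbb C^2)$ define $P(z)v=(P^I(z)v,P^B(z)v)\in L^2(\omega_h,\mathbb C^2)\times\mathbb C^2\times\mathbb C^2$ by $$P^I(z)v=A\partial_{11}v+zB\partial_1v+\omega^2\rho v+z^2Cv,\qquad P^B(z)v=\big(A\partial_1v(h)+zDv(h),\ A\partial_1v(-h)+zDv(-h)\big).$$ A Lamb mode with Lamb eigenvalue $z\in\mathbb C$ is a nonzero $v_0\in H^2(\omega_h,\mathbb C^2)$ with $P(z)v_0=0$; vectors $v_1,\dots,v_k\in H^2(\omega_h,\mathbb C^2)$ are associated modes of the Lamb mode $v_0$ if $\sum_{j=0}^{p}\frac{1}{j!}P^{(j)}(z)v_{p-j}=0$ for $p=0,\dots,k$, where $P^{(j)}$ is the $j$-th derivative of the polynomial pencil $z\mapsto P(z)$. Then the set of all Lamb modes and associated modes (over all Lamb eigenvalues) is complete in $H^1(\omega_h,\mathbb C^2)$, i.e., its linear span is dense in $H^1(\omega_h,\mathbb C^2)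$.
   Context: Lamb modes describe time-harmonic guided waves $\mathrm{Re}\big(v(x_1)e^{i(\beta x_3-\omega t)}\big)$ (with $z=i\beta$) in an isotropic homogeneous elastic plate $\{-h<x_1<h\}$ with Lamé coefficients $\lambda,\mu$, density $\rho$, traction-free on $x_1=\pm h$; $\partial_1$ denotes $d/dx_1$. *)

theory Defs
  imports "HOL-Analysis.Analysis"
begin

type_synonym cvec = "complex ^ 2"
type_synonym cfun = "real \<Rightarrow> cvec"

definition test_fun :: "real \<Rightarrow> real \<Rightarrow> (real \<Rightarrow> real) \<Rightarrow> bool" where
  "test_fun a b \<phi> \<longleftrightarrow>
     (\<exists>D::nat \<Rightarrow> real \<Rightarrow> real. D 0 = \<phi> \<and> (\<forall>k x. (D k has_real_derivative D (Suc k) x) (at x))) \<and>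
     (\<exists>c d. a < c \<and> d < b \<and> (\<forall>x. x \<notin> {c..d} \<longrightarrow> \<phi> x = 0))"

definition L2_on :: "real \<Rightarrow> real \<Rightarrow> cfun \<Rightarrow> bool" where
  "L2_on a b f \<longleftrightarrow> set_borel_measurable lborel {a<..<b} f \<and>
     set_integrable lborel {a<..<b} (\<lambda>x. (norm (f x))\<^sup>2)"

definition L2_normsq :: "real \<Rightarrow> real \<Rightarrow> cfun \<Rightarrow> real" where
  "L2_normsq a b f = (LINT x:{a<..<b}|lborel. (norm (f x))\<^sup>2)"

text \<open>g is a weak derivative of f on (a,b) (both assumed in L2 wherever used).\<close>
definition weak_deriv_on :: "real \<Rightarrow> real \<Rightarrow> cfun \<Rightarrow> cfun \<Rightarrow> bool" where
  "weak_deriv_on a b f g \<longleftrightarrow>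
     (\<forall>\<phi>. test_fun a b \<phi> \<longrightarrow>
        (LINT x:{a<..<b}|lborel. deriv \<phi> x *\<^sub>R f x) = - (LINT x:{a<..<b}|lborel. \<phi> x *\<^sub>R g x))"

definition H1_on :: "real \<Rightarrow> real \<Rightarrow> cfun \<Rightarrow> bool" where
  "H1_on a b f \<longleftrightarrow> L2_on a b f \<and> (\<exists>g. L2_on a b g \<and> weak_deriv_on a b f g)"

text \<open>An element of H^2(a,b) given by its continuous representative v whose first weak
  derivative v1 is also represented continuously on [a,b]; v2 is the second weak derivative.\<close>
definition H2_rep :: "real \<Rightarrow> real \<Rightarrow> cfun \<Rightarrow> cfun \<Rightarrow> cfun \<Rightarrow> bool" where
  "H2_rep a b v v1 v2 \<longleftrightarrow> L2_on a b v \<and> L2_on a b v1 \<and> L2_on a b v2 \<and>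
     weak_deriv_on a b v v1 \<and> weak_deriv_on a b v1 v2 \<and>
     continuous_on {a..b} v \<and> continuous_on {a..b} v1"

definition mat2 :: "complex \<Rightarrow> complex \<Rightarrow> complex \<Rightarrow> complex \<Rightarrow> complex ^ 2 ^ 2" where
  "mat2 p q r s = (\<chi> i j. if i = 1 then (if j = 1 then p else q) else (if j = 1 then r else s))"

definition matA :: "real \<Rightarrow> real \<Rightarrow> complex^2^2" where
  "matA lam mu = mat2 (of_real (lam + 2*mu)) 0 0 (of_real mu)"
definition matB :: "real \<Rightarrow> real \<Rightarrow> complex^2^2" where
  "matB lam mu = mat2 0 (of_real (lam + mu)) (of_real (lam + mu)) 0"
definition matC :: "real \<Rightarrow> real \<Rightarrow> complex^2^2" where
  "matC lam mu = mat2 (of_real mu) 0 0 (of_real (lam + 2*mu))"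
definition matD :: "real \<Rightarrow> real \<Rightarrow> complex^2^2" where
  "matD lam mu = mat2 0 (of_real lam) (of_real mu) 0"

text \<open>Coefficients of the quadratic pencil P(z) = P_0 + z P_1 + z^2 P_2, interior part
  (applied to v with derivatives v1, v2, evaluated at x) and boundary part
  (values at x = h and x = -h).\<close>
definition PcoefI :: "real \<Rightarrow> real \<Rightarrow> real \<Rightarrow> real \<Rightarrow> nat \<Rightarrow> cfun \<Rightarrow> cfun \<Rightarrow> cfun \<Rightarrow> cfun" where
  "PcoefI lam mu rho om k v v1 v2 = (\<lambda>x.
     if k = 0 then matA lam mu *v v2 x + of_real (om\<^sup>2 * rho) *s v x
     else if k = 1 then matB lam mu *v v1 x
     else if k = 2 then matC lam mu *v v x
     else 0)"

definition PcoefB :: "real \<Rightarrow> real \<Rightarrow> real \<Rightarrow> nat \<Rightarrow> cfun \<Rightarrow> cfun \<Rightarrow> cvec \<times> cvec" where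
  "PcoefB h lam mu k v v1 =
     (if k = 0 then (matA lam mu *v v1 h, matA lam mu *v v1 (-h))
      else if k = 1 then (matD lam mu *v v h, matD lam mu *v v (-h))
      else (0, 0))"

text \<open>(1/j!) P^(j)(z) for the polynomial pencil: sum over k of (k choose j) z^(k-j) P_k.\<close>
definition PderI :: "real \<Rightarrow> real \<Rightarrow> real \<Rightarrow> real \<Rightarrow> nat \<Rightarrow> complex \<Rightarrow> cfun \<Rightarrow> cfun \<Rightarrow> cfun \<Rightarrow> cfun" where
  "PderI lam mu rho om j z v v1 v2 = (\<lambda>x.
     \<Sum>k\<le>2. (of_nat (k choose j) * z ^ (k - j)) *s PcoefI lam mu rho om k v v1 v2 x)"

definition PderB :: "real \<Rightarrow> real \<Rightarrow> real \<Rightarrow> nat \<Rightarrow> complex \<Rightarrow> cfun \<Rightarrow> cfun \<Rightarrow> cvec \<times> cvec" where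
  "PderB h lam mu j z v v1 =
     (\<Sum>k\<le>2. (let c = of_nat (k choose j) * z ^ (k - j); w = PcoefB h lam mu k v v1
              in (c *s fst w, c *s snd w)))"

definition lamb_modes :: "real \<Rightarrow> real \<Rightarrow> real \<Rightarrow> real \<Rightarrow> real \<Rightarrow> cfun set" where
  "lamb_modes h lam mu rho om = {w. \<exists>(z::complex) (k::nat) (V::nat \<Rightarrow> cfun) V1 V2 m.
      m \<le> k \<and> w = V m \<and>
      (\<forall>i\<le>k. H2_rep (-h) h (V i) (V1 i) (V2 i)) \<and>
      \<not> (AE x in lborel. x \<in> {-h<..<h} \<longrightarrow> V 0 x = 0) \<and>
      (\<forall>p\<le>k.
         (AE x in lborel. x \<in> {-h<..<h} \<longrightarrow>
            (\<Sum>j\<le>p. PderI lam mu rho om j z (V (p - j)) (V1 (p - j)) (V2 (p - j)) x) = 0) \<and>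
         (\<Sum>j\<le>p. PderB h lam mu j z (V (p - j)) (V1 (p - j))) = (0, 0))}"

definition cspan_fun :: "cfun set \<Rightarrow> cfun set" where
  "cspan_fun S = {u. \<exists>(n::nat) (c::nat \<Rightarrow> complex) w.
      (\<forall>i<n. w i \<in> S) \<and> u = (\<lambda>x. \<Sum>i<n. c i *s w i x)}"

definition complete_in_H1 :: "real \<Rightarrow> real \<Rightarrow> cfun set \<Rightarrow> bool" where
  "complete_in_H1 a b S \<longleftrightarrow>
     (\<forall>f. H1_on a b f \<longrightarrow> (\<forall>\<epsilon>>0. \<exists>u\<in>cspan_fun S. \<exists>g.
        L2_on a b (\<lambda>x. f x - u x) \<and> L2_on a b g \<and> weak_deriv_on a b (\<lambda>x. f x - u x) g \<and>
        L2_normsq a b (\<lambda>x. f x - u x) + L2_normsq a b g < \<epsilon>))"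

end

theory Submission
  imports Defs "HOL-Complex_Analysis.Complex_Analysis" "HOL-Real_Asymp.Real_Asymp"
begin

text \<open>
  Put \<open>a = \<omega>\<^sup>2\<rho>/(\<lambda>+2\<mu>)\<close> and \<open>b = \<omega>\<^sup>2\<rho>/\<mu>\<close>, so that \<open>0 < a < b\<close>. The solutions of \<open>P\<^sup>I(z)v = 0\<close> are spanned by
  longitudinal waves \<open>(\<phi>', z\<phi>)\<close> with \<open>\<phi>'' = -(z\<^sup>2+a)\<phi>\<close> and shear waves \<open>(-z\<psi>, \<psi>')\<close> with
  \<open>\<psi>'' = -(z\<^sup>2+b)\<psi>\<close>. For each parity in \<open>x\<close> there is one of either kind, and two combinations \<open>U(z)\<close>
  of them, entire in \<open>z\<close>, whose traction is a multiple of a single vector by the Rayleigh-Lamb dispersion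
  function \<open>D(z)\<close>. At a zero of \<open>D\<close> of order \<open>m\<close> the first \<open>m\<close> Taylor coefficients of \<open>U\<close>
  form a chain of modes.

  If the span of the modes is not dense, a nonzero bounded functional \<open>l\<close> on \<open>H\<^sup>1\<close> annihilates it, and then
  \<open>l(U(z))/D(z)\<close> is entire. It is of exponential type, being a quotient of functions of exponential type,
  and it is \<open>O(|z|\<^sup>2)\<close> on the rays \<open>z\<^sup>4 < 0\<close>, where \<open>D\<close> is bounded below; by Phragmen-Lindeloef it is a
  polynomial of degree at most two. Solving for \<open>l\<close> on the longitudinal waves, these polynomials would give
  \<open>l(\<phi> e\<^sub>i)\<close> as a combination of boundary values of \<open>\<phi>\<close> growing faster than the \<open>H\<^sup>1\<close>
  norm of \<open>cosh(yx)\<close> allows, so they vanish. Hence \<open>l\<close> annihilates \<open>e\<^bsup>ipx\<^esup> e\<^sub>i\<close> for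
  all complex \<open>p\<close>, so all its moments vanish, and it is zero.
\<close>

section \<open>Quotients of entire functions of exponential type\<close>

text \<open>Holomorphic maps into function spaces are avoided: each wave is a power series in x with
  coefficients bounded by M K^n/n!, the functional is known only through its moments l(x^n e_i), and
  \<open>pairing\<close> the two sequences gives scalar entire functions of z. The rays z^4 < 0 are
  singled out because z^2 is purely imaginary there, so the square roots of z^2 + a and z^2 + b can
  both be taken with large imaginary part, and D is a Rayleigh function up to exponential factors
  and small errors. In it terms of size |z|^4 cancel down to |z|^2, while the numerators are
  O(|z|^4); hence polynomials of degree two are left over. They are excluded by the factor 1/sqrt|Im
  p| in the H^1 norm of exp(ipx): with the exponential removed, cosh(yx) has norm of order sqrt y,
  while its derivative at the boundary has size y. The span lies in the C^1 functions, which are not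
  complete for the H^1 norm; the separating functional is therefore built as a limit along a
  minimising sequence. Passing from entire functions to all of H^1 goes through polynomials and
  rests on a Poincare inequality for weak derivatives.\<close>

lemma entire_factor_power:
  assumes hol: "f holomorphic_on UNIV" and z: "\<And>i. i < m \<Longrightarrow> (deriv ^^ i) f \<xi> = 0"
  obtains g where "g holomorphic_on UNIV" "\<And>w. f w = (w - \<xi>) ^ m * g w"
    "g \<xi> = (deriv ^^ m) f \<xi> / fact m"
proof -
  define c where "c i = (deriv ^^ (i + m)) f \<xi> / fact (i + m)" for i
  define g where "g w = (\<Sum>i. c i * (w - \<xi>) ^ i)" for w
  have sf: "(\<lambda>i. (deriv ^^ i) f \<xi> / fact i * (w - \<xi>) ^ i) sums f w" for w
    by (rule holomorphic_power_series[where r = "dist \<xi> w + 1"])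
      (use hol holomorphic_on_subset in auto)
  have sh: "(\<lambda>i. (w - \<xi>) ^ m * (c i * (w - \<xi>) ^ i)) sums f w" for w
  proof -
    have "(\<lambda>i. (deriv ^^ (i + m)) f \<xi> / fact (i + m) * (w - \<xi>) ^ (i + m)) sums
        (f w - (\<Sum>i<m. (deriv ^^ i) f \<xi> / fact i * (w - \<xi>) ^ i))"
      using sf by (subst sums_iff_shift) simp
    thus ?thesis
      by (simp add: z c_def power_add mult_ac)
  qed
  have sg: "(\<lambda>i. c i * (w - \<xi>) ^ i) sums g w" for w
  proof (cases "w = \<xi>")
    case True
    then show ?thesis
      unfolding g_def by (intro summable_sums summable_finite[of "{0}"]) auto
  next
    case False
    have "summable (\<lambda>i. (w - \<xi>) ^ m * (c i * (w - \<xi>) ^ i) / (w - \<xi>) ^ m)"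
      using sh[of w] by (intro summable_divide) (auto simp: sums_iff)
    with False show ?thesis
      unfolding g_def by (auto intro: summable_sums)
  qed
  show ?thesis
  proof (rule that)
    have "g holomorphic_on ball \<xi> r" for r
      by (rule power_series_holomorphic[OF sg])
    hence "g holomorphic_on (\<Union>r. ball \<xi> r)"
      by (intro holomorphic_on_UN_open) auto
    moreover have "(\<Union>r. ball \<xi> r) = UNIV"
      by (auto simp: set_eq_iff intro: gt_ex)
    ultimately show "g holomorphic_on UNIV" by simp
    show "f w = (w - \<xi>) ^ m * g w" for w
      using sums_mult[OF sg, of "(w - \<xi>) ^ m" w] sh[of w] sums_unique2 by blast
    show "g \<xi> = (deriv ^^ m) f \<xi> / fact m"
      unfolding g_def by (subst suminf_finite[of "{0}"]) (auto simp: c_def)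
  qed
qed

lemma entire_zero_order:
  assumes hol: "f holomorphic_on UNIV" and nz: "f w0 \<noteq> 0"
  obtains m where "\<And>i. i < m \<Longrightarrow> (deriv ^^ i) f \<xi> = 0" "(deriv ^^ m) f \<xi> \<noteq> 0"
proof -
  have "\<exists>n. (deriv ^^ n) f \<xi> \<noteq> 0"
  proof (rule ccontr)
    assume "\<not> ?thesis"
    hence "f w0 = 0"
      using holomorphic_fun_eq_0_on_connected[OF hol open_UNIV connected_UNIV, of \<xi> w0] by auto
    with nz show False by simp
  qed
  then obtain m where "(deriv ^^ m) f \<xi> \<noteq> 0" "\<forall>i<m. \<not> (deriv ^^ i) f \<xi> \<noteq> 0"
    unfolding exists_least_iff[of "\<lambda>n. (deriv ^^ n) f \<xi> \<noteq> 0"] by blast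
  thus ?thesis using that by blast
qed

text \<open>Divisibility of entire functions is a local matter: by \<open>ord\<close>, f vanishes at
  every point at least to the order of g, so the same power of (w - \<xi>) can be cancelled from
  both. \<open>g w0 \<noteq> 0\<close> makes that order finite everywhere.\<close>

lemma entire_quotient:
  assumes hf: "f holomorphic_on UNIV" and hg: "g holomorphic_on UNIV" and nz: "g w0 \<noteq> 0"
    and ord: "\<And>\<xi> m. (\<And>i. i < m \<Longrightarrow> (deriv ^^ i) g \<xi> = 0) \<Longrightarrow> (\<And>i. i < m \<Longrightarrow> (deriv ^^ i) f \<xi> = 0)"
  obtains q where "q holomorphic_on UNIV" "\<And>z. f z = q z * g z"
proof -
  have loc: "\<exists>u v. u holomorphic_on UNIV \<and> v holomorphic_on UNIV \<and> v \<xi> \<noteq> 0 \<and>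
      (\<forall>w. f w * v w = u w * g w) \<and> (\<forall>w. w \<noteq> \<xi> \<longrightarrow> g w = 0 \<longleftrightarrow> v w = 0)" for \<xi>
  proof -
    obtain m where m: "\<And>i. i < m \<Longrightarrow> (deriv ^^ i) g \<xi> = 0" "(deriv ^^ m) g \<xi> \<noteq> 0"
      using entire_zero_order[OF hg nz] by blast
    obtain v where v: "v holomorphic_on UNIV" "\<And>w. g w = (w - \<xi>) ^ m * v w"
        "v \<xi> = (deriv ^^ m) g \<xi> / fact m"
      using entire_factor_power[OF hg m(1)] by blast
    have fz: "(deriv ^^ i) f \<xi> = 0" if "i < m" for i
      by (rule ord[OF m(1) that])
    obtain u where u: "u holomorphic_on UNIV" "\<And>w. f w = (w - \<xi>) ^ m * u w"
      using entire_factor_power[OF hf, of m \<xi>] fz by metis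
    show ?thesis
      using u v m by (intro exI[of _ u] exI[of _ v]) auto
  qed
  then obtain u v where uv: "\<And>\<xi>. u \<xi> holomorphic_on UNIV" "\<And>\<xi>. v \<xi> holomorphic_on UNIV"
    "\<And>\<xi>. v \<xi> \<xi> \<noteq> 0" "\<And>\<xi> w. f w * v \<xi> w = u \<xi> w * g w"
    "\<And>\<xi> w. w \<noteq> \<xi> \<Longrightarrow> g w = 0 \<longleftrightarrow> v \<xi> w = 0"
    by metis
  \<comment> \<open>The value at each point comes from the factorisation centred there. The next
    fact shows that one factorisation also gives the values at nearby points, and this is what makes
    \<open>q\<close> holomorphic.\<close>
  define q where "q \<xi> = u \<xi> \<xi> / v \<xi> \<xi>" for \<xi>
  have q: "q w = u \<xi> w / v \<xi> w" if "v \<xi> w \<noteq> 0" for \<xi> w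
  proof (cases "w = \<xi>")
    case False
    hence "g w \<noteq> 0" using uv that by blast
    have "f w = q w * g w"
      using uv(3)[of w] uv(4)[of w w] by (simp add: q_def field_simps)
    moreover have "f w = u \<xi> w / v \<xi> w * g w"
      using that uv(4)[of w \<xi>] by (simp add: field_simps)
    ultimately show ?thesis using \<open>g w \<noteq> 0\<close> by (metis mult_right_cancel)
  qed (simp add: q_def)
  show ?thesis
  proof (rule that)
    have "q field_differentiable at \<xi>" for \<xi>
    proof -
      have "\<forall>\<^sub>F w in nhds \<xi>. v \<xi> w \<noteq> 0"
      proof -
        have "isCont (v \<xi>) \<xi>"
          using uv(2) by (metis UNIV_I continuous_on_eq_continuous_at holomorphic_on_imp_continuous_on open_UNIV)
        then obtain e where "e > 0" "\<forall>y. dist \<xi> y < e \<longrightarrow> v \<xi> y \<noteq> 0"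
          using continuous_at_avoid[of \<xi> "v \<xi>" 0] uv(3)[of \<xi>] by blast
        thus ?thesis
          unfolding eventually_nhds_metric by (metis dist_commute)
      qed
      hence ev: "\<forall>\<^sub>F w in nhds \<xi>. u \<xi> w / v \<xi> w = q w"
        by eventually_elim (simp add: q)
      have "(\<lambda>w. u \<xi> w / v \<xi> w) field_differentiable at \<xi>"
        using uv(1-3) by (intro derivative_intros)
          (auto simp: holomorphic_on_def)
      then obtain d where "((\<lambda>w. u \<xi> w / v \<xi> w) has_field_derivative d) (at \<xi>)"
        by (auto simp: field_differentiable_def)
      hence "(q has_field_derivative d) (at \<xi>)"
        using DERIV_cong_ev[OF refl ev refl] by blast
      thus ?thesis by (auto simp: field_differentiable_def)
    qed
    thus "q holomorphic_on UNIV"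
      by (auto simp: holomorphic_on_def)
    show "f z = q z * g z" for z
      using uv(3)[of z] uv(4)[of z z] by (simp add: q_def field_simps)
  qed
qed

section \<open>Lower bounds after removal of zeros\<close>

lemma entire_factor_finite_zeros:
  assumes "g holomorphic_on UNIV" "g w0 \<noteq> 0" "finite {z \<in> S. g z = 0}"
  shows "\<exists>(l :: complex list) k. k holomorphic_on UNIV \<and> set l \<subseteq> S \<and>
    (\<forall>z. g z = (\<Prod>a\<leftarrow>l. z - a) * k z) \<and> (\<forall>z\<in>S. k z \<noteq> 0)"
  using assms
proof (induction "card {z \<in> S. g z = 0}" arbitrary: g)
  case 0
  hence "{z \<in> S. g z = 0} = {}" by simp
  thus ?case using 0 by (intro exI[of _ "[]"] exI[of _ g]) auto
next
  case (Suc n)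
  have "{z \<in> S. g z = 0} \<noteq> {}"
  proof
    assume "{z \<in> S. g z = 0} = {}"
    thus False using Suc.hyps(2) by (simp only: card.empty)
  qed
  then obtain \<xi> where \<xi>: "\<xi> \<in> S" "g \<xi> = 0" by blast
  obtain m where m: "\<And>i. i < m \<Longrightarrow> (deriv ^^ i) g \<xi> = 0" "(deriv ^^ m) g \<xi> \<noteq> 0"
    using entire_zero_order[OF Suc.prems(1,2)] by blast
  \<comment> \<open>The full multiplicity is removed at once, so the number of distinct zeros, on
    which the induction runs, drops by one; the list in the statement records
    multiplicities.\<close>
  obtain v where v: "v holomorphic_on UNIV" "\<And>w. g w = (w - \<xi>) ^ m * v w"
      "v \<xi> = (deriv ^^ m) g \<xi> / fact m"
    using entire_factor_power[OF Suc.prems(1) m(1)] by blast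
  have "m \<noteq> 0" using m \<xi> by (metis funpow_0)
  have eq: "{z \<in> S. v z = 0} = {z \<in> S. g z = 0} - {\<xi>}"
    using v m by auto
  have "n = card {z \<in> S. v z = 0}" "v w0 \<noteq> 0" "finite {z \<in> S. v z = 0}"
    using Suc.hyps Suc.prems \<xi> v unfolding eq by auto
  from Suc.hyps(1)[OF this(1) v(1) this(2,3)] obtain l k where lk: "k holomorphic_on UNIV" "set l \<subseteq> S"
    "\<And>z. v z = (\<Prod>a\<leftarrow>l. z - a) * k z" "\<forall>z\<in>S. k z \<noteq> 0"
    by blast
  show ?case
    using lk v \<xi> by (intro exI[of _ "replicate m \<xi> @ l"] exI[of _ k])
      (auto simp: prod_list_replicate map_replicate_const mult_ac split: if_splits)
qed

lemma entire_finite_zeros_cball: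
  fixes g :: "complex \<Rightarrow> complex"
  assumes "g holomorphic_on UNIV" "g w0 \<noteq> 0"
  shows "finite {z \<in> cball 0 R. g z = 0}"
proof (cases "g constant_on UNIV")
  case True
  hence "{z \<in> cball 0 R. g z = 0} = {}" using assms(2) by (auto simp: constant_on_def)
  thus ?thesis by (metis finite.emptyI)
next
  case False
  show ?thesis
    by (rule holomorphic_compact_finite_zeros[OF assms(1) open_UNIV connected_UNIV _ _ False]) auto
qed

text \<open>The map u -> u/(2A - u) carries the half plane Re u <= A into the closed unit disc and
  fixes 0, so Schwarz's lemma applies to \<open>f\<close>. At half the radius |f| <= 1/2, and u = f
  (2A - u) then gives |u| <= A + |u|/2.\<close>

lemma Borel_Caratheodory_half_disc:
  assumes hol: "k holomorphic_on ball 0 R" and "R > 0" "A > 0"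
    and re: "\<And>z. z \<in> ball 0 R \<Longrightarrow> Re (k z - k 0) \<le> A" and z: "norm z \<le> R / 2"
  shows "norm (k z - k 0) \<le> 2 * A"
proof -
  define u where "u w = k (of_real R * w) - k 0" for w
  have Rw: "of_real R * w \<in> ball 0 R" if "norm w < 1" for w :: complex
    using that \<open>R > 0\<close> by (simp add: norm_mult)
  have ne: "2 * of_real A - u w \<noteq> 0" if "norm w < 1" for w
  proof
    assume "2 * of_real A - u w = 0"
    hence "Re (u w) = 2 * A" by (simp add: complex_eq_iff)
    with re[OF Rw[OF that]] \<open>A > 0\<close> show False by (simp add: u_def)
  qed
  define f where "f w = u w / (2 * of_real A - u w)" for w
  have holu: "u holomorphic_on ball 0 1"
    unfolding u_def
    by (intro holomorphic_intros holomorphic_on_compose_gen[OF _ hol, unfolded o_def])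
      (use Rw in auto)
  have holf: "f holomorphic_on ball 0 1"
    unfolding f_def using ne by (intro holomorphic_intros holu) auto
  have le: "norm (u w) \<le> norm (2 * of_real A - u w)" if "norm w < 1" for w
  proof -
    have "Re (u w) \<le> A" using re[OF Rw[OF that]] by (simp add: u_def)
    hence "(Re (u w))\<^sup>2 \<le> (2 * A - Re (u w))\<^sup>2"
      using \<open>A > 0\<close> by (intro abs_le_square_iff[THEN iffD1]) auto
    hence "(norm (u w))\<^sup>2 \<le> (norm (2 * of_real A - u w))\<^sup>2"
      by (simp add: cmod_power2)
    thus ?thesis using power2_le_imp_le by fastforce
  qed
  \<comment> \<open>Schwarz's lemma is applied with a strict bound. Equality at one interior point
    would make \<open>f\<close> constant by the maximum principle, hence zero since
    \<open>f 0 = 0\<close>.\<close>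
  have f1: "norm (f w) < 1" if "norm w < 1" for w
  proof (rule ccontr)
    assume "\<not> ?thesis"
    hence eq: "norm (u w) = norm (2 * of_real A - u w)"
      using le[OF that] ne[OF that] by (simp add: f_def norm_divide field_simps)
    have "f constant_on ball 0 1"
    proof (rule maximum_modulus_principle[OF holf _ _ open_ball order_refl, of w])
      fix y :: complex assume "y \<in> ball 0 1"
      hence "norm (f y) \<le> 1" using le[of y] ne[of y] by (simp add: f_def norm_divide field_simps)
      also have "1 = norm (f w)" using eq ne[OF that] by (simp add: f_def norm_divide)
      finally show "norm (f y) \<le> norm (f w)" .
    qed (use that in auto)
    hence "f w = f 0" using that unfolding constant_on_def by (metis centre_in_ball mem_ball_0 zero_less_one)
    hence "f w = 0" by (simp add: f_def u_def)
    moreover have "norm (f w) = 1" using eq ne[OF that] by (simp add: f_def norm_divide)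
    ultimately show False by simp
  qed
  define w where "w = z / of_real R"
  have w: "norm w \<le> 1 / 2" using z \<open>R > 0\<close> by (simp add: w_def norm_divide field_simps)
  have "norm (f w) \<le> norm w"
    by (rule Schwarz_Lemma(1)[OF holf _ f1]) (use w in \<open>auto simp: f_def u_def\<close>)
  with w have fw: "norm (f w) \<le> 1 / 2" by simp
  have "u w = f w * (2 * of_real A - u w)" using ne[of w] w by (simp add: f_def)
  hence "norm (u w) = norm (f w) * norm (2 * of_real A - u w)" by (metis norm_mult)
  also have "\<dots> \<le> (1/2) * (2 * A + norm (u w))"
    using fw norm_triangle_ineq4[of "2 * of_real A" "u w"] \<open>A > 0\<close>
    by (intro mult_mono) (auto simp: norm_mult)
  finally have "norm (u w) \<le> 2 * A" by simp
  thus ?thesis using \<open>R > 0\<close> by (simp add: u_def w_def)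
qed

definition exptype :: "(complex \<Rightarrow> complex) \<Rightarrow> bool" where
  "exptype f \<longleftrightarrow> (\<exists>M K. M \<ge> 0 \<and> K \<ge> 0 \<and> (\<forall>z. norm (f z) \<le> M * exp (K * norm z)))"

text \<open>These factors are Blaschke denominators: they move a nonzero zero a of the disc to the
  reflected point R^2/cnj a outside it (and remove a zero at 0) without changing moduli on the
  circle.\<close>

lemma norm_linear_factor_reflect:
  fixes a z :: complex
  assumes "norm z = R" "R > 0"
  shows "norm (of_real R - cnj a * z / of_real R) = norm (z - a)"
proof -
  have "z * cnj z = of_real (R\<^sup>2)" using assms by (simp add: complex_norm_square[symmetric])
  hence "cnj z * (z / of_real R) = of_real R" using assms by (simp add: field_simps power2_eq_square)
  hence "of_real R - cnj a * z / of_real R = cnj (z - a) * (z / of_real R)"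
    by (simp add: algebra_simps)
  hence "norm (of_real R - cnj a * z / of_real R) = norm (cnj (z - a)) * (norm z / R)"
    using assms by (simp add: norm_mult norm_divide del: complex_cnj_diff)
  thus ?thesis using assms by (simp only: complex_mod_cnj) simp
qed

text \<open>Zeros of g obstruct a lower bound for g inside the disc, so they are reflected:
  \<open>g1\<close> has no zero in the open disc and has the modulus of g on the circle. It
  possesses a logarithm, whose real part exceeds its value at 0 by at most A, and the
  Borel-Caratheodory estimate turns this upper bound into |g1 z| >= |g 0| exp(-2A). By the maximum
  principle q g1 is bounded by B, and division bounds q.\<close>

lemma entire_quotient_bound:
  assumes hq: "q holomorphic_on UNIV" and hg: "g holomorphic_on UNIV" and g0: "g 0 \<noteq> 0"
    and R: "R > 0" and z: "norm z \<le> R / 2"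
    and Bg: "\<And>w. norm w \<le> R \<Longrightarrow> norm (g w) \<le> exp A * norm (g 0)" and A: "A > 0"
    and Bf: "\<And>w. norm w \<le> R \<Longrightarrow> norm (q w * g w) \<le> B"
  shows "norm (q z) \<le> B * exp (2 * A) / norm (g 0)"
proof -
  have "{z \<in> ball 0 R. g z = 0} \<subseteq> {z \<in> cball 0 R. g z = 0}" by auto
  hence "finite {z \<in> ball 0 R. g z = 0}"
    using entire_finite_zeros_cball[OF hg g0] finite_subset by blast
  from entire_factor_finite_zeros[OF hg g0 this] obtain l k where lk: "k holomorphic_on UNIV"
    "set l \<subseteq> ball 0 R" "\<And>z. g z = (\<Prod>a\<leftarrow>l. z - a) * k z" "\<forall>z\<in>ball 0 R. k z \<noteq> 0"
    by blast
  define Q where "Q z = (\<Prod>a\<leftarrow>l. of_real R - cnj a * z / of_real R)" for z :: complex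
  have Qb: "norm (Q w) = norm (\<Prod>a\<leftarrow>l. w - a)" if "norm w = R" for w
    unfolding Q_def using norm_linear_factor_reflect[OF that R]
    by (induction l) (auto simp: norm_mult)
  \<comment> \<open>Each zero has modulus below R, so reflection can only increase the value at 0.
    The bound on g normalised by \<open>g 0\<close> thus becomes one on \<open>g1\<close> normalised
    by \<open>g1 0\<close>.\<close>
  have Q0: "norm (\<Prod>a\<leftarrow>l. 0 - a) \<le> norm (Q 0)"
    unfolding Q_def using lk(2) R
    by (induction l) (auto simp: norm_mult intro!: mult_mono)
  have Qnz: "Q w \<noteq> 0" if "norm w < R" for w
  proof -
    have "of_real R - cnj a * w / of_real R \<noteq> 0" if "a \<in> set l" for a
    proof
      assume "of_real R - cnj a * w / of_real R = 0"
      hence "cnj a * w = of_real (R * R)" using R by (simp add: field_simps)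
      hence "norm a * norm w = R * R" by (metis R abs_of_pos complex_mod_cnj mult_pos_pos norm_mult norm_of_real)
      moreover have "norm a * norm w < R * R"
        using lk(2) that \<open>norm w < R\<close> R by (intro mult_strict_mono) auto
      ultimately show False by simp
    qed
    thus ?thesis unfolding Q_def by (auto simp: prod_list_zero_iff)
  qed
  have hQ: "Q holomorphic_on UNIV"
  proof -
    have "(\<lambda>z. \<Prod>a\<leftarrow>l. of_real R - cnj a * z / of_real R) holomorphic_on UNIV"
      using R by (induction l) (auto intro!: holomorphic_intros)
    thus ?thesis unfolding Q_def .
  qed
  define g1 where "g1 z = Q z * k z" for z
  have hg1: "g1 holomorphic_on UNIV" unfolding g1_def by (intro holomorphic_intros hQ lk)
  have nz: "g1 w \<noteq> 0" if "w \<in> ball 0 R" for w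
    using Qnz lk(4) that by (auto simp: g1_def)
  have eqb: "norm (g1 w) = norm (g w)" if "norm w = R" for w
    using Qb[OF that] by (simp add: g1_def lk(3) norm_mult)
  have maxi: "norm (F w) \<le> C" if "F holomorphic_on UNIV" "\<And>w. norm w = R \<Longrightarrow> norm (F w) \<le> C"
      "w \<in> ball 0 R" for F w C
    by (rule maximum_modulus_frontier[of F "ball 0 R"])
      (use that R in \<open>auto intro: holomorphic_on_subset holomorphic_on_imp_continuous_on continuous_on_subset simp: frontier_def\<close>)
  have g1_le: "norm (g1 w) \<le> exp A * norm (g 0)" if "w \<in> ball 0 R" for w
    by (rule maxi[OF hg1 _ that]) (use eqb Bg in auto)
  have qg1_le: "norm (q w * g1 w) \<le> B" if "w \<in> ball 0 R" for w
  proof (rule maxi[OF _ _ that])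
    show "(\<lambda>w. q w * g1 w) holomorphic_on UNIV" by (intro holomorphic_intros hq hg1)
    show "norm (q w * g1 w) \<le> B" if "norm w = R" for w
      using Bf[of w] eqb[OF that] that by (simp add: norm_mult)
  qed
  have g10: "norm (g 0) \<le> norm (g1 0)"
    using Q0 by (simp add: g1_def lk(3) norm_mult mult_right_mono)
  obtain \<kappa> where \<kappa>: "\<kappa> holomorphic_on ball 0 R" "\<And>w. w \<in> ball 0 R \<Longrightarrow> g1 w = exp (\<kappa> w)"
  proof (rule contractible_imp_holomorphic_log[of g1 "ball 0 R"])
    show "g1 holomorphic_on ball 0 R" using hg1 by (rule holomorphic_on_subset) simp
    show "contractible (ball 0 R :: complex set)" by (simp add: convex_imp_contractible)
  qed (use nz in auto)
  have zb: "z \<in> ball 0 R" and 0: "0 \<in> ball 0 R" using z R by auto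
  have "Re (\<kappa> w - \<kappa> 0) \<le> A" if "w \<in> ball 0 R" for w
  proof -
    have "exp (Re (\<kappa> w)) \<le> exp A * exp (Re (\<kappa> 0))"
    proof -
      have "exp (Re (\<kappa> w)) \<le> exp A * norm (g 0)"
        using g1_le[OF that] \<kappa>(2)[OF that] by simp
      also have "\<dots> \<le> exp A * norm (g1 0)" using g10 by (intro mult_left_mono) auto
      finally show ?thesis using \<kappa>(2)[OF 0] by simp
    qed
    hence "exp (Re (\<kappa> w)) \<le> exp (A + Re (\<kappa> 0))" by (simp add: exp_add)
    thus ?thesis by simp
  qed
  hence "norm (\<kappa> z - \<kappa> 0) \<le> 2 * A"
    by (rule Borel_Caratheodory_half_disc[OF \<kappa>(1) R A _ z])
  hence "Re (\<kappa> 0) - 2 * A \<le> Re (\<kappa> z)"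
    using abs_Re_le_cmod[of "\<kappa> z - \<kappa> 0"] by simp
  hence "exp (Re (\<kappa> 0)) * exp (-2 * A) \<le> exp (Re (\<kappa> z))"
    by (simp flip: exp_add)
  hence low: "norm (g 0) * exp (-2 * A) \<le> norm (g1 z)"
  proof -
    have "norm (g 0) * exp (-2 * A) \<le> norm (g1 0) * exp (-2 * A)"
      using g10 by (intro mult_right_mono) auto
    also have "\<dots> = exp (Re (\<kappa> 0)) * exp (-2 * A)" using \<kappa>(2)[OF 0] by simp
    also have "\<dots> \<le> exp (Re (\<kappa> z))" by fact
    also have "\<dots> = norm (g1 z)" using \<kappa>(2)[OF zb] by simp
    finally show ?thesis .
  qed
  have "norm (q z) * (norm (g 0) * exp (-2 * A)) \<le> norm (q z) * norm (g1 z)"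
    using low by (intro mult_left_mono) auto
  also have "\<dots> \<le> B" using qg1_le[OF zb] by (simp add: norm_mult)
  finally show ?thesis using g0 by (simp add: exp_minus field_simps)
qed

lemma exptype_quotient_aux:
  assumes hq: "q holomorphic_on UNIV" and hg: "g holomorphic_on UNIV" and g0: "g 0 \<noteq> 0"
    and eg: "exptype g" and ef: "exptype (\<lambda>z. q z * g z)"
  shows "exptype q"
proof -
  obtain M K where MK: "M \<ge> 0" "K \<ge> 0" "\<And>z. norm (g z) \<le> M * exp (K * norm z)"
    using eg unfolding exptype_def by blast
  obtain N L where NL: "N \<ge> 0" "L \<ge> 0" "\<And>z. norm (q z * g z) \<le> N * exp (L * norm z)"
    using ef unfolding exptype_def by blast
  define M' where "M' = max 1 (M / norm (g 0))"
  have M': "M' \<ge> 1" "M \<le> M' * norm (g 0)" using g0 by (auto simp: M'_def field_simps max_def)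
  have "norm (q z) \<le> N * exp (2 * L) * exp (2 * (ln M' + 1 + 2 * K)) / norm (g 0) * exp ((2 * L + 4 * K) * norm z)"
    for z
  proof -
    \<comment> \<open>A radius comparable to |z| keeps the final exponent linear in |z|. The
      summands 2 here and 1 in \<open>A\<close> secure positivity, and M' >= 1 makes ln M'
      nonnegative.\<close>
    define R where "R = 2 * norm z + 2"
    define A where "A = ln M' + 1 + K * R"
    have AR: "A > 0" "R > 0" "norm z \<le> R / 2" using M' MK by (auto simp: A_def R_def add_nonneg_pos add_pos_nonneg)
    have "norm (q z) \<le> N * exp (L * R) * exp (2 * A) / norm (g 0)"
    proof (rule entire_quotient_bound[OF hq hg g0 AR(2,3) _ AR(1)])
      fix w :: complex assume w: "norm w \<le> R"
      have "norm (g w) \<le> M * exp (K * norm w)" by fact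
      also have "\<dots> \<le> (M' * norm (g 0)) * exp (1 + K * R)"
        using M' MK w by (intro mult_mono) (auto intro: add_increasing mult_left_mono)
      also have "\<dots> = exp A * norm (g 0)" using M' by (simp add: A_def exp_add)
      finally show "norm (g w) \<le> exp A * norm (g 0)" .
      have "norm (q w * g w) \<le> N * exp (L * norm w)" by fact
      also have "\<dots> \<le> N * exp (L * R)" using NL w by (intro mult_left_mono) (auto intro: mult_left_mono)
      finally show "norm (q w * g w) \<le> N * exp (L * R)" .
    qed
    also have "\<dots> = N * exp (2 * L) * exp (2 * (ln M' + 1 + 2 * K)) / norm (g 0) * exp ((2 * L + 4 * K) * norm z)"
      by (simp add: A_def R_def flip: exp_add) (simp add: algebra_simps)
    finally show ?thesis .
  qed
  thus ?thesis unfolding exptype_def using MK NL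
    by (intro exI[of _ "N * exp (2 * L) * exp (2 * (ln M' + 1 + 2 * K)) / norm (g 0)"] exI[of _ "2 * L + 4 * K"]) auto
qed

lemma exptype_shift:
  assumes "exptype f" shows "exptype (\<lambda>z. f (z + c))"
proof -
  obtain M K where MK: "M \<ge> 0" "K \<ge> 0" "\<And>z. norm (f z) \<le> M * exp (K * norm z)"
    using assms unfolding exptype_def by blast
  have "norm (f (z + c)) \<le> (M * exp (K * norm c)) * exp (K * norm z)" for z
  proof -
    have "norm (f (z + c)) \<le> M * exp (K * norm (z + c))" by fact
    also have "\<dots> \<le> M * exp (K * (norm z + norm c))"
      using MK by (intro mult_left_mono) (auto intro!: mult_left_mono norm_triangle_ineq)
    finally show ?thesis by (simp add: algebra_simps exp_add)
  qed
  thus ?thesis unfolding exptype_def using MK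
    by (intro exI[of _ "M * exp (K * norm c)"] exI[of _ K]) auto
qed

text \<open>The origin is translated to a point where g does not vanish; shifts preserve exponential
  type.\<close>

lemma exptype_quotient:
  assumes hq: "q holomorphic_on UNIV" and hg: "g holomorphic_on UNIV" and g0: "g w0 \<noteq> 0"
    and eg: "exptype g" and ef: "exptype (\<lambda>z. q z * g z)"
  shows "exptype q"
proof -
  have sh: "(\<lambda>z. F (z + w0)) holomorphic_on UNIV" if "F holomorphic_on UNIV" for F :: "complex \<Rightarrow> complex"
    using holomorphic_on_compose_gen[OF _ that, of "\<lambda>z. z + w0" UNIV] by (simp add: o_def holomorphic_intros)
  have "exptype (\<lambda>z. q (z + w0))"
    by (rule exptype_quotient_aux[of _ "\<lambda>z. g (z + w0)"])
      (use sh[OF hq] sh[OF hg] g0 exptype_shift[OF eg, of w0] exptype_shift[OF ef, of w0] in auto)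
  from exptype_shift[OF this, of "-w0"] show ?thesis by simp
qed

section \<open>A Phragmen-Lindeloef theorem\<close>

lemma exptypeI:
  assumes "\<And>z. norm (f z) \<le> M * exp (K * norm z)" "K \<ge> 0"
  shows "exptype f"
proof -
  have "M \<ge> 0" using order_trans[OF norm_ge_zero assms(1)[of 0]] by simp
  thus ?thesis using assms unfolding exptype_def by blast
qed

lemma exptype_const: "exptype (\<lambda>z. c)"
  by (rule exptypeI[of _ "norm c" 0]) auto

lemma exptype_ident: "exptype (\<lambda>z. z)"
proof (rule exptypeI[of _ 1 1])
  show "norm z \<le> 1 * exp (1 * norm z)" for z :: complex
    using exp_ge_add_one_self[of "norm z"] by (simp del: exp_ge_add_one_self)
qed auto

lemma exptype_add:
  assumes "exptype f" "exptype g" shows "exptype (\<lambda>z. f z + g z)"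
proof -
  obtain M K N L where MK: "M \<ge> 0" "K \<ge> 0" "\<And>z. norm (f z) \<le> M * exp (K * norm z)"
      "N \<ge> 0" "L \<ge> 0" "\<And>z. norm (g z) \<le> N * exp (L * norm z)"
    using assms unfolding exptype_def by metis
  show ?thesis
  proof (rule exptypeI)
    fix z
    have "norm (f z + g z) \<le> M * exp (K * norm z) + N * exp (L * norm z)"
      using MK norm_triangle_mono by blast
    also have "\<dots> \<le> M * exp ((K + L) * norm z) + N * exp ((K + L) * norm z)"
      using MK by (intro add_mono mult_left_mono) (auto intro!: mult_right_mono)
    finally show "norm (f z + g z) \<le> (M + N) * exp ((K + L) * norm z)"
      by (simp add: algebra_simps)
  qed (use MK in auto)
qed

lemma exptype_mult:
  assumes "exptype f" "exptype g" shows "exptype (\<lambda>z. f z * g z)"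
proof -
  obtain M K N L where MK: "M \<ge> 0" "K \<ge> 0" "\<And>z. norm (f z) \<le> M * exp (K * norm z)"
      "N \<ge> 0" "L \<ge> 0" "\<And>z. norm (g z) \<le> N * exp (L * norm z)"
    using assms unfolding exptype_def by metis
  show ?thesis
  proof (rule exptypeI)
    fix z
    have "norm (f z * g z) \<le> (M * exp (K * norm z)) * (N * exp (L * norm z))"
      unfolding norm_mult using MK by (intro mult_mono) auto
    thus "norm (f z * g z) \<le> (M * N) * exp ((K + L) * norm z)"
      by (simp add: algebra_simps exp_add)
  qed (use MK in auto)
qed

lemma exptype_diff:
  assumes "exptype f" "exptype g" shows "exptype (\<lambda>z. f z - g z)"
  using exptype_add[OF assms(1) exptype_mult[OF exptype_const[of "-1"] assms(2)]] by simp

lemma exptype_minus: "exptype f \<Longrightarrow> exptype (\<lambda>z. - f z)"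
  using exptype_diff[OF exptype_const[of 0], of f] by simp

lemma exptype_power: "exptype f \<Longrightarrow> exptype (\<lambda>z. f z ^ n)"
  by (induction n) (simp_all add: exptype_const exptype_mult)

lemma exptype_cmult: 
  assumes "exptype f" shows "exptype (\<lambda>z. f (c * z))"
proof -
  obtain M K where MK: "M \<ge> 0" "K \<ge> 0" "\<And>z. norm (f z) \<le> M * exp (K * norm z)"
    using assms unfolding exptype_def by metis
  show ?thesis
    by (rule exptypeI[of _ M "K * norm c"]) (use MK(1,2) MK(3)[of "c * _"] in \<open>auto simp: norm_mult mult_ac\<close>)
qed

text \<open>The substitution \<^term>\<open>z = w\<^sup>2\<close> turns the convergence factor
  \<open>exp (- \<epsilon> z powr (3/2))\<close> of the classical argument into the entire function \<open>exp (- \<epsilon> w ^ 3)\<close>.\<close>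

lemma Phragmen_Lindelof_quarter_plane:
  assumes hol: "F holomorphic_on UNIV" and et: "exptype F" and "B > 0"
    and ray: "\<And>z. \<bar>Re z\<bar> = \<bar>Im z\<bar> \<Longrightarrow> norm (F z) \<le> B"
    and z: "\<bar>Im z\<bar> \<le> Re z"
  shows "norm (F z) \<le> B"
proof -
  obtain M K where MK: "M \<ge> 0" "K \<ge> 0" "\<And>z. norm (F z) \<le> M * exp (K * norm z)"
    using et unfolding exptype_def by metis
  \<comment> \<open>This is tan(pi/8). Squaring maps the sector |arg w| <= pi/8 onto |arg z| <=
    pi/4, and 1 - t^2 = 2t says that its edges go to the diagonals.\<close>
  define t where "t = sqrt 2 - 1"
  have t: "t > 0" "1 - t\<^sup>2 = 2 * t" "3 * t\<^sup>2 \<le> 6/10" "t < 1"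
  proof -
    have "sqrt 2 < 1.42" by (rule real_less_lsqrt) (auto simp: power2_eq_square)
    moreover have "sqrt 2 > 1.4" by (rule real_less_rsqrt) (auto simp: power2_eq_square)
    ultimately show "t > 0" "t < 1" "1 - t\<^sup>2 = 2 * t" "3 * t\<^sup>2 \<le> 6/10"
      by (auto simp: t_def power2_eq_square algebra_simps)
  qed
  \<comment> \<open>On this sector |arg (w^3)| <= 3 pi/8 < pi/2. The constant 1/10 results from Re
    (w^3) >= 4/10 (Re w)^3 and |w|^3 <= 4 (Re w)^3.\<close>
  have Re3: "Re (w ^ 3) \<ge> (norm w) ^ 3 / 10" if w: "\<bar>Im w\<bar> \<le> t * Re w" for w
  proof -
    have u: "Re w \<ge> 0" using order_trans[OF abs_ge_zero w] t by (simp add: zero_le_mult_iff)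
    have v: "(Im w)\<^sup>2 \<le> t\<^sup>2 * (Re w)\<^sup>2"
      using power_mono[OF w, of 2] by (simp add: power_mult_distrib)
    have "norm w \<le> 2 * Re w / sqrt 2"
    proof (rule power2_le_imp_le)
      have "t\<^sup>2 \<le> 1" using t by (simp add: power_le_one)
      hence "t\<^sup>2 * (Re w)\<^sup>2 \<le> 1 * (Re w)\<^sup>2" by (intro mult_right_mono) auto
      thus "(norm w)\<^sup>2 \<le> (2 * Re w / sqrt 2)\<^sup>2" using v by (simp add: cmod_power2 power_divide)
    qed (use u in auto)
    hence "norm w ^ 3 \<le> (2 * Re w / sqrt 2) ^ 3" by (intro power_mono) auto
    also have "\<dots> = 4 / sqrt 2 * (Re w) ^ 3"
      by (simp add: power_divide power3_eq_cube field_simps)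
    also have "\<dots> \<le> 4 * (Re w) ^ 3"
      using u by (intro mult_right_mono) (auto simp: field_simps)
    finally have 1: "norm w ^ 3 \<le> 4 * (Re w) ^ 3" .
    have "Re (w ^ 3) = (Re w) ^ 3 - 3 * (Im w)\<^sup>2 * Re w"
      by (simp add: power3_eq_cube power2_eq_square algebra_simps)
    moreover have "3 * (Im w)\<^sup>2 * Re w \<le> 6/10 * (Re w) ^ 3"
    proof -
      have "3 * (Im w)\<^sup>2 \<le> 6/10 * (Re w)\<^sup>2"
        using v mult_right_mono[OF t(3), of "(Re w)\<^sup>2"] by simp
      from mult_right_mono[OF this u] show ?thesis by (simp add: power3_eq_cube power2_eq_square)
    qed
    ultimately show ?thesis using 1 by argo
  qed
  have ray2: "norm (F (w\<^sup>2)) \<le> B" if w: "\<bar>Im w\<bar> = t * Re w" for w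
  proof (rule ray)
    have "(Im w)\<^sup>2 = t\<^sup>2 * (Re w)\<^sup>2" using w by (metis power2_abs power_mult_distrib)
    hence "Re (w\<^sup>2) = (1 - t\<^sup>2) * (Re w)\<^sup>2" by (simp add: power2_eq_square[of w] power2_eq_square algebra_simps)
    also have "\<dots> = 2 * t * (Re w)\<^sup>2" using t by simp
    finally have "\<bar>Re (w\<^sup>2)\<bar> = 2 * t * (Re w)\<^sup>2" using t by simp
    moreover have "\<bar>Im (w\<^sup>2)\<bar> = 2 * \<bar>Re w\<bar> * \<bar>Im w\<bar>" by (simp add: power2_eq_square abs_mult)
    moreover have "Re w \<ge> 0" using order_trans[OF abs_ge_zero eq_refl[OF w]] t by (simp add: zero_le_mult_iff)
    ultimately show "\<bar>Re (w\<^sup>2)\<bar> = \<bar>Im (w\<^sup>2)\<bar>" using w by (simp add: power2_eq_square)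
  qed
  have main: "norm (F (w\<^sup>2)) * exp (- \<epsilon> * Re (w ^ 3)) \<le> B" if "\<epsilon> > 0" and w: "\<bar>Im w\<bar> < t * Re w" for \<epsilon> w
  proof -
    define k where "k w = F (w\<^sup>2) * exp (- (of_real \<epsilon> * w ^ 3))" for w
    have hk: "k holomorphic_on UNIV" unfolding k_def
      by (intro holomorphic_intros holomorphic_on_compose_gen[OF _ hol, unfolded o_def]) auto
    have nk: "norm (k w) = norm (F (w\<^sup>2)) * exp (- \<epsilon> * Re (w ^ 3))" for w
      by (simp add: k_def norm_mult)
    \<comment> \<open>After the substitution the type of \<open>F\<close> contributes exp (K R^2),
      and a cubic in the exponent beats it for every positive \<epsilon>; so the arc of a large
      sector does no harm.\<close>
    have "((\<lambda>R. M * exp (K * R\<^sup>2 - \<epsilon> * (R ^ 3 / 10))) \<longlongrightarrow> 0) at_top"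
      using \<open>\<epsilon> > 0\<close> by real_asymp
    hence "\<forall>\<^sub>F R in at_top. M * exp (K * R\<^sup>2 - \<epsilon> * (R ^ 3 / 10)) < B"
      using \<open>B > 0\<close> by (rule order_tendstoD)
    then obtain R where R: "R > norm w" "M * exp (K * R\<^sup>2 - \<epsilon> * (R ^ 3 / 10)) < B"
      using eventually_happens[OF eventually_conj[OF _ eventually_gt_at_top[of "norm w"]]] by force
    define S where "S = {w. \<bar>Im w\<bar> < t * Re w} \<inter> ball 0 R"
    have oS: "open S" unfolding S_def
      by (intro open_Int open_Collect_less continuous_intros) auto
    have cl: "closure S \<subseteq> {w. \<bar>Im w\<bar> \<le> t * Re w} \<inter> cball 0 R"
      by (rule closure_minimal) (auto simp: S_def intro!: closed_Int closed_Collect_le continuous_intros)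
    have "norm (k w) \<le> B"
    proof (rule maximum_modulus_frontier[of k S])
      show "k holomorphic_on interior S" "continuous_on (closure S) k"
        using hk by (auto intro: holomorphic_on_subset holomorphic_on_imp_continuous_on continuous_on_subset)
      show "bounded S" by (auto simp: S_def)
      show "w \<in> S" using w R by (simp add: S_def)
      fix y assume "y \<in> frontier S"
      hence "y \<in> closure S" "y \<notin> S" using oS by (auto simp: frontier_def interior_open)
      hence y: "\<bar>Im y\<bar> \<le> t * Re y" "norm y \<le> R" "\<bar>Im y\<bar> = t * Re y \<or> norm y = R"
        using cl by (auto simp: S_def)
      from y(3) show "norm (k y) \<le> B"
      proof
        assume eq: "\<bar>Im y\<bar> = t * Re y"
        have "0 \<le> norm y ^ 3 / 10" by simp
        hence "0 \<le> \<epsilon> * Re (y ^ 3)"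
          using order_trans[OF _ Re3[OF y(1)]] \<open>\<epsilon> > 0\<close> by (intro mult_nonneg_nonneg) auto
        hence "norm (k y) \<le> B * 1"
          unfolding nk using ray2[OF eq] \<open>B > 0\<close> by (intro mult_mono) auto
        thus ?thesis by simp
      next
        assume eq: "norm y = R"
        have "norm (k y) \<le> (M * exp (K * norm (y\<^sup>2))) * exp (- \<epsilon> * (norm y ^ 3 / 10))"
          unfolding nk using MK(1) MK(3)[of "y\<^sup>2"] Re3[OF y(1)] \<open>\<epsilon> > 0\<close> by (intro mult_mono) auto
        also have "\<dots> = M * exp (K * R\<^sup>2 - \<epsilon> * (R ^ 3 / 10))"
          unfolding diff_conv_add_uminus exp_add by (simp add: eq norm_power)
        finally show ?thesis using R(2) by simp
      qed
    qed
    thus ?thesis by (simp add: nk)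
  qed
  \<comment> \<open>The bound B is independent of \<epsilon>, so letting \<epsilon> tend to 0
    removes the convergence factor.\<close>
  have inner: "norm (F (w\<^sup>2)) \<le> B" if w: "\<bar>Im w\<bar> < t * Re w" for w
  proof (rule tendsto_upperbound)
    have "((\<lambda>\<epsilon>. norm (F (w\<^sup>2)) * exp (- \<epsilon> * Re (w ^ 3))) \<longlongrightarrow> norm (F (w\<^sup>2)) * exp (- 0 * Re (w ^ 3))) (at_right 0)"
      by (intro tendsto_intros)
    thus "((\<lambda>\<epsilon>. norm (F (w\<^sup>2)) * exp (- \<epsilon> * Re (w ^ 3))) \<longlongrightarrow> norm (F (w\<^sup>2))) (at_right 0)"
      by simp
    show "\<forall>\<^sub>F \<epsilon> in at_right 0. norm (F (w\<^sup>2)) * exp (- \<epsilon> * Re (w ^ 3)) \<le> B"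
      using main[OF _ w] by (auto simp: eventually_at_filter)
  qed auto
  define w where "w = csqrt z"
  have zw: "z = w\<^sup>2" by (simp add: w_def)
  have u: "Re w \<ge> 0" using csqrt_principal[of z] by (auto simp: w_def)
  have "(Re w)\<^sup>2 - (Im w)\<^sup>2 \<ge> 2 * Re w * \<bar>Im w\<bar>"
    using z u by (simp add: zw power2_eq_square abs_mult algebra_simps)
  hence "(Re w + \<bar>Im w\<bar>)\<^sup>2 \<le> (sqrt 2 * Re w)\<^sup>2"
    by (simp add: power2_eq_square algebra_simps abs_mult_self_eq)
  hence "Re w + \<bar>Im w\<bar> \<le> sqrt 2 * Re w"
    by (rule power2_le_imp_le) (use u in auto)
  hence "\<bar>Im w\<bar> \<le> t * Re w" by (simp add: t_def algebra_simps)
  thus ?thesis using inner[of w] ray2[of w] by (fastforce simp: zw)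
qed

text \<open>The diagonals cut the plane into four quarter planes. Multiplication by 1, i, -1, -i
  brings each of them to the position already treated, so F is bounded and Liouville's theorem
  applies.\<close>

lemma Phragmen_Lindelof_diagonal_rays:
  assumes hol: "F holomorphic_on UNIV" and et: "exptype F"
    and ray: "\<And>z. \<bar>Re z\<bar> = \<bar>Im z\<bar> \<Longrightarrow> norm (F z) \<le> B"
  shows "F z = F 0"
proof -
  define B' where "B' = \<bar>B\<bar> + 1"
  have B': "B' > 0" "\<And>z. \<bar>Re z\<bar> = \<bar>Im z\<bar> \<Longrightarrow> norm (F z) \<le> B'"
    using ray by (fastforce simp: B'_def)+
  have sec: "norm (F (c * z)) \<le> B'" if "\<bar>Im z\<bar> \<le> Re z" "c \<in> {1, \<i>, -1, -\<i>}" for c z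
  proof (rule Phragmen_Lindelof_quarter_plane[where F = "\<lambda>z. F (c * z)", OF _ exptype_cmult[OF et] B'(1) _ that(1)])
    show "(\<lambda>z. F (c * z)) holomorphic_on UNIV"
      by (intro holomorphic_on_compose_gen[OF _ hol, unfolded o_def] holomorphic_intros) auto
    show "norm (F (c * z)) \<le> B'" if "\<bar>Re z\<bar> = \<bar>Im z\<bar>" for z
      using that \<open>c \<in> _\<close> by (intro B'(2)) auto
  qed
  have bd: "norm (F z) \<le> B'" for z
  proof -
    consider "\<bar>Im z\<bar> \<le> Re z" | "\<bar>Im z\<bar> \<le> - Re z" | "\<bar>Re z\<bar> \<le> Im z" | "\<bar>Re z\<bar> \<le> - Im z" by linarith
    thus ?thesis
    proof cases
      case 1 thus ?thesis using sec[of z 1] by simp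
    next
      case 2 thus ?thesis using sec[of "-z" "-1"] by simp
    next
      case 3 thus ?thesis using sec[of "-\<i> * z" "\<i>"] by (simp flip: mult.assoc)
    next
      case 4 thus ?thesis using sec[of "\<i> * z" "-\<i>"] by (simp flip: mult.assoc)
    qed
  qed
  hence "bounded (range F)" by (auto simp: bounded_iff)
  from Liouville_theorem[OF hol this] show ?thesis by (auto simp: constant_on_def)
qed

text \<open>Removing the Taylor polynomial of degree one at 0 leaves a function divisible by z^2.
  The quotient \<open>H\<close> is still of exponential type and is bounded on the diagonals, hence
  constant.\<close>

lemma exptype_quadratic_on_rays:
  assumes hol: "G holomorphic_on UNIV" and et: "exptype G"
    and ray: "\<And>z. \<lbrakk>\<bar>Re z\<bar> = \<bar>Im z\<bar>; norm z \<ge> r0\<rbrakk> \<Longrightarrow> norm (G z) \<le> C * (norm z)\<^sup>2"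
  shows "\<exists>g0 g1 g2. \<forall>z. G z = g0 + g1 * z + g2 * z\<^sup>2"
proof -
  define g0 where "g0 = G 0"
  define g1 where "g1 = deriv G 0"
  define F where "F z = G z - g0 - g1 * z" for z
  have hF: "F holomorphic_on UNIV" unfolding F_def by (intro holomorphic_intros hol)
  have "deriv F 0 = 0"
    unfolding F_def using holomorphic_derivI[OF hol open_UNIV UNIV_I, of 0]
    by (intro DERIV_imp_deriv) (auto intro!: derivative_eq_intros simp: g1_def)
  hence "(deriv ^^ i) F 0 = 0" if "i < 2" for i
    using that by (cases i) (auto simp: F_def g0_def)
  then obtain H where H: "H holomorphic_on UNIV" "\<And>w. F w = (w - 0)\<^sup>2 * H w"
    using entire_factor_power[OF hF, of 2 0] by metis
  have eF: "exptype F" unfolding F_def by (intro exptype_diff et exptype_const exptype_mult exptype_ident)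
  have eH: "exptype H"
  proof (rule exptype_quotient[OF H(1), of "\<lambda>z. z\<^sup>2" 1])
    have "(\<lambda>z. H z * z\<^sup>2) = F" by (simp add: H(2) fun_eq_iff mult.commute)
    thus "exptype (\<lambda>z. H z * z\<^sup>2)" using eF by simp
    show "exptype (\<lambda>z. z\<^sup>2)" by (intro exptype_power exptype_ident)
  qed (auto intro!: holomorphic_intros)
  \<comment> \<open>Near 0 compactness bounds \<open>H\<close>; for |z| >= 1 the subtracted terms
    are at most a multiple of |z|^2.\<close>
  define r where "r = max r0 1"
  have "compact (H ` cball 0 r)"
    using H(1) by (intro compact_continuous_image) (auto intro: holomorphic_on_imp_continuous_on holomorphic_on_subset)
  then obtain B where B: "\<And>z. norm z \<le> r \<Longrightarrow> norm (H z) \<le> B"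
    by (metis bounded_iff compact_imp_bounded imageI mem_cball_0)
  have "H z = H 0" for z
  proof (rule Phragmen_Lindelof_diagonal_rays[OF H(1) eH])
    fix z :: complex assume z: "\<bar>Re z\<bar> = \<bar>Im z\<bar>"
    show "norm (H z) \<le> \<bar>B\<bar> + \<bar>C\<bar> + norm g0 + norm g1"
    proof (cases "norm z \<le> r")
      case True
      thus ?thesis using B[of z] norm_ge_zero[of g0] norm_ge_zero[of g1] by linarith
    next
      case False
      hence z1: "norm z \<ge> 1" "norm z \<ge> r0" by (auto simp: r_def)
      have "norm (F z) \<le> norm (G z) + norm g0 + norm (g1 * z)"
        unfolding F_def by (meson add_mono norm_triangle_ineq4 order_refl order_trans)
      also have "\<dots> \<le> C * (norm z)\<^sup>2 + norm g0 * (norm z)\<^sup>2 + norm g1 * (norm z)\<^sup>2"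
      proof -
        have "norm z \<le> (norm z)\<^sup>2" "1 \<le> (norm z)\<^sup>2" using z1 self_le_power[of "norm z" 2] one_le_power[of "norm z" 2] by auto
        thus ?thesis using ray[OF z z1(2)]
          by (intro add_mono) (auto simp: norm_mult mult_le_cancel_left1 intro: mult_left_mono)
      qed
      also have "\<dots> = (C + norm g0 + norm g1) * (norm z)\<^sup>2" by (simp add: algebra_simps)
      finally have "(norm z)\<^sup>2 * norm (H z) \<le> (norm z)\<^sup>2 * (C + norm g0 + norm g1)"
        by (simp add: H(2) norm_mult norm_power mult.commute)
      hence "norm (H z) \<le> C + norm g0 + norm g1"
        using z1 by (subst (asm) mult_le_cancel_left_pos) auto
      thus ?thesis by linarith
    qed
  qed
  hence "G z = g0 + g1 * z + H 0 * z\<^sup>2" for z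
    using H(2)[of z] by (simp add: F_def algebra_simps)
  thus ?thesis by blast
qed

section \<open>Entire families of power series\<close>

text \<open>Growth of the moments l(x^n) of a bounded functional over a bounded interval. It is dual
  to \<open>entire_coeffs\<close>: together they make \<open>pairing\<close>, the value of l at the
  power series, converge absolutely.\<close>

definition geom_bounded :: "(nat \<Rightarrow> complex) \<Rightarrow> bool" where
  "geom_bounded m \<longleftrightarrow> (\<exists>M K. M \<ge> 0 \<and> K \<ge> 0 \<and> (\<forall>n. norm (m n) \<le> M * K ^ n))"

definition pairing :: "(nat \<Rightarrow> complex) \<Rightarrow> (nat \<Rightarrow> complex) \<Rightarrow> complex" where
  "pairing c m = (\<Sum>n. c n * m n)"

definition entire_coeffs :: "(nat \<Rightarrow> complex) \<Rightarrow> bool" where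
  "entire_coeffs c \<longleftrightarrow> (\<exists>M K. M \<ge> 0 \<and> K \<ge> 0 \<and> (\<forall>n. norm (c n) \<le> M * K ^ n / fact n))"

text \<open>The estimate is uniform in z on each disc, with constants depending on the disc. This
  gives holomorphy of pairings in z; their growth in z is estimated separately.\<close>

definition entire_family :: "(nat \<Rightarrow> complex \<Rightarrow> complex) \<Rightarrow> bool" where
  "entire_family c \<longleftrightarrow> (\<forall>n. c n holomorphic_on UNIV) \<and>
     (\<forall>r. \<exists>M K. M \<ge> 0 \<and> K \<ge> 0 \<and> (\<forall>n z. norm z \<le> r \<longrightarrow> norm (c n z) \<le> M * K ^ n / fact n))"

definition tcoeff :: "nat \<Rightarrow> (complex \<Rightarrow> complex) \<Rightarrow> complex \<Rightarrow> complex" where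
  "tcoeff j f z = (deriv ^^ j) f z / fact j"

lemma geom_bounded_power: "geom_bounded (\<lambda>n. x ^ n)"
  unfolding geom_bounded_def by (intro exI[of _ 1] exI[of _ "norm x"]) (auto simp: norm_power)

lemma summable_geom_exp: "summable (\<lambda>n. M * K ^ n / fact n * (N * L ^ n) :: real)"
proof -
  have "summable (\<lambda>n. M * N * (inverse (fact n) * (K * L) ^ n))"
    by (intro summable_mult summable_exp)
  thus ?thesis by (simp add: power_mult_distrib field_simps)
qed

lemma suminf_geom_exp: "(\<Sum>n. M * K ^ n / fact n * (N * L ^ n) :: real) = M * N * exp (K * L)"
proof -
  have "(\<lambda>n. M * N * ((K * L) ^ n /\<^sub>R fact n)) sums (M * N * exp (K * L))"
    by (intro sums_mult exp_converges)
  thus ?thesis by (simp add: sums_iff power_mult_distrib field_simps)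
qed

lemma summable_pairing:
  assumes "entire_coeffs c" "geom_bounded m"
  shows "summable (\<lambda>n. norm (c n * m n))" "summable (\<lambda>n. c n * m n)"
proof -
  obtain M K N L where b: "\<And>n. norm (c n) \<le> M * K ^ n / fact n" "M \<ge> 0" "K \<ge> 0"
      "\<And>n. norm (m n) \<le> N * L ^ n" "N \<ge> 0" "L \<ge> 0"
    using assms unfolding entire_coeffs_def geom_bounded_def by blast
  have "norm (c n * m n) \<le> M * K ^ n / fact n * (N * L ^ n)" for n
    unfolding norm_mult by (rule mult_mono) (use b in auto)
  thus "summable (\<lambda>n. norm (c n * m n))"
    by (intro summable_comparison_test'[OF summable_geom_exp[of M K N L]]) simp
  thus "summable (\<lambda>n. c n * m n)" by (rule summable_norm_cancel)
qed

lemma norm_pairing_le: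
  assumes "\<And>n. norm (c n) \<le> M * K ^ n / fact n" "M \<ge> 0" "K \<ge> 0"
    "\<And>n. norm (m n) \<le> N * L ^ n" "N \<ge> 0" "L \<ge> 0"
  shows "norm (pairing c m) \<le> M * N * exp (K * L)"
proof -
  have "norm (pairing c m) \<le> (\<Sum>n. M * K ^ n / fact n * (N * L ^ n))"
    unfolding pairing_def
  proof (rule norm_suminf_le[OF _ summable_geom_exp])
    show "norm (c n * m n) \<le> M * K ^ n / fact n * (N * L ^ n)" for n
      unfolding norm_mult by (rule mult_mono) (use assms in auto)
  qed
  thus ?thesis by (simp only: suminf_geom_exp)
qed

lemma entire_family_uniform_limit:
  assumes c: "entire_family c" and m: "geom_bounded m"
  shows "uniform_limit (ball 0 r) (\<lambda>N z. \<Sum>n<N. c n z * m n) (\<lambda>z. pairing (\<lambda>n. c n z) m) sequentially"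
proof -
  obtain M K where MK: "M \<ge> 0" "K \<ge> 0" "\<And>n z. norm z \<le> r \<Longrightarrow> norm (c n z) \<le> M * K ^ n / fact n"
    using c unfolding entire_family_def by metis
  obtain N L where NL: "\<And>n. norm (m n) \<le> N * L ^ n" "N \<ge> 0" "L \<ge> 0"
    using m unfolding geom_bounded_def by blast
  show ?thesis
    unfolding pairing_def
  proof (rule Weierstrass_m_test[OF _ summable_geom_exp[of M K N L]])
    show "norm (c n z * m n) \<le> M * K ^ n / fact n * (N * L ^ n)" if "z \<in> ball 0 r" for n z
      unfolding norm_mult by (rule mult_mono) (use MK NL that in auto)
  qed
qed

lemma holomorphic_pairing:
  assumes c: "entire_family c" and m: "geom_bounded m"
  shows "(\<lambda>z. pairing (\<lambda>n. c n z) m) holomorphic_on UNIV"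
proof -
  have "(\<lambda>z. pairing (\<lambda>n. c n z) m) holomorphic_on ball 0 r" for r
  proof (rule holomorphic_uniform_sequence)
    show "(\<lambda>z. \<Sum>n<N. c n z * m n) holomorphic_on ball 0 r" for N
      using c unfolding entire_family_def
      by (intro holomorphic_intros) (meson holomorphic_on_subset subset_UNIV)
    fix z :: complex assume z: "z \<in> ball 0 r"
    then obtain d where "d > 0" "cball z d \<subseteq> ball 0 r" by (meson open_ball open_contains_cball)
    thus "\<exists>d>0. cball z d \<subseteq> ball 0 r \<and> uniform_limit (cball z d) (\<lambda>N z. \<Sum>n<N. c n z * m n) (\<lambda>z. pairing (\<lambda>n. c n z) m) sequentially"
      using uniform_limit_on_subset[OF entire_family_uniform_limit[OF c m]] by blast
  qed auto
  hence "(\<lambda>z. pairing (\<lambda>n. c n z) m) holomorphic_on (\<Union>r. ball 0 r)"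
    by (intro holomorphic_on_UN_open) auto
  moreover have "(\<Union>r. ball 0 r) = (UNIV :: complex set)"
    by (auto simp: set_eq_iff intro: gt_ex)
  ultimately show ?thesis by simp
qed

section \<open>Taylor coefficients in the spectral parameter\<close>

lemma tcoeff_add:
  assumes "f holomorphic_on UNIV" "g holomorphic_on UNIV"
  shows "tcoeff j (\<lambda>z. f z + g z) z = tcoeff j f z + tcoeff j g z"
  by (simp add: tcoeff_def higher_deriv_add[OF assms] add_divide_distrib)

lemma tcoeff_cmult:
  assumes "f holomorphic_on UNIV"
  shows "tcoeff j (\<lambda>z. c * f z) z = c * tcoeff j f z"
  by (simp add: tcoeff_def higher_deriv_cmult[OF assms])

lemma tcoeff_zero [simp]: "tcoeff j (\<lambda>z. 0) z = 0"
  by (simp add: tcoeff_def)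

lemma tcoeff_sum:
  assumes "\<And>n. n \<in> A \<Longrightarrow> f n holomorphic_on UNIV"
  shows "tcoeff j (\<lambda>z. \<Sum>n\<in>A. f n z) z = (\<Sum>n\<in>A. tcoeff j (f n) z)"
  using assms
  by (induction A rule: infinite_finite_induct) (auto simp: tcoeff_add holomorphic_on_sum)

lemma tcoeff_mult:
  assumes "f holomorphic_on UNIV" "g holomorphic_on UNIV"
  shows "tcoeff p (\<lambda>z. f z * g z) z = (\<Sum>i\<le>p. tcoeff i f z * tcoeff (p - i) g z)"
proof -
  have "(\<Sum>i = 0..p. of_nat (p choose i) * (deriv ^^ i) f z * (deriv ^^ (p - i)) g z) / fact p
      = (\<Sum>i\<le>p. tcoeff i f z * tcoeff (p - i) g z)"
    unfolding sum_divide_distrib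
    by (rule sum.cong) (auto simp: tcoeff_def binomial_fact)
  thus ?thesis using higher_deriv_mult[OF assms open_UNIV UNIV_I, of p z]
    by (simp add: tcoeff_def)
qed

text \<open>The factors (k choose j) z^(k-j) are those of P^(j)(z)/j! for the monomial z^k.
  Therefore Taylor coefficients of P(z)U(z) are exactly the sums that occur in the condition for
  associated modes.\<close>

lemma tcoeff_power_mult:
  assumes "f holomorphic_on UNIV"
  shows "tcoeff p (\<lambda>z. z ^ k * f z) z = (\<Sum>j\<le>p. of_nat (k choose j) * z ^ (k - j) * tcoeff (p - j) f z)"
proof -
  have "tcoeff j (\<lambda>z. z ^ k) z = of_nat (k choose j) * z ^ (k - j)" for j
  proof (cases "j \<le> k")
    case True
    thus ?thesis using higher_deriv_power[of j 0 k z]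
      by (simp add: tcoeff_def) (simp add: binomial_gbinomial gbinomial_pochhammer' of_nat_diff algebra_simps)
  next
    case False
    thus ?thesis using higher_deriv_power[of j 0 k z] by (simp add: tcoeff_def pochhammer_0_left)
  qed
  thus ?thesis
    by (subst tcoeff_mult) (auto intro!: holomorphic_intros assms)
qed

text \<open>Locally uniform convergence of the partial sums allows every derivative in z to be taken
  term by term; in effect the functional commutes with Taylor expansion.\<close>

lemma tcoeff_pairing:
  assumes c: "entire_family c" and m: "geom_bounded m"
  shows "tcoeff j (\<lambda>z. pairing (\<lambda>n. c n z) m) z = pairing (\<lambda>n. tcoeff j (c n) z) m"
proof -
  have hc: "c n holomorphic_on UNIV" for n using c by (auto simp: entire_family_def)
  define r where "r = norm z + 1"
  have "(\<lambda>N. (deriv ^^ j) (\<lambda>z. \<Sum>n<N. c n z * m n) z) \<longlonglongrightarrow> (deriv ^^ j) (\<lambda>z. pairing (\<lambda>n. c n z) m) z"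
    by (rule higher_deriv_complex_uniform_limit[OF entire_family_uniform_limit[OF c m, of r]])
      (auto simp: r_def intro!: always_eventually holomorphic_intros holomorphic_on_subset[OF hc])
  from tendsto_divide[OF this tendsto_const[of "fact j"]]
  have "(\<lambda>N. tcoeff j (\<lambda>z. \<Sum>n<N. m n * c n z) z) \<longlonglongrightarrow> tcoeff j (\<lambda>z. pairing (\<lambda>n. c n z) m) z"
    by (simp add: tcoeff_def mult.commute)
  moreover have "tcoeff j (\<lambda>z. \<Sum>n<N. m n * c n z) z = (\<Sum>n<N. tcoeff j (c n) z * m n)" for N
    by (subst tcoeff_sum) (auto intro!: holomorphic_intros hc simp: tcoeff_cmult[OF hc] mult.commute)
  ultimately have "(\<lambda>n. tcoeff j (c n) z * m n) sums tcoeff j (\<lambda>z. pairing (\<lambda>n. c n z) m) z"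
    by (simp add: sums_def)
  thus ?thesis by (simp add: pairing_def sums_iff)
qed

text \<open>Cauchy's estimate on the unit circle around z loses no power of n, so the Taylor
  coefficients inherit the bound that the family satisfies on a disc with radius larger by
  1.\<close>

lemma entire_coeffs_tcoeff:
  assumes c: "entire_family c"
  shows "entire_coeffs (\<lambda>n. tcoeff j (c n) z)"
proof -
  obtain M K where MK: "M \<ge> 0" "K \<ge> 0"
      "\<And>n w. norm w \<le> norm z + 1 \<Longrightarrow> norm (c n w) \<le> M * K ^ n / fact n"
    using c unfolding entire_family_def by metis
  have hc: "c n holomorphic_on UNIV" for n using c by (auto simp: entire_family_def)
  have "norm (tcoeff j (c n) z) \<le> M * K ^ n / fact n" for n
  proof -
    have "norm ((deriv ^^ j) (c n) z) \<le> fact j * (M * K ^ n / fact n) / 1 ^ j"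
    proof (rule Cauchy_inequality)
      show "continuous_on (cball z 1) (c n)" "c n holomorphic_on ball z 1"
        using hc by (auto intro: holomorphic_on_subset holomorphic_on_imp_continuous_on continuous_on_subset)
      show "norm (c n x) \<le> M * K ^ n / fact n" if "norm (z - x) = 1" for x
        using that norm_triangle_ineq2[of x z] by (intro MK(3)) (simp add: norm_minus_commute)
    qed auto
    thus ?thesis by (simp add: tcoeff_def norm_divide divide_le_eq mult.commute)
  qed
  thus ?thesis unfolding entire_coeffs_def using MK by blast
qed

lemma entire_family_mult:
  assumes "entire_family c" "A holomorphic_on UNIV"
  shows "entire_family (\<lambda>n z. A z * c n z)"
  unfolding entire_family_def
proof (intro conjI allI)
  show "(\<lambda>z. A z * c n z) holomorphic_on UNIV" for n
    using assms by (intro holomorphic_intros) (auto simp: entire_family_def)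
  fix r :: real
  obtain M K where MK: "M \<ge> 0" "K \<ge> 0"
      "\<And>n w. norm w \<le> r \<Longrightarrow> norm (c n w) \<le> M * K ^ n / fact n"
    using assms unfolding entire_family_def by metis
  have "compact (A ` cball 0 r)"
    using assms(2) by (intro compact_continuous_image) (auto intro: holomorphic_on_imp_continuous_on holomorphic_on_subset)
  then obtain B where B: "B > 0" "\<And>z. norm z \<le> r \<Longrightarrow> norm (A z) \<le> B"
    by (metis bounded_pos compact_imp_bounded imageI mem_cball_0)
  have "norm (A z * c n z) \<le> (B * M) * K ^ n / fact n" if "norm z \<le> r" for n z
  proof -
    have "norm (A z * c n z) \<le> B * (M * K ^ n / fact n)"
      unfolding norm_mult using B MK that by (intro mult_mono) auto
    thus ?thesis by simp
  qed
  thus "\<exists>M K. M \<ge> 0 \<and> K \<ge> 0 \<and> (\<forall>n z. norm z \<le> r \<longrightarrow> norm (A z * c n z) \<le> M * K ^ n / fact n)"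
    using B MK by (intro exI[of _ "B * M"] exI[of _ K]) auto
qed

lemma entire_family_add:
  assumes "entire_family c" "entire_family d"
  shows "entire_family (\<lambda>n z. c n z + d n z)"
  unfolding entire_family_def
proof (intro conjI allI)
  show "(\<lambda>z. c n z + d n z) holomorphic_on UNIV" for n
    using assms by (intro holomorphic_intros) (auto simp: entire_family_def)
  fix r :: real
  obtain M K where MK: "M \<ge> 0" "K \<ge> 0"
      "\<And>n w. norm w \<le> r \<Longrightarrow> norm (c n w) \<le> M * K ^ n / fact n"
    using assms unfolding entire_family_def by metis
  obtain N L where NL: "N \<ge> 0" "L \<ge> 0"
      "\<And>n w. norm w \<le> r \<Longrightarrow> norm (d n w) \<le> N * L ^ n / fact n"
    using assms unfolding entire_family_def by metis
  have "norm (c n z + d n z) \<le> (M + N) * (max K L) ^ n / fact n" if "norm z \<le> r" for n z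
  proof -
    have "norm (c n z + d n z) \<le> M * K ^ n / fact n + N * L ^ n / fact n"
      using MK(3) NL(3) that norm_triangle_mono by blast
    also have "\<dots> \<le> M * (max K L) ^ n / fact n + N * (max K L) ^ n / fact n"
      using MK NL by (intro add_mono divide_right_mono mult_left_mono power_mono) auto
    finally show ?thesis by (simp add: algebra_simps add_divide_distrib)
  qed
  thus "\<exists>M K. M \<ge> 0 \<and> K \<ge> 0 \<and> (\<forall>n z. norm z \<le> r \<longrightarrow> norm (c n z + d n z) \<le> M * K ^ n / fact n)"
    using NL MK by (intro exI[of _ "M + N"] exI[of _ "max K L"]) auto
qed

lemma pairing_add:
  assumes "entire_coeffs c" "entire_coeffs d" "geom_bounded m"
  shows "pairing (\<lambda>n. c n + d n) m = pairing c m + pairing d m"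
  unfolding pairing_def using summable_pairing(2)[OF assms(1,3)] summable_pairing(2)[OF assms(2,3)]
  by (simp add: suminf_add distrib_right)

lemma pairing_cmult:
  assumes "entire_coeffs c" "geom_bounded m"
  shows "pairing (\<lambda>n. x * c n) m = x * pairing c m"
  unfolding pairing_def using summable_pairing(2)[OF assms]
  by (simp add: suminf_mult mult.assoc)

text \<open>The coefficients of the power series in \<open>x\<close> of \<open>cos (sqrt s * x)\<close> (for \<open>True\<close>) and of
  \<open>sin (sqrt s * x) / sqrt s\<close> (for \<open>False\<close>); both are entire in \<open>s\<close>.\<close>

definition trigc :: "bool \<Rightarrow> complex \<Rightarrow> nat \<Rightarrow> complex" where
  "trigc \<tau> s n = (if even n = \<tau> then (- s) ^ (n div 2) / fact n else 0)"

definition trig_factor :: "bool \<Rightarrow> complex \<Rightarrow> complex" where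
  "trig_factor \<tau> s = (if \<tau> then - s else 1)"

text \<open>Differentiation in x exchanges the two series: cos(sqrt s x) goes to -s times the other
  one, and sin(sqrt s x)/sqrt s to the first. With s in place of sqrt s everything stays
  single-valued in z.\<close>

lemma trigc_Suc: "of_nat (Suc n) * trigc \<tau> s (Suc n) = trig_factor \<tau> s * trigc (\<not> \<tau>) s n"
proof (cases "even (Suc n) = \<tau>")
  case True
  show ?thesis
  proof (cases \<tau>)
    case t: True
    with True obtain k where "n = 2 * k + 1" by (auto elim: oddE)
    thus ?thesis using t by (simp add: trigc_def trig_factor_def field_simps del: fact_Suc) (simp add: fact_Suc field_simps)
  next
    case t: False
    with True obtain k where "n = 2 * k" by (auto elim: evenE)
    thus ?thesis using t by (simp add: trigc_def trig_factor_def field_simps del: fact_Suc) (simp add: fact_Suc field_simps)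
  qed
next
  case False
  thus ?thesis by (auto simp: trigc_def)
qed

lemma norm_trigc_le: "norm (trigc \<tau> s n) \<le> (1 + sqrt (norm s)) ^ n / fact n"
proof -
  have "norm s ^ (n div 2) = sqrt (norm s) ^ (2 * (n div 2))"
    by (simp add: power_mult)
  also have "\<dots> \<le> (1 + sqrt (norm s)) ^ (2 * (n div 2))" by (intro power_mono) auto
  also have "\<dots> \<le> (1 + sqrt (norm s)) ^ n" by (intro power_increasing) auto
  finally show ?thesis
    by (auto simp: trigc_def norm_divide norm_power divide_right_mono)
qed

lemma entire_coeffs_trigc: "entire_coeffs (trigc \<tau> s)"
  unfolding entire_coeffs_def
  by (intro exI[of _ 1] exI[of _ "1 + sqrt (norm s)"]) (use norm_trigc_le in auto)

lemma norm_square_plus_sqrt: "sqrt (norm (z\<^sup>2 + of_real c)) \<le> norm z + sqrt \<bar>c\<bar>" for z :: complex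
proof (rule real_le_lsqrt)
  have "norm (z\<^sup>2 + of_real c) \<le> (norm z)\<^sup>2 + \<bar>c\<bar>"
    using norm_triangle_ineq[of "z\<^sup>2" "of_real c"] by (simp add: norm_power)
  also have "\<dots> \<le> (norm z + sqrt \<bar>c\<bar>)\<^sup>2" by (simp add: power2_sum)
  finally show "norm (z\<^sup>2 + of_real c) \<le> (norm z + sqrt \<bar>c\<bar>)\<^sup>2" .
qed auto

lemma entire_family_trigc: "entire_family (\<lambda>n z. trigc \<tau> (z\<^sup>2 + of_real c) n)"
  unfolding entire_family_def
proof (intro conjI allI)
  show "(\<lambda>z. trigc \<tau> (z\<^sup>2 + of_real c) n) holomorphic_on UNIV" for n
    unfolding trigc_def by (cases "even n = \<tau>") (auto intro!: holomorphic_intros)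
  fix r :: real
  have "norm (trigc \<tau> (z\<^sup>2 + of_real c) n) \<le> 1 * (1 + \<bar>r\<bar> + sqrt \<bar>c\<bar>) ^ n / fact n" if "norm z \<le> r" for n z
  proof -
    have "norm (trigc \<tau> (z\<^sup>2 + of_real c) n) \<le> (1 + sqrt (norm (z\<^sup>2 + of_real c))) ^ n / fact n"
      by (rule norm_trigc_le)
    also have "\<dots> \<le> (1 + \<bar>r\<bar> + sqrt \<bar>c\<bar>) ^ n / fact n"
      using norm_square_plus_sqrt[of z c] that by (intro divide_right_mono power_mono) auto
    finally show ?thesis by simp
  qed
  thus "\<exists>M K. M \<ge> 0 \<and> K \<ge> 0 \<and> (\<forall>n z. norm z \<le> r \<longrightarrow> norm (trigc \<tau> (z\<^sup>2 + of_real c) n) \<le> M * K ^ n / fact n)"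
    by (intro exI[of _ 1] exI[of _ "1 + \<bar>r\<bar> + sqrt \<bar>c\<bar>"]) auto
qed

text \<open>Although s = z^2 + c is quadratic in z, the coefficient bound involves only sqrt|s| <=
  |z| + sqrt|c|; this yields order one instead of two.\<close>

lemma exptype_trig_pairing:
  assumes "geom_bounded m"
  shows "exptype (\<lambda>z. pairing (trigc \<tau> (z\<^sup>2 + of_real c)) m)"
proof -
  obtain N L where NL: "\<And>n. norm (m n) \<le> N * L ^ n" "N \<ge> 0" "L \<ge> 0"
    using assms unfolding geom_bounded_def by blast
  show ?thesis
  proof (rule exptypeI)
    fix z :: complex
    have "norm (pairing (trigc \<tau> (z\<^sup>2 + of_real c)) m) \<le> 1 * N * exp ((1 + sqrt (norm (z\<^sup>2 + of_real c))) * L)"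
      by (rule norm_pairing_le) (use NL norm_trigc_le in auto)
    also have "\<dots> \<le> 1 * N * exp ((1 + sqrt \<bar>c\<bar> + norm z) * L)"
      using NL norm_square_plus_sqrt[of z c] by (intro mult_left_mono) (auto intro!: mult_right_mono)
    also have "\<dots> = (N * exp ((1 + sqrt \<bar>c\<bar>) * L)) * exp (L * norm z)"
      by (simp add: algebra_simps exp_add)
    finally show "norm (pairing (trigc \<tau> (z\<^sup>2 + of_real c)) m) \<le> (N * exp ((1 + sqrt \<bar>c\<bar>) * L)) * exp (L * norm z)" .
  qed (use NL in auto)
qed

lemma holomorphic_trig_pairing:
  "geom_bounded m \<Longrightarrow> (\<lambda>z. pairing (trigc \<tau> (z\<^sup>2 + of_real c)) m) holomorphic_on UNIV"
  using holomorphic_pairing[OF entire_family_trigc] by simp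

section \<open>Values on exponentials, and the trigonometric series in terms of them\<close>

definition fourier :: "(nat \<Rightarrow> complex) \<Rightarrow> complex \<Rightarrow> complex" where
  "fourier m p = pairing (\<lambda>n. (\<i> * p) ^ n / fact n) m"

text \<open>The denominators in cos(px) = (exp(ipx) + exp(-ipx))/2 and sin(px)/p = (exp(ipx) -
  exp(-ipx))/(2ip), without the common 2. \<open>trig_sign\<close> is the sign of the second
  exponential.\<close>

definition trig_norm :: "bool \<Rightarrow> complex \<Rightarrow> complex" where
  "trig_norm \<tau> p = (if \<tau> then 1 else \<i> * p)"

definition trig_sign :: "bool \<Rightarrow> complex" where
  "trig_sign \<tau> = (if \<tau> then 1 else -1)"

lemma entire_coeffs_exp: "entire_coeffs (\<lambda>n. p ^ n / fact n)"
  unfolding entire_coeffs_def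
  by (intro exI[of _ 1] exI[of _ "norm p"]) (auto simp: norm_divide norm_power)

lemma fourier_power: "fourier (\<lambda>n. x ^ n) p = exp (\<i> * p * x)"
  unfolding fourier_def pairing_def
  using exp_converges[of "\<i> * p * x"]
  by (simp add: sums_iff power_mult_distrib scaleR_conv_of_real field_simps)

lemma fourier_sums: "geom_bounded m \<Longrightarrow> (\<lambda>n. (\<i> ^ n / fact n * m n) * p ^ n) sums fourier m p"
  using summable_sums[OF summable_pairing(2)[OF entire_coeffs_exp[of "\<i> * p"]], of m]
  by (simp add: fourier_def pairing_def power_mult_distrib mult_ac)

lemma trigc_exp:
  assumes "p \<noteq> 0"
  shows "2 * trig_norm \<tau> p * trigc \<tau> (p\<^sup>2) n = (\<i> * p) ^ n / fact n + trig_sign \<tau> * ((\<i> * (- p)) ^ n / fact n)"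
proof -
  have i2: "(\<i> * p) ^ (2 * k) = (- (p\<^sup>2)) ^ k" "(- (\<i> * p)) ^ (2 * k) = (- (p\<^sup>2)) ^ k" for k
    by (simp_all add: power_mult power_mult_distrib)
  show ?thesis
  proof (cases "even n")
    case True
    then obtain k where "n = 2 * k" by (auto elim: evenE)
    thus ?thesis using i2 by (auto simp: trigc_def trig_sign_def trig_norm_def)
  next
    case False
    then obtain k where "n = Suc (2 * k)" by (auto elim: oddE)
    thus ?thesis using i2[of k] by (simp add: trigc_def trig_sign_def trig_norm_def del: fact_Suc)
  qed
qed

lemma trig_pairing_fourier:
  assumes "p \<noteq> 0" "geom_bounded m"
  shows "pairing (trigc \<tau> (p\<^sup>2)) m = (fourier m p + trig_sign \<tau> * fourier m (- p)) / (2 * trig_norm \<tau> p)"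
proof -
  have nz: "2 * trig_norm \<tau> p \<noteq> 0" using assms by (simp add: trig_norm_def)
  have "2 * trig_norm \<tau> p * pairing (trigc \<tau> (p\<^sup>2)) m = pairing (\<lambda>n. 2 * trig_norm \<tau> p * trigc \<tau> (p\<^sup>2) n) m"
    by (rule pairing_cmult[symmetric, OF entire_coeffs_trigc assms(2)])
  also have "\<dots> = fourier m p + pairing (\<lambda>n. trig_sign \<tau> * ((\<i> * (- p)) ^ n / fact n)) m"
    unfolding trigc_exp[OF assms(1)] fourier_def
  proof (rule pairing_add[OF entire_coeffs_exp _ assms(2)])
    show "entire_coeffs (\<lambda>n. trig_sign \<tau> * ((\<i> * (- p)) ^ n / fact n))"
      unfolding entire_coeffs_def
      by (intro exI[of _ 1] exI[of _ "norm p"]) (auto simp: norm_divide norm_power norm_mult trig_sign_def)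
  qed
  also have "pairing (\<lambda>n. trig_sign \<tau> * ((\<i> * (- p)) ^ n / fact n)) m = trig_sign \<tau> * fourier m (- p)"
    unfolding fourier_def by (rule pairing_cmult[OF entire_coeffs_exp assms(2)])
  finally show ?thesis using nz by (simp add: field_simps)
qed

text \<open>By \<open>trigc_Suc\<close>, the left side is the pairing with the x-derivative of the
  series of parity \<tau>.\<close>

lemma trig_pairing_fourier':
  assumes "p \<noteq> 0" "geom_bounded m"
  shows "trig_factor \<tau> (p\<^sup>2) * pairing (trigc (\<not> \<tau>) (p\<^sup>2)) m =
    \<i> * p * (fourier m p - trig_sign \<tau> * fourier m (- p)) / (2 * trig_norm \<tau> p)"
  unfolding trig_pairing_fourier[OF assms] using assms(1)
  by (cases \<tau>) (auto simp: trig_factor_def trig_norm_def trig_sign_def field_simps power2_eq_square)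

text \<open>Up to the factors i^n/n! the moments are the Taylor coefficients at 0 of p ->
  l(exp(ipx)). The value at p = 0, where division by p breaks down, is recovered by
  continuity.\<close>

lemma fourier_eq_0_imp:
  assumes "geom_bounded m" "\<And>p. p \<noteq> 0 \<Longrightarrow> fourier m p = 0"
  shows "m n = 0"
proof -
  have "isCont (fourier m) 0"
  proof -
    have "entire_family (\<lambda>n p. (\<i> * p) ^ n / fact n)"
      unfolding entire_family_def
    proof (intro conjI allI)
      fix r :: real
      show "\<exists>M K. M \<ge> 0 \<and> K \<ge> 0 \<and> (\<forall>n p. norm p \<le> r \<longrightarrow> norm ((\<i> * p) ^ n / fact n) \<le> M * K ^ n / fact n)"
        by (intro exI[of _ 1] exI[of _ "\<bar>r\<bar>"])
          (auto simp: norm_divide norm_power norm_mult intro!: divide_right_mono power_mono)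
    qed (auto intro!: holomorphic_intros)
    from holomorphic_pairing[OF this assms(1)] have "fourier m holomorphic_on UNIV"
      unfolding fourier_def .
    thus ?thesis
      by (metis UNIV_I continuous_on_eq_continuous_at holomorphic_on_imp_continuous_on open_UNIV)
  qed
  moreover have "(fourier m \<longlongrightarrow> 0) (at 0)"
    by (rule tendsto_eventually) (auto simp: eventually_at_filter assms(2))
  ultimately have "fourier m 0 = 0"
    by (metis LIM_unique isCont_def)
  hence F0: "fourier m p = 0" for p using assms(2) by (cases "p = 0") auto
  have s0: "(\<lambda>n. (\<i> ^ n / fact n * m n) * p ^ n) sums 0" for p
    using fourier_sums[OF assms(1), of p] F0 by simp
  have "\<i> ^ n / fact n * m n = 0"
  proof (rule ccontr)
    assume nz: "\<not> ?thesis"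
    have "n \<noteq> 0"
    proof
      assume "n = 0"
      thus False using nz s0[of 0] by (simp only: powser_sums_zero_iff)
    qed
    obtain s where "s > 0" "\<And>z :: complex. z \<in> cball 0 s - {0} \<Longrightarrow> (0::complex) \<noteq> 0"
    proof (rule powser_0_nonzero[of 1 0 "\<lambda>n. \<i> ^ n / fact n * m n" "\<lambda>_. 0 :: complex" n])
      show "(\<lambda>n. (\<i> ^ n / fact n * m n) * (x - 0) ^ n) sums 0" for x using s0[of x] by simp
    qed (use nz \<open>n \<noteq> 0\<close> in auto)
    moreover have "of_real s \<in> cball 0 s - {0 :: complex}" using \<open>s > 0\<close> by auto
    ultimately show False by blast
  qed
  thus ?thesis by simp
qed

section \<open>The dispersion function\<close>

text \<open>This is the growth of the H^1 norm of exp(ipx) on (-h, h). The factor 1 + |p| accounts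
  for the derivative, and 1/sqrt|Im p| for the fact that the exponential is near its maximum only
  within a distance of order 1/|Im p| from one endpoint.\<close>

definition decaying_fourier :: "real \<Rightarrow> (nat \<Rightarrow> complex) \<Rightarrow> bool" where
  "decaying_fourier h m \<longleftrightarrow> (\<exists>K\<ge>0. \<forall>p. \<bar>Im p\<bar> \<ge> 1 \<longrightarrow>
     norm (fourier m p) \<le> K * (1 + norm p) * exp (h * \<bar>Im p\<bar>) / sqrt \<bar>Im p\<bar>)"

text \<open>With A = (2s + b)^2 and B = 4spq, the product (A - B)(A + B) is a polynomial in s whose
  terms of degree four cancel, leaving 16(b - a)s^3 in front. As |A + B| <= (9 + 8) t^2, a term of
  order t must remain in A - B, whatever branches p and q are. \<open>large\<close> keeps the lower
  terms below half of the cubic one.\<close>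

lemma Rayleigh_lower_bound:
  fixes s p q :: complex and a b t :: real
  assumes p: "p\<^sup>2 = s + of_real a" and q: "q\<^sup>2 = s + of_real b" and t: "norm s = t" "t > 0"
    and ab: "0 < a" "a < b" "b \<le> t"
    and large: "\<bar>24 * b\<^sup>2 - 16 * a * b\<bar> * t\<^sup>2 + 8 * b ^ 3 * t + b ^ 4 \<le> 8 * (b - a) * t ^ 3"
  shows "norm ((2 * s + of_real b)\<^sup>2 - 4 * s * p * q) \<ge> 8 / 17 * (b - a) * t"
    "norm ((2 * s + of_real b)\<^sup>2 + 4 * s * p * q) \<le> 17 * t\<^sup>2"
proof -
  define A where "A = (2 * s + of_real b)\<^sup>2"
  define B where "B = 4 * s * p * q"
  have np: "(norm p)\<^sup>2 \<le> 2 * t" "(norm q)\<^sup>2 \<le> 2 * t"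
    using norm_triangle_ineq[of s "of_real a"] norm_triangle_ineq[of s "of_real b"] ab t
    by (auto simp flip: norm_power simp: p q)
  have nB: "norm B \<le> 8 * t\<^sup>2"
  proof -
    have "(norm p * norm q)\<^sup>2 \<le> (2 * t) * (2 * t)"
      unfolding power_mult_distrib using np t by (intro mult_mono) auto
    hence "(norm p * norm q)\<^sup>2 \<le> (2 * t)\<^sup>2" by (simp only: power2_eq_square)
    hence "norm p * norm q \<le> 2 * t" by (rule power2_le_imp_le) (use t in auto)
    hence "4 * t * (norm p * norm q) \<le> 4 * t * (2 * t)" using t by (intro mult_left_mono) auto
    thus ?thesis by (simp add: B_def norm_mult t power2_eq_square mult_ac)
  qed
  have nA: "norm A \<le> 9 * t\<^sup>2"
  proof -
    have "norm (2 * s + of_real b) \<le> 3 * t"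
      using norm_triangle_ineq[of "2 * s" "of_real b"] ab t by (simp add: norm_mult)
    hence "norm (2 * s + of_real b) ^ 2 \<le> (3 * t)\<^sup>2" by (intro power_mono) auto
    thus ?thesis by (simp add: A_def norm_power power_mult_distrib)
  qed
  have AB: "norm (A + B) \<le> 17 * t\<^sup>2" using nA nB norm_triangle_ineq[of A B] by simp
  thus "norm ((2 * s + of_real b)\<^sup>2 + 4 * s * p * q) \<le> 17 * t\<^sup>2" by (simp add: A_def B_def)
  define R where "R = of_real (24 * b\<^sup>2 - 16 * a * b) * s\<^sup>2 + of_real (8 * b ^ 3) * s + of_real (b ^ 4)"
  have "B\<^sup>2 = 16 * s\<^sup>2 * (s + of_real a) * (s + of_real b)"
    by (simp add: B_def power_mult_distrib p q)
  hence "(A - B) * (A + B) = (2 * s + of_real b) ^ 4 - 16 * s\<^sup>2 * (s + of_real a) * (s + of_real b)"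
    by (simp add: A_def algebra_simps power2_eq_square eval_nat_numeral)
  also have "\<dots> = of_real (16 * (b - a)) * s ^ 3 + R"
    unfolding R_def by (simp add: algebra_simps eval_nat_numeral)
  finally have prod: "(A - B) * (A + B) = of_real (16 * (b - a)) * s ^ 3 + R" .
  have "norm R \<le> norm (of_real (24 * b\<^sup>2 - 16 * a * b) * s\<^sup>2) + norm (of_real (8 * b ^ 3) * s) + norm (of_real (b ^ 4) :: complex)"
    unfolding R_def by (meson add_mono norm_triangle_ineq order_refl order_trans)
  also have "\<dots> = \<bar>24 * b\<^sup>2 - 16 * a * b\<bar> * t\<^sup>2 + 8 * b ^ 3 * t + b ^ 4"
    using t ab unfolding norm_mult norm_of_real norm_power by simp
  finally have nR: "norm R \<le> 8 * (b - a) * t ^ 3" using large by simp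
  have "16 * (b - a) * t ^ 3 = norm (of_real (16 * (b - a)) * s ^ 3)"
    using ab t unfolding norm_mult norm_of_real norm_power by simp
  also have "\<dots> \<le> norm ((A - B) * (A + B)) + norm R"
    unfolding prod using norm_triangle_ineq4[of "of_real (16 * (b - a)) * s ^ 3 + R" R] by simp
  finally have "8 * (b - a) * t ^ 3 \<le> norm (A - B) * norm (A + B)"
    using nR unfolding norm_mult by argo
  also have "\<dots> \<le> norm (A - B) * (17 * t\<^sup>2)" using AB by (intro mult_left_mono) auto
  finally have "t\<^sup>2 * (8 * (b - a) * t) \<le> t\<^sup>2 * (17 * norm (A - B))"
    by (simp add: power2_eq_square eval_nat_numeral mult_ac)
  hence "8 * (b - a) * t \<le> 17 * norm (A - B)"
    using t by (subst (asm) mult_le_cancel_left_pos) auto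
  thus "norm ((2 * s + of_real b)\<^sup>2 - 4 * s * p * q) \<ge> 8 / 17 * (b - a) * t"
    by (simp add: A_def B_def)
qed

text \<open>Expanded, the bracket is -(A - B) - (A + B)(x - y) + (A - B)xy. The first-order error
  carries the larger factor A + B, hence the condition relating \<delta>, U and L; the last term
  costs at most a quarter of |A - B|.\<close>

lemma bracket_lower_bound:
  fixes A B x y :: complex and L U \<delta> :: real
  assumes "norm (A - B) \<ge> L" "norm (A + B) \<le> U" "norm x \<le> \<delta>" "norm y \<le> \<delta>" "\<delta> \<le> 1 / 2" "2 * \<delta> * U \<le> L / 4" "L \<ge> 0"
  shows "norm (- A * (1 + x) * (1 - y) + B * (1 - x) * (1 + y)) \<ge> L / 2"
proof -
  have "(A - B) = - (- A * (1 + x) * (1 - y) + B * (1 - x) * (1 + y)) - (A + B) * (x - y) + (A - B) * (x * y)"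
    by (simp add: algebra_simps)
  moreover have "norm (- X - Y + Z) \<le> norm X + norm Y + norm Z" for X Y Z :: complex
    using norm_triangle_ineq[of "- X - Y" Z] norm_triangle_ineq4[of "- X" Y] by simp
  ultimately have "norm (A - B) \<le> norm (- A * (1 + x) * (1 - y) + B * (1 - x) * (1 + y)) + norm ((A + B) * (x - y)) + norm ((A - B) * (x * y))"
    by metis
  moreover have "norm ((A + B) * (x - y)) \<le> U * (2 * \<delta>)"
  proof -
    have "norm (x - y) \<le> 2 * \<delta>" using norm_triangle_ineq4[of x y] assms by simp
    thus ?thesis unfolding norm_mult using assms(2) order_trans[OF norm_ge_zero assms(2)]
      by (intro mult_mono) auto
  qed
  moreover have "norm ((A - B) * (x * y)) \<le> norm (A - B) * (1 / 4)"
  proof -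
    have "norm x * norm y \<le> (1/2) * (1/2)" using assms(3-5) by (intro mult_mono) auto
    thus ?thesis unfolding norm_mult by (intro mult_left_mono) auto
  qed
  ultimately show ?thesis using assms by (simp add: algebra_simps)
qed

lemma upper_square_root:
  fixes w :: complex
  assumes "Im w \<noteq> 0 \<or> Re w < 0"
  obtains p where "p\<^sup>2 = w" "Im p > 0" "(Im p)\<^sup>2 = (norm w - Re w) / 2"
proof -
  define p where "p = (if Im (csqrt w) > 0 then csqrt w else - csqrt w)"
  have p2: "p\<^sup>2 = w" by (simp add: p_def)
  have "(norm p)\<^sup>2 = norm w" by (simp add: p2 flip: norm_power)
  hence 1: "(Re p)\<^sup>2 + (Im p)\<^sup>2 = norm w" by (simp add: cmod_power2)
  have 2: "Re w = (Re p)\<^sup>2 - (Im p)\<^sup>2" by (simp add: p2[symmetric] power2_eq_square)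
  have i: "(Im p)\<^sup>2 = (norm w - Re w) / 2" using 1 2 by (simp add: field_simps)
  have "norm w \<noteq> Re w" 
  proof
    assume eq: "norm w = Re w"
    hence "(Im w)\<^sup>2 = 0" using cmod_power2[of w] by simp
    thus False using assms eq norm_ge_zero[of w] by auto
  qed
  hence "Im p \<noteq> 0" using i by auto
  moreover have "Im p \<ge> 0" by (auto simp: p_def)
  ultimately show ?thesis using that[of p] p2 i by auto
qed

text \<open>Only growth of the two moment sequences is assumed here. That the functional annihilates
  the modes enters later, as the orders of vanishing of \<open>num1\<close> and \<open>num2\<close>
  at the zeros of \<open>disp\<close>.\<close>

locale annihilated_moments =
  fixes h a b :: real and m1 m2 :: "nat \<Rightarrow> complex"
  assumes h: "h > 0" and a: "0 < a" and ab: "a < b"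
    and gb: "geom_bounded m1" "geom_bounded m2"
    and dec: "decaying_fourier h m1" "decaying_fourier h m2"
begin

text \<open>\<open>phi\<close>, \<open>dphi\<close>, \<open>psi\<close>, \<open>dpsi\<close> are the values at \<open>h\<close> of the potentials \<open>\<phi>\<close>, \<open>\<psi>\<close>
  of parity \<open>\<tau>\<close> and of their derivatives; \<open>A1\<close>, \<open>A2\<close>, \<open>B1\<close>, \<open>B2\<close> are the values of the functional with moments
  \<open>m1\<close>, \<open>m2\<close> at \<open>(\<phi>', 0)\<close>, \<open>(0, \<phi>)\<close>, \<open>(\<psi>, 0)\<close>, \<open>(0, \<psi>')\<close>; and \<open>num1\<close>, \<open>num2\<close> are its
  values at the two combinations \<open>U(z)\<close> whose traction at \<open>h\<close> has vanishing first, respectively second, component.\<close>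

definition phi :: "bool \<Rightarrow> complex \<Rightarrow> complex" where
  "phi \<tau> z = pairing (trigc \<tau> (z\<^sup>2 + of_real a)) (\<lambda>n. of_real h ^ n)"
definition dphi :: "bool \<Rightarrow> complex \<Rightarrow> complex" where
  "dphi \<tau> z = trig_factor \<tau> (z\<^sup>2 + of_real a) * pairing (trigc (\<not> \<tau>) (z\<^sup>2 + of_real a)) (\<lambda>n. of_real h ^ n)"
text \<open>The series is the one of parity opposite to that of \<open>phi\<close>. Then (\<phi>',
  z\<phi>) and (-z\<psi>, \<psi>') have equal parity in each component, and the conditions at -h
  repeat those at h.\<close>

definition psi :: "bool \<Rightarrow> complex \<Rightarrow> complex" where
  "psi \<tau> z = pairing (trigc (\<not> \<tau>) (z\<^sup>2 + of_real b)) (\<lambda>n. of_real h ^ n)"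
definition dpsi :: "bool \<Rightarrow> complex \<Rightarrow> complex" where
  "dpsi \<tau> z = trig_factor (\<not> \<tau>) (z\<^sup>2 + of_real b) * pairing (trigc \<tau> (z\<^sup>2 + of_real b)) (\<lambda>n. of_real h ^ n)"
definition A1 :: "bool \<Rightarrow> complex \<Rightarrow> complex" where
  "A1 \<tau> z = trig_factor \<tau> (z\<^sup>2 + of_real a) * pairing (trigc (\<not> \<tau>) (z\<^sup>2 + of_real a)) m1"
definition A2 :: "bool \<Rightarrow> complex \<Rightarrow> complex" where
  "A2 \<tau> z = pairing (trigc \<tau> (z\<^sup>2 + of_real a)) m2"
definition B1 :: "bool \<Rightarrow> complex \<Rightarrow> complex" where
  "B1 \<tau> z = pairing (trigc (\<not> \<tau>) (z\<^sup>2 + of_real b)) m1"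
definition B2 :: "bool \<Rightarrow> complex \<Rightarrow> complex" where
  "B2 \<tau> z = trig_factor (\<not> \<tau>) (z\<^sup>2 + of_real b) * pairing (trigc \<tau> (z\<^sup>2 + of_real b)) m2"
text \<open>Up to the factor \<mu>, the longitudinal and shear waves have at h the tractions (-(2z^2
  + b)\<phi>, 2z\<phi>') and (-2z\<psi>', -(2z^2 + b)\<psi>). This is their determinant; the
  coefficients in \<open>num2\<close> and \<open>num1\<close> are the columns of the adjugate, the
  latter with sign reversed.\<close>

definition disp :: "bool \<Rightarrow> complex \<Rightarrow> complex" where
  "disp \<tau> z = (2 * z\<^sup>2 + of_real b)\<^sup>2 * phi \<tau> z * psi \<tau> z + 4 * z\<^sup>2 * dphi \<tau> z * dpsi \<tau> z"
definition num1 :: "bool \<Rightarrow> complex \<Rightarrow> complex" where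
  "num1 \<tau> z = (- 2 * z * dpsi \<tau> z) * (A1 \<tau> z + z * A2 \<tau> z)
     + ((2 * z\<^sup>2 + of_real b) * phi \<tau> z) * (- z * B1 \<tau> z + B2 \<tau> z)"
definition num2 :: "bool \<Rightarrow> complex \<Rightarrow> complex" where
  "num2 \<tau> z = (- (2 * z\<^sup>2 + of_real b) * psi \<tau> z) * (A1 \<tau> z + z * A2 \<tau> z)
     + (- 2 * z * dphi \<tau> z) * (- z * B1 \<tau> z + B2 \<tau> z)"

lemmas all_defs = phi_def dphi_def psi_def dpsi_def A1_def A2_def B1_def B2_def

lemma trig_factor_entire: "(\<lambda>z. trig_factor \<tau> (z\<^sup>2 + of_real c)) holomorphic_on UNIV"
  "exptype (\<lambda>z. trig_factor \<tau> (z\<^sup>2 + of_real c))"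
proof -
  show "(\<lambda>z. trig_factor \<tau> (z\<^sup>2 + of_real c)) holomorphic_on UNIV"
    unfolding trig_factor_def by (cases \<tau>) (simp_all, intro holomorphic_intros)
  have "exptype (\<lambda>z. - (z\<^sup>2 + of_real c))"
    by (intro exptype_minus exptype_add exptype_power exptype_ident exptype_const)
  thus "exptype (\<lambda>z. trig_factor \<tau> (z\<^sup>2 + of_real c))"
    unfolding trig_factor_def by (cases \<tau>) (simp_all add: exptype_const)
qed

lemma entire:
  "phi \<tau> holomorphic_on UNIV" "dphi \<tau> holomorphic_on UNIV" "psi \<tau> holomorphic_on UNIV"
  "dpsi \<tau> holomorphic_on UNIV" "A1 \<tau> holomorphic_on UNIV" "A2 \<tau> holomorphic_on UNIV"
  "B1 \<tau> holomorphic_on UNIV" "B2 \<tau> holomorphic_on UNIV"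
  unfolding all_defs[abs_def]
  by (rule holomorphic_trig_pairing gb geom_bounded_power holomorphic_on_mult trig_factor_entire)+

lemma exptypes:
  "exptype (phi \<tau>)" "exptype (dphi \<tau>)" "exptype (psi \<tau>)" "exptype (dpsi \<tau>)"
  "exptype (A1 \<tau>)" "exptype (A2 \<tau>)" "exptype (B1 \<tau>)" "exptype (B2 \<tau>)"
  unfolding all_defs[abs_def]
  by (rule exptype_trig_pairing gb geom_bounded_power exptype_mult trig_factor_entire)+

lemma entire_disp: "disp \<tau> holomorphic_on UNIV" "num1 \<tau> holomorphic_on UNIV" "num2 \<tau> holomorphic_on UNIV"
  unfolding disp_def[abs_def] num1_def[abs_def] num2_def[abs_def] by (intro holomorphic_intros entire)+

lemma exptype_disp: "exptype (disp \<tau>)" "exptype (num1 \<tau>)" "exptype (num2 \<tau>)"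
  unfolding disp_def[abs_def] num1_def[abs_def] num2_def[abs_def]
  by (intro exptype_add exptype_mult exptype_const exptype_ident exptype_power exptype_minus exptypes)+

lemma even_in_z [simp]:
  "phi \<tau> (- z) = phi \<tau> z" "dphi \<tau> (- z) = dphi \<tau> z" "psi \<tau> (- z) = psi \<tau> z" "dpsi \<tau> (- z) = dpsi \<tau> z"
  "A1 \<tau> (- z) = A1 \<tau> z" "A2 \<tau> (- z) = A2 \<tau> z" "B1 \<tau> (- z) = B1 \<tau> z" "B2 \<tau> (- z) = B2 \<tau> z"
  "disp \<tau> (- z) = disp \<tau> z"
  by (simp_all add: all_defs disp_def)

text \<open>With \<open>p\<^sup>2 = z\<^sup>2 + a\<close>, \<open>q\<^sup>2 = z\<^sup>2 + b\<close> in the upper half plane, the leading part of the dispersion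
  function is the Rayleigh function \<open>(2z\<^sup>2 + b)\<^sup>2 - 4z\<^sup>2pq\<close>.\<close>

lemma disp_explicit:
  fixes \<tau> :: bool and z p q :: complex
  assumes p: "p\<^sup>2 = z\<^sup>2 + of_real a" "Im p > 0" and q: "q\<^sup>2 = z\<^sup>2 + of_real b" "Im q > 0"
  defines "x \<equiv> trig_sign \<tau> * exp (2 * \<i> * p * of_real h)" and "y \<equiv> trig_sign \<tau> * exp (2 * \<i> * q * of_real h)"
  shows "disp \<tau> z = exp (- \<i> * p * of_real h) * exp (- \<i> * q * of_real h) / (4 * trig_norm \<tau> p * trig_norm (\<not> \<tau>) q)
     * (- (2 * z\<^sup>2 + of_real b)\<^sup>2 * (1 + x) * (1 - y) + (4 * z\<^sup>2 * p * q) * (1 - x) * (1 + y))"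
proof -
  define \<sigma> where "\<sigma> = trig_sign \<tau>"
  have \<sigma>: "\<sigma> * \<sigma> = 1" "trig_sign (\<not> \<tau>) = - \<sigma>" by (simp_all add: \<sigma>_def trig_sign_def)
  have nz: "p \<noteq> 0" "q \<noteq> 0" using p q by auto
  define P where "P = exp (- \<i> * p * of_real h)"
  define Q where "Q = exp (- \<i> * q * of_real h)"
  have ex: "exp (\<i> * p * of_real h) = P * exp (2 * \<i> * p * of_real h)" "exp (\<i> * (- p) * of_real h) = P"
    "exp (\<i> * q * of_real h) = Q * exp (2 * \<i> * q * of_real h)" "exp (\<i> * (- q) * of_real h) = Q"
    unfolding P_def Q_def exp_add[symmetric] by (simp_all add: algebra_simps)
  have xx: "\<sigma> * x = exp (2 * \<i> * p * of_real h)" "\<sigma> * y = exp (2 * \<i> * q * of_real h)"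
    using \<sigma>(1) by (simp_all add: x_def y_def flip: \<sigma>_def mult.assoc)
  have tn: "trig_norm \<tau> p \<noteq> 0" "trig_norm (\<not> \<tau>) q \<noteq> 0" using nz by (auto simp: trig_norm_def)
  have f: "phi \<tau> z = \<sigma> * P * (1 + x) / (2 * trig_norm \<tau> p)"
    unfolding phi_def p(1)[symmetric] trig_pairing_fourier[OF nz(1) geom_bounded_power] fourier_power ex
      \<sigma>_def[symmetric] xx[symmetric]
    by (simp add: algebra_simps)
  have f': "dphi \<tau> z = - \<sigma> * \<i> * p * P * (1 - x) / (2 * trig_norm \<tau> p)"
    unfolding dphi_def p(1)[symmetric] trig_pairing_fourier'[OF nz(1) geom_bounded_power] fourier_power ex
      \<sigma>_def[symmetric] xx[symmetric]
    by (simp add: algebra_simps)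
  have g: "psi \<tau> z = - \<sigma> * Q * (1 - y) / (2 * trig_norm (\<not> \<tau>) q)"
    unfolding psi_def q(1)[symmetric] trig_pairing_fourier[OF nz(2) geom_bounded_power] fourier_power ex
      \<sigma>(2) xx[symmetric]
    by (simp add: algebra_simps)
  have g': "dpsi \<tau> z = \<sigma> * \<i> * q * Q * (1 + y) / (2 * trig_norm (\<not> \<tau>) q)"
    using trig_pairing_fourier'[OF nz(2) geom_bounded_power, of "\<not> \<tau>" "of_real h"]
    unfolding dpsi_def q(1)[symmetric] fourier_power ex
      \<sigma>(2) xx[symmetric]
    by (simp add: algebra_simps)
  have s2: "\<sigma> * (\<sigma> * w) = w" for w using \<sigma>(1) by (simp flip: mult.assoc)
  show ?thesis
    unfolding disp_def f f' g g' P_def[symmetric] Q_def[symmetric]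
    using tn by (simp add: divide_simps) (simp add: algebra_simps s2 power2_eq_square)
qed

text \<open>The factor exp(h Im p)/|trig_norm| is kept explicit on the right, since it also occurs
  in \<open>disp\<close> and cancels in the quotients.\<close>

lemma trig_bounds:
  assumes p: "Im p \<ge> 1" and m: "geom_bounded m"
    and K: "norm (fourier m p) \<le> K * exp (h * Im p)" "norm (fourier m (- p)) \<le> K * exp (h * Im p)"
  shows "norm (pairing (trigc \<tau> (p\<^sup>2)) m) \<le> K * (exp (h * Im p) / norm (trig_norm \<tau> p))"
    "norm (trig_factor \<tau> (p\<^sup>2) * pairing (trigc (\<not> \<tau>) (p\<^sup>2)) m) \<le> norm p * K * (exp (h * Im p) / norm (trig_norm \<tau> p))"
proof -
  have nz: "p \<noteq> 0" using p by auto
  hence tn: "norm (trig_norm \<tau> p) > 0" by (simp add: trig_norm_def)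
  have ns: "norm (trig_sign \<tau>) = 1" by (simp add: trig_sign_def)
  have "norm (fourier m p + trig_sign \<tau> * fourier m (- p)) \<le> 2 * (K * exp (h * Im p))"
    using norm_triangle_ineq[of "fourier m p" "trig_sign \<tau> * fourier m (- p)"] K by (simp add: norm_mult ns)
  hence "norm (fourier m p + trig_sign \<tau> * fourier m (- p)) / (2 * norm (trig_norm \<tau> p))
      \<le> 2 * (K * exp (h * Im p)) / (2 * norm (trig_norm \<tau> p))" by (intro divide_right_mono) auto
  thus "norm (pairing (trigc \<tau> (p\<^sup>2)) m) \<le> K * (exp (h * Im p) / norm (trig_norm \<tau> p))"
    unfolding trig_pairing_fourier[OF nz m] by (simp add: norm_divide norm_mult)
  have "norm (fourier m p - trig_sign \<tau> * fourier m (- p)) \<le> 2 * (K * exp (h * Im p))"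
    using norm_triangle_ineq4[of "fourier m p" "trig_sign \<tau> * fourier m (- p)"] K by (simp add: norm_mult ns)
  hence "norm p * norm (fourier m p - trig_sign \<tau> * fourier m (- p)) / (2 * norm (trig_norm \<tau> p))
      \<le> norm p * (2 * (K * exp (h * Im p))) / (2 * norm (trig_norm \<tau> p))"
    by (intro divide_right_mono mult_left_mono) auto
  thus "norm (trig_factor \<tau> (p\<^sup>2) * pairing (trigc (\<not> \<tau>) (p\<^sup>2)) m) \<le> norm p * K * (exp (h * Im p) / norm (trig_norm \<tau> p))"
    unfolding trig_pairing_fourier'[OF nz m] by (simp add: norm_divide norm_mult mult.assoc)
qed

lemma power_fourier_bound:
  assumes "Im p \<ge> 0"
  shows "norm (fourier (\<lambda>n. of_real h ^ n) p) \<le> 1 * exp (h * Im p)"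
    "norm (fourier (\<lambda>n. of_real h ^ n) (- p)) \<le> 1 * exp (h * Im p)"
  using assms h by (auto simp: fourier_power algebra_simps intro: order_trans[of _ 0])

lemma moment_bounds:
  obtains K where "K \<ge> 0"
    "\<And>m p. m \<in> {m1, m2} \<Longrightarrow> Im p \<ge> 1 \<Longrightarrow> norm (fourier m p) \<le> K * (1 + norm p) / sqrt (Im p) * exp (h * Im p)"
    "\<And>m p. m \<in> {m1, m2} \<Longrightarrow> Im p \<ge> 1 \<Longrightarrow> norm (fourier m (- p)) \<le> K * (1 + norm p) / sqrt (Im p) * exp (h * Im p)"
proof -
  obtain K1 where K1: "K1 \<ge> 0" "\<And>p. \<bar>Im p\<bar> \<ge> 1 \<Longrightarrow>
     norm (fourier m1 p) \<le> K1 * (1 + norm p) * exp (h * \<bar>Im p\<bar>) / sqrt \<bar>Im p\<bar>"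
    using dec(1) unfolding decaying_fourier_def by blast
  obtain K2 where K2: "K2 \<ge> 0" "\<And>p. \<bar>Im p\<bar> \<ge> 1 \<Longrightarrow>
     norm (fourier m2 p) \<le> K2 * (1 + norm p) * exp (h * \<bar>Im p\<bar>) / sqrt \<bar>Im p\<bar>"
    using dec(2) unfolding decaying_fourier_def by blast
  have *: "norm (fourier m p) \<le> (K1 + K2) * (1 + norm p) / sqrt \<bar>Im p\<bar> * exp (h * \<bar>Im p\<bar>)"
    if "m \<in> {m1, m2}" "\<bar>Im p\<bar> \<ge> 1" for m p
  proof -
    have "K1 * ((1 + norm p) * exp (h * \<bar>Im p\<bar>) / sqrt \<bar>Im p\<bar>) \<le> (K1 + K2) * ((1 + norm p) * exp (h * \<bar>Im p\<bar>) / sqrt \<bar>Im p\<bar>)"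
      "K2 * ((1 + norm p) * exp (h * \<bar>Im p\<bar>) / sqrt \<bar>Im p\<bar>) \<le> (K1 + K2) * ((1 + norm p) * exp (h * \<bar>Im p\<bar>) / sqrt \<bar>Im p\<bar>)"
      using K1 K2 by (intro mult_right_mono; simp)+
    thus ?thesis using K1(2)[OF that(2)] K2(2)[OF that(2)] that(1) by auto
  qed
  show ?thesis
  proof (rule that[of "K1 + K2"])
    fix m p assume "m \<in> {m1, m2}" "Im p \<ge> 1"
    thus "norm (fourier m p) \<le> (K1 + K2) * (1 + norm p) / sqrt (Im p) * exp (h * Im p)"
        "norm (fourier m (- p)) \<le> (K1 + K2) * (1 + norm p) / sqrt (Im p) * exp (h * Im p)"
      using *[of m p] *[of m "- p"] by auto
  qed (use K1(1) K2(1) in auto)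
qed

text \<open>Both roots being far from the real axis, the quantities x and y of
  \<open>disp_explicit\<close> are negligible. Relative to the same factor
  \<open>\<Phi> * \<Psi>\<close>, \<open>disp\<close> is at least of order |z|^2 and the numerators
  are at most of order |z|^4, so the quotients grow at most quadratically.\<close>

lemma ray_bound:
  obtains r0 C where "r0 \<ge> 1" "\<And>\<tau> z. \<lbrakk>\<bar>Re z\<bar> = \<bar>Im z\<bar>; norm z \<ge> r0\<rbrakk> \<Longrightarrow> disp \<tau> z \<noteq> 0 \<and>
     norm (num1 \<tau> z) \<le> C * (norm z)\<^sup>2 * norm (disp \<tau> z) \<and> norm (num2 \<tau> z) \<le> C * (norm z)\<^sup>2 * norm (disp \<tau> z)"
proof -
  obtain K where K: "K \<ge> 0"
    "\<And>m p. m \<in> {m1, m2} \<Longrightarrow> Im p \<ge> 1 \<Longrightarrow> norm (fourier m p) \<le> K * (1 + norm p) / sqrt (Im p) * exp (h * Im p)"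
    "\<And>m p. m \<in> {m1, m2} \<Longrightarrow> Im p \<ge> 1 \<Longrightarrow> norm (fourier m (- p)) \<le> K * (1 + norm p) / sqrt (Im p) * exp (h * Im p)"
    using moment_bounds by blast
  \<comment> \<open>Bounds |x| and |y|: with |z|^2 = t and z^2 imaginary, the roots in the upper
    half plane satisfy Im p >= sqrt((t - b)/2).\<close>
  define \<delta> where "\<delta> t = exp (- 2 * h * sqrt ((t - b) / 2))" for t
  have b: "b > 0" "b - a > 0" using a ab by auto
  have "\<forall>\<^sub>F t in at_top. \<bar>24 * b\<^sup>2 - 16 * a * b\<bar> * t\<^sup>2 + 8 * b ^ 3 * t + b ^ 4 \<le> 8 * (b - a) * t ^ 3"
    using b by real_asymp
  moreover have "\<forall>\<^sub>F t in at_top. \<delta> t \<le> 1 / 2" unfolding \<delta>_def using h by real_asymp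
  moreover have "\<forall>\<^sub>F t in at_top. 2 * \<delta> t * (17 * t\<^sup>2) \<le> 8 / 17 * (b - a) * t / 4"
    unfolding \<delta>_def using h b by real_asymp
  moreover have "\<forall>\<^sub>F t in at_top. t \<ge> 2 + b" by (rule eventually_ge_at_top)
  ultimately have "\<forall>\<^sub>F t in at_top. \<bar>24 * b\<^sup>2 - 16 * a * b\<bar> * t\<^sup>2 + 8 * b ^ 3 * t + b ^ 4 \<le> 8 * (b - a) * t ^ 3 \<and>
      \<delta> t \<le> 1 / 2 \<and> 2 * \<delta> t * (17 * t\<^sup>2) \<le> 8 / 17 * (b - a) * t / 4 \<and> t \<ge> 2 + b"
    by eventually_elim auto
  then obtain T where T: "\<And>t. t \<ge> T \<Longrightarrow> \<bar>24 * b\<^sup>2 - 16 * a * b\<bar> * t\<^sup>2 + 8 * b ^ 3 * t + b ^ 4 \<le> 8 * (b - a) * t ^ 3 \<and>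
      \<delta> t \<le> 1 / 2 \<and> 2 * \<delta> t * (17 * t\<^sup>2) \<le> 8 / 17 * (b - a) * t / 4 \<and> t \<ge> 2 + b"
    unfolding eventually_at_top_linorder by blast
  define r0 where "r0 = max 1 \<bar>T\<bar>"
  \<comment> \<open>Each numerator has two products, bounded with constants 2 * 2 * 9 = 36 and 3 * 9
    = 27, of sum 63; 17/(b - a) inverts the lower bound of \<open>disp\<close>.\<close>
  define C where "C = 63 * K * (17 / (b - a))"
  show ?thesis
  proof (rule that[of r0 C])
    show "r0 \<ge> 1" by (simp add: r0_def)
    fix \<tau> and z :: complex assume ri: "\<bar>Re z\<bar> = \<bar>Im z\<bar>" and rz: "norm z \<ge> r0"
    define r where "r = norm z"
    define t where "t = r\<^sup>2"
    define s where "s = z\<^sup>2"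
    have r1: "r \<ge> 1" using rz by (simp add: r_def r0_def)
    have "t \<ge> T"
    proof -
      have "T \<le> r" using rz unfolding r_def r0_def by linarith
      also have "r \<le> r\<^sup>2" using self_le_power[of r 2] r1 by simp
      finally show ?thesis by (simp add: t_def)
    qed
    note Tt = T[OF this]
    have ns: "norm s = t" by (simp add: s_def t_def r_def norm_power)
    have "(Re z)\<^sup>2 = (Im z)\<^sup>2" using ri by (metis power2_abs)
    hence Res: "Re s = 0" by (simp add: s_def power2_eq_square)
    have Ims: "\<bar>Im s\<bar> = t" using ns Res by (metis cmod_eq_Im)
    have t0: "t > 0" using Tt b by auto
    have root: "\<exists>p. p\<^sup>2 = s + of_real c \<and> Im p \<ge> 1 \<and> exp (- 2 * h * Im p) \<le> \<delta> t \<and> norm p \<le> 2 * r"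
      if c: "0 < c" "c \<le> b" for c
    proof -
      have "Im (s + of_real c) \<noteq> 0 \<or> Re (s + of_real c) < 0" using Ims t0 by auto
      then obtain p where p: "p\<^sup>2 = s + of_real c" "Im p > 0" "(Im p)\<^sup>2 = (norm (s + of_real c) - Re (s + of_real c)) / 2"
        using upper_square_root by blast
      have "norm (s + of_real c) \<ge> \<bar>Im (s + of_real c)\<bar>" by (rule abs_Im_le_cmod)
      hence "(Im p)\<^sup>2 \<ge> (t - b) / 2" unfolding p(3) using Res Ims c by simp
      hence 1: "Im p \<ge> sqrt ((t - b) / 2)" using p(2) by (intro real_le_lsqrt) auto
      have 2: "sqrt ((t - b) / 2) \<ge> 1" using Tt by simp
      have "(norm p)\<^sup>2 = norm (s + of_real c)" by (simp add: p(1) flip: norm_power)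
      also have "\<dots> \<le> t + c" using norm_triangle_ineq[of s "of_real c"] ns c by simp
      also have "\<dots> \<le> (2 * r)\<^sup>2" using Tt c t_def by simp
      finally have "norm p \<le> 2 * r" by (rule power2_le_imp_le) (use r1 in auto)
      moreover have "exp (- 2 * h * Im p) \<le> \<delta> t" unfolding \<delta>_def using 1 h by (simp add: mult_left_mono)
      ultimately show ?thesis using p(1) order_trans[OF 2 1] by (intro exI[of _ p]) auto
    qed
    obtain p where p: "p\<^sup>2 = s + of_real a" "Im p \<ge> 1" "exp (- 2 * h * Im p) \<le> \<delta> t" "norm p \<le> 2 * r"
      using root[of a] a ab by auto
    obtain q where q: "q\<^sup>2 = s + of_real b" "Im q \<ge> 1" "exp (- 2 * h * Im q) \<le> \<delta> t" "norm q \<le> 2 * r"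
      using root[of b] b by auto
    define \<Phi> where "\<Phi> = exp (h * Im p) / norm (trig_norm \<tau> p)"
    define \<Psi> where "\<Psi> = exp (h * Im q) / norm (trig_norm (\<not> \<tau>) q)"
    have "p \<noteq> 0" "q \<noteq> 0" using p(2) q(2) by auto
    hence pos: "\<Phi> > 0" "\<Psi> > 0" by (auto simp: \<Phi>_def \<Psi>_def trig_norm_def norm_mult)
    define x where "x = trig_sign \<tau> * exp (2 * \<i> * p * of_real h)"
    define y where "y = trig_sign \<tau> * exp (2 * \<i> * q * of_real h)"
    have nxy: "norm x \<le> \<delta> t" "norm y \<le> \<delta> t" using p(3) q(3)
      by (auto simp: x_def y_def norm_mult trig_sign_def mult_ac)
    define br where "br = - (2 * s + of_real b)\<^sup>2 * (1 + x) * (1 - y) + (4 * s * p * q) * (1 - x) * (1 + y)"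
    have "norm br \<ge> (8 / 17 * (b - a) * t) / 2"
      unfolding br_def
      by (rule bracket_lower_bound[OF Rayleigh_lower_bound[OF p(1) q(1) ns t0 a ab] nxy])
        (use Tt b t0 in auto)
    moreover have "norm (disp \<tau> z) = \<Phi> * \<Psi> / 4 * norm br"
      using disp_explicit[of p z q \<tau>] p q unfolding br_def x_def y_def s_def \<Phi>_def \<Psi>_def
      by (simp add: norm_mult norm_divide mult_ac)
    ultimately have dlow: "norm (disp \<tau> z) \<ge> \<Phi> * \<Psi> * ((b - a) / 17 * r\<^sup>2)"
    proof -
      have "\<Phi> * \<Psi> * ((b - a) / 17 * r\<^sup>2) = \<Phi> * \<Psi> / 4 * ((8 / 17 * (b - a) * t) / 2)"
        by (simp add: t_def)
      also have "\<dots> \<le> \<Phi> * \<Psi> / 4 * norm br"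
        using \<open>norm br \<ge> _\<close> pos by (intro mult_left_mono) auto
      finally show ?thesis using \<open>norm (disp \<tau> z) = _\<close> by simp
    qed
    \<comment> \<open>Here 1/sqrt(Im w) is estimated by 1; its decay is exploited in
      \<open>moments_vanish\<close>.\<close>
    have mb: "norm (fourier m w) \<le> (3 * K * r) * exp (h * Im w)" "norm (fourier m (- w)) \<le> (3 * K * r) * exp (h * Im w)"
      if "m \<in> {m1, m2}" "Im w \<ge> 1" "norm w \<le> 2 * r" for m w
    proof -
      have "K * (1 + norm w) / sqrt (Im w) \<le> K * (1 + norm w) / 1"
        using K(1) that by (intro divide_left_mono) auto
      also have "\<dots> \<le> 3 * K * r"
      proof -
        have "1 + norm w \<le> 3 * r" using that r1 by auto
        from mult_left_mono[OF this K(1)] show ?thesis by simp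
      qed
      finally have "K * (1 + norm w) / sqrt (Im w) * exp (h * Im w) \<le> (3 * K * r) * exp (h * Im w)"
        by (intro mult_right_mono) auto
      thus "norm (fourier m w) \<le> (3 * K * r) * exp (h * Im w)" "norm (fourier m (- w)) \<le> (3 * K * r) * exp (h * Im w)"
        using K(2)[OF that(1,2)] K(3)[OF that(1,2)] by linarith+
    qed
    have hb: "norm (phi \<tau> z) \<le> \<Phi>" "norm (dphi \<tau> z) \<le> 2 * r * \<Phi>" "norm (psi \<tau> z) \<le> \<Psi>" "norm (dpsi \<tau> z) \<le> 2 * r * \<Psi>"
    proof -
      have f: "Im p \<ge> 0" "Im q \<ge> 0" using p q by auto
      note bp = trig_bounds[OF p(2) geom_bounded_power power_fourier_bound[OF f(1)], of \<tau>]
      note bq = trig_bounds[OF q(2) geom_bounded_power power_fourier_bound[OF f(2)], of "\<not> \<tau>"]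
      show "norm (phi \<tau> z) \<le> \<Phi>" using bp(1) p(1) by (simp add: phi_def s_def \<Phi>_def)
      show "norm (psi \<tau> z) \<le> \<Psi>" using bq(1) q(1) by (simp add: psi_def s_def \<Psi>_def)
      have "norm (dphi \<tau> z) \<le> norm p * \<Phi>" using bp(2) p(1) by (simp add: dphi_def s_def \<Phi>_def)
      also have "\<dots> \<le> 2 * r * \<Phi>" using p(4) pos by (intro mult_right_mono) auto
      finally show "norm (dphi \<tau> z) \<le> 2 * r * \<Phi>" .
      have "norm (dpsi \<tau> z) \<le> norm q * \<Psi>" using bq(2) q(1) by (simp add: dpsi_def s_def \<Psi>_def)
      also have "\<dots> \<le> 2 * r * \<Psi>" using q(4) pos by (intro mult_right_mono) auto
      finally show "norm (dpsi \<tau> z) \<le> 2 * r * \<Psi>" .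
    qed
    have lb: "norm (A1 \<tau> z) \<le> 6 * K * r\<^sup>2 * \<Phi>" "norm (A2 \<tau> z) \<le> 3 * K * r * \<Phi>"
      "norm (B1 \<tau> z) \<le> 3 * K * r * \<Psi>" "norm (B2 \<tau> z) \<le> 6 * K * r\<^sup>2 * \<Psi>"
    proof -
      note b1 = trig_bounds[OF p(2) gb(1) mb[OF _ p(2,4)], of \<tau>, simplified]
      note b2 = trig_bounds[OF p(2) gb(2) mb[OF _ p(2,4)], of \<tau>, simplified]
      note b3 = trig_bounds[OF q(2) gb(1) mb[OF _ q(2,4)], of "\<not> \<tau>", simplified]
      note b4 = trig_bounds[OF q(2) gb(2) mb[OF _ q(2,4)], of "\<not> \<tau>", simplified]
      show "norm (A2 \<tau> z) \<le> 3 * K * r * \<Phi>" using b2(1) p(1) by (simp add: A2_def s_def \<Phi>_def)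
      show "norm (B1 \<tau> z) \<le> 3 * K * r * \<Psi>" using b3(1) q(1) by (simp add: B1_def s_def \<Psi>_def)
      have "norm (A1 \<tau> z) \<le> norm p * (3 * K * r * \<Phi>)" using b1(2) p(1) by (simp add: A1_def s_def \<Phi>_def)
      also have "\<dots> \<le> 2 * r * (3 * K * r * \<Phi>)" using p(4) pos K r1 by (intro mult_right_mono) auto
      finally show "norm (A1 \<tau> z) \<le> 6 * K * r\<^sup>2 * \<Phi>" by (simp add: power2_eq_square mult_ac)
      have "norm (B2 \<tau> z) \<le> norm q * (3 * K * r * \<Psi>)" using b4(2) q(1) by (simp add: B2_def s_def \<Psi>_def)
      also have "\<dots> \<le> 2 * r * (3 * K * r * \<Psi>)" using q(4) pos K r1 by (intro mult_right_mono) auto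
      finally show "norm (B2 \<tau> z) \<le> 6 * K * r\<^sup>2 * \<Psi>" by (simp add: power2_eq_square mult_ac)
    qed
    have cA: "norm (A1 \<tau> z + z * A2 \<tau> z) \<le> 9 * K * r\<^sup>2 * \<Phi>"
    proof -
      have "norm (z * A2 \<tau> z) \<le> r * (3 * K * r * \<Phi>)"
        unfolding norm_mult r_def[symmetric] using lb(2) r1 by (intro mult_left_mono) auto
      thus ?thesis using lb(1) norm_triangle_ineq[of "A1 \<tau> z" "z * A2 \<tau> z"]
        by (simp add: power2_eq_square algebra_simps)
    qed
    have cB: "norm (- z * B1 \<tau> z + B2 \<tau> z) \<le> 9 * K * r\<^sup>2 * \<Psi>"
    proof -
      have "norm (- z * B1 \<tau> z) \<le> r * (3 * K * r * \<Psi>)"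
        unfolding norm_mult norm_minus_cancel r_def[symmetric] using lb(3) r1 by (intro mult_left_mono) auto
      thus ?thesis using lb(4) norm_triangle_ineq[of "- z * B1 \<tau> z" "B2 \<tau> z"]
        by (simp add: power2_eq_square algebra_simps)
    qed
    have cs: "norm (2 * z\<^sup>2 + of_real b) \<le> 3 * r\<^sup>2"
      using norm_triangle_ineq[of "2 * z\<^sup>2" "of_real b"] b Tt
      by (simp add: norm_mult norm_power t_def flip: r_def)
    have "norm ((- 2 * z * dpsi \<tau> z) * (A1 \<tau> z + z * A2 \<tau> z)) \<le> (2 * r * (2 * r * \<Psi>)) * (9 * K * r\<^sup>2 * \<Phi>)"
      unfolding norm_mult norm_minus_cancel using cA hb(4) r1 K pos
      by (intro mult_mono) (auto simp flip: r_def)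
    moreover have "norm (((2 * z\<^sup>2 + of_real b) * phi \<tau> z) * (- z * B1 \<tau> z + B2 \<tau> z)) \<le> (3 * r\<^sup>2 * \<Phi>) * (9 * K * r\<^sup>2 * \<Psi>)"
      unfolding norm_mult using cB cs hb(1) r1 K pos by (intro mult_mono) auto
    ultimately have n1: "norm (num1 \<tau> z) \<le> 63 * K * r ^ 4 * (\<Phi> * \<Psi>)"
      unfolding num1_def
      using norm_triangle_ineq[of "(- 2 * z * dpsi \<tau> z) * (A1 \<tau> z + z * A2 \<tau> z)" "((2 * z\<^sup>2 + of_real b) * phi \<tau> z) * (- z * B1 \<tau> z + B2 \<tau> z)"]
      by (simp add: power2_eq_square eval_nat_numeral algebra_simps)
    have "norm ((- (2 * z\<^sup>2 + of_real b) * psi \<tau> z) * (A1 \<tau> z + z * A2 \<tau> z)) \<le> (3 * r\<^sup>2 * \<Psi>) * (9 * K * r\<^sup>2 * \<Phi>)"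
      unfolding norm_mult norm_minus_cancel using cA cs hb(3) r1 K pos by (intro mult_mono) auto
    moreover have "norm ((- 2 * z * dphi \<tau> z) * (- z * B1 \<tau> z + B2 \<tau> z)) \<le> (2 * r * (2 * r * \<Phi>)) * (9 * K * r\<^sup>2 * \<Psi>)"
      unfolding norm_mult norm_minus_cancel using cB hb(2) r1 K pos
      by (intro mult_mono) (auto simp flip: r_def)
    ultimately have n2: "norm (num2 \<tau> z) \<le> 63 * K * r ^ 4 * (\<Phi> * \<Psi>)"
      unfolding num2_def
      using norm_triangle_ineq[of "(- (2 * z\<^sup>2 + of_real b) * psi \<tau> z) * (A1 \<tau> z + z * A2 \<tau> z)" "(- 2 * z * dphi \<tau> z) * (- z * B1 \<tau> z + B2 \<tau> z)"]
      by (simp add: power2_eq_square eval_nat_numeral algebra_simps)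
    have "63 * K * r ^ 4 * (\<Phi> * \<Psi>) = C * r\<^sup>2 * (\<Phi> * \<Psi> * ((b - a) / 17 * r\<^sup>2))"
      using b by (simp add: C_def power2_eq_square eval_nat_numeral)
    also have "\<dots> \<le> C * r\<^sup>2 * norm (disp \<tau> z)"
      using dlow K b by (intro mult_left_mono) (auto simp: C_def)
    finally have "63 * K * r ^ 4 * (\<Phi> * \<Psi>) \<le> C * (norm z)\<^sup>2 * norm (disp \<tau> z)" by (simp add: r_def)
    moreover have "\<Phi> * \<Psi> * ((b - a) / 17 * r\<^sup>2) > 0" using pos b r1 by auto
    ultimately show "disp \<tau> z \<noteq> 0 \<and>
     norm (num1 \<tau> z) \<le> C * (norm z)\<^sup>2 * norm (disp \<tau> z) \<and> norm (num2 \<tau> z) \<le> C * (norm z)\<^sup>2 * norm (disp \<tau> z)"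
      using n1 n2 dlow by auto
  qed
qed

end

text \<open>Dividing by y^2 isolates \<alpha> in the limit; once it is zero, dividing by y isolates
  \<beta>, and then \<gamma> remains.\<close>

lemma quadratic_growth_vanishes:
  fixes u v w :: "real \<Rightarrow> complex" and \<alpha> \<beta> \<gamma> :: complex
  assumes u: "(u \<longlongrightarrow> u0) at_top" and v: "(v \<longlongrightarrow> v0) at_top" and w: "(w \<longlongrightarrow> w0) at_top"
    and nz: "u0 \<noteq> 0" "v0 \<noteq> 0" "w0 \<noteq> 0"
    and lim: "((\<lambda>y. of_real (y\<^sup>2) * \<alpha> * u y + of_real y * \<beta> * v y + \<gamma> * w y) \<longlongrightarrow> 0) at_top"
  shows "\<alpha> = 0" "\<beta> = 0" "\<gamma> = 0"
proof -
  have i1: "((\<lambda>y :: real. of_real (1 / y) :: complex) \<longlongrightarrow> of_real 0) at_top"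
    by (intro tendsto_of_real) real_asymp
  have i2: "((\<lambda>y :: real. of_real (1 / y\<^sup>2) :: complex) \<longlongrightarrow> of_real 0) at_top"
    by (intro tendsto_of_real) real_asymp
  have uniq: "l = l'" if "(g \<longlongrightarrow> l') at_top" "(f \<longlongrightarrow> l) at_top" "\<forall>\<^sub>F y in at_top. f y = g y"
    for f g :: "real \<Rightarrow> complex" and l l'
    using tendsto_cong[OF that(3), of l] that(1,2) tendsto_unique[OF trivial_limit_at_top_linorder] by blast
  have ev: "\<forall>\<^sub>F y :: real in at_top. y > 0" by (rule eventually_gt_at_top)
  have "((\<lambda>y. of_real (1 / y\<^sup>2) * (of_real (y\<^sup>2) * \<alpha> * u y + of_real y * \<beta> * v y + \<gamma> * w y)) \<longlongrightarrow> of_real 0 * 0) at_top"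
    by (intro tendsto_mult i2 lim)
  moreover have "((\<lambda>y. \<alpha> * u y + of_real (1 / y) * (\<beta> * v y) + of_real (1 / y\<^sup>2) * (\<gamma> * w y))
      \<longlongrightarrow> \<alpha> * u0 + of_real 0 * (\<beta> * v0) + of_real 0 * (\<gamma> * w0)) at_top"
    by (intro tendsto_intros i1 i2 u v w)
  moreover have "\<forall>\<^sub>F y in at_top. \<alpha> * u y + of_real (1 / y) * (\<beta> * v y) + of_real (1 / y\<^sup>2) * (\<gamma> * w y)
      = of_real (1 / y\<^sup>2) * (of_real (y\<^sup>2) * \<alpha> * u y + of_real y * \<beta> * v y + \<gamma> * w y)"
    using ev by eventually_elim (simp add: field_simps power2_eq_square)
  ultimately have "\<alpha> * u0 + of_real 0 * (\<beta> * v0) + of_real 0 * (\<gamma> * w0) = of_real 0 * 0"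
    by (intro uniq)
  thus \<alpha>: "\<alpha> = 0" using nz by simp
  have "((\<lambda>y. of_real (1 / y) * (of_real (y\<^sup>2) * \<alpha> * u y + of_real y * \<beta> * v y + \<gamma> * w y)) \<longlongrightarrow> of_real 0 * 0) at_top"
    by (intro tendsto_mult i1 lim)
  moreover have "((\<lambda>y. \<beta> * v y + of_real (1 / y) * (\<gamma> * w y)) \<longlongrightarrow> \<beta> * v0 + of_real 0 * (\<gamma> * w0)) at_top"
    by (intro tendsto_intros i1 v w)
  moreover have "\<forall>\<^sub>F y in at_top. \<beta> * v y + of_real (1 / y) * (\<gamma> * w y)
      = of_real (1 / y) * (of_real (y\<^sup>2) * \<alpha> * u y + of_real y * \<beta> * v y + \<gamma> * w y)"
    using ev by eventually_elim (simp add: field_simps \<alpha>)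
  ultimately have "\<beta> * v0 + of_real 0 * (\<gamma> * w0) = of_real 0 * 0"
    by (intro uniq)
  thus \<beta>: "\<beta> = 0" using nz by simp
  have "((\<lambda>y. \<gamma> * w y) \<longlongrightarrow> \<gamma> * w0) at_top" by (intro tendsto_intros w)
  moreover have "((\<lambda>y. \<gamma> * w y) \<longlongrightarrow> 0) at_top" using lim by (simp add: \<alpha> \<beta>)
  ultimately have "\<gamma> * w0 = 0" by (intro uniq) auto
  thus "\<gamma> = 0" using nz by simp
qed

context annihilated_moments
begin

lemma quotient_quadratic:
  assumes num: "N \<in> {num1 \<tau>, num2 \<tau>}"
    and ord: "\<And>\<xi> m i. (\<And>i. i < m \<Longrightarrow> (deriv ^^ i) (disp \<tau>) \<xi> = 0) \<Longrightarrow> i < m \<Longrightarrow> (deriv ^^ i) N \<xi> = 0"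
  obtains g0 g1 g2 where "\<And>z. N z = (g0 + g1 * z + g2 * z\<^sup>2) * disp \<tau> z"
proof -
  obtain r0 C where rC: "r0 \<ge> 1" "\<And>z. \<lbrakk>\<bar>Re z\<bar> = \<bar>Im z\<bar>; norm z \<ge> r0\<rbrakk> \<Longrightarrow> disp \<tau> z \<noteq> 0 \<and>
     norm (num1 \<tau> z) \<le> C * (norm z)\<^sup>2 * norm (disp \<tau> z) \<and> norm (num2 \<tau> z) \<le> C * (norm z)\<^sup>2 * norm (disp \<tau> z)"
    by (rule ray_bound) metis
  have hN: "N holomorphic_on UNIV" "exptype N" using num entire_disp exptype_disp by auto
  \<comment> \<open>A point of a ray beyond r0, which shows that \<open>disp\<close> is not
    identically zero.\<close>
  define w0 where "w0 = of_real r0 * (1 + \<i>)"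
  have "norm w0 \<ge> \<bar>Re w0\<bar>" by (rule abs_Re_le_cmod)
  hence "disp \<tau> w0 \<noteq> 0" using rC(2)[of w0] rC(1) by (simp add: w0_def)
  then obtain q where q: "q holomorphic_on UNIV" "\<And>z. N z = q z * disp \<tau> z"
    using entire_quotient[OF hN(1) entire_disp(1)] ord by metis
  have "exptype q"
  proof (rule exptype_quotient[OF q(1) entire_disp(1) \<open>disp \<tau> w0 \<noteq> 0\<close> exptype_disp(1)])
    show "exptype (\<lambda>z. q z * disp \<tau> z)" using hN(2) q(2) by (simp flip: q(2))
  qed
  moreover have "norm (q z) \<le> C * (norm z)\<^sup>2" if "\<bar>Re z\<bar> = \<bar>Im z\<bar>" "norm z \<ge> r0" for z
  proof -
    have "norm (N z) \<le> C * (norm z)\<^sup>2 * norm (disp \<tau> z)" "disp \<tau> z \<noteq> 0"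
      using rC(2)[OF that] num by auto
    thus ?thesis by (simp add: q(2) norm_mult)
  qed
  ultimately obtain g0 g1 g2 where "\<And>z. q z = g0 + g1 * z + g2 * z\<^sup>2"
    using exptype_quadratic_on_rays[OF q(1), of r0 C] by blast
  thus ?thesis using that q(2) by metis
qed

text \<open>All auxiliary functions are even in z, so the even and odd parts of the two identities
  between numerator and polynomial times \<open>disp\<close> give four linear equations. Eliminating
  \<open>B1\<close> and \<open>B2\<close> leaves \<open>A1\<close> and \<open>A2\<close> as explicit
  combinations of \<open>phi\<close> and \<open>dphi\<close>; growth along the imaginary axis then
  excludes every coefficient.\<close>

lemma moments_vanish:
  assumes ord1: "\<And>\<tau> \<xi> m i. (\<And>i. i < m \<Longrightarrow> (deriv ^^ i) (disp \<tau>) \<xi> = 0) \<Longrightarrow> i < m \<Longrightarrow> (deriv ^^ i) (num1 \<tau>) \<xi> = 0"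
    and ord2: "\<And>\<tau> \<xi> m i. (\<And>i. i < m \<Longrightarrow> (deriv ^^ i) (disp \<tau>) \<xi> = 0) \<Longrightarrow> i < m \<Longrightarrow> (deriv ^^ i) (num2 \<tau>) \<xi> = 0"
  shows "m1 n = 0" "m2 n = 0"
proof -
  have main: "A1 \<tau> z = 0 \<and> A2 \<tau> z = 0" for \<tau> z
  proof -
    obtain g0 g1 g2 where g: "\<And>z. num1 \<tau> z = (g0 + g1 * z + g2 * z\<^sup>2) * disp \<tau> z"
      by (rule quotient_quadratic[of "num1 \<tau>" \<tau>, OF _ ord1]) auto
    obtain k0 k1 k2 where k: "\<And>z. num2 \<tau> z = (k0 + k1 * z + k2 * z\<^sup>2) * disp \<tau> z"
      by (rule quotient_quadratic[of "num2 \<tau>" \<tau>, OF _ ord2]) auto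
    \<comment> \<open>The outcome of Cramer's rule: the pair of equations for \<open>A2\<close>,
      \<open>B2\<close> has determinant \<open>disp\<close>, the pair for \<open>A1\<close>,
      \<open>B1\<close> has determinant -\<open>disp\<close>, and this factor cancels against the
      right-hand sides.\<close>
    define E2 where "E2 z = A2 \<tau> z + 2 * dphi \<tau> z * (g0 + g2 * z\<^sup>2) + (2 * z\<^sup>2 + of_real b) * phi \<tau> z * k1" for z
    define E1 where "E1 z = A1 \<tau> z + 2 * z\<^sup>2 * dphi \<tau> z * g1 + (2 * z\<^sup>2 + of_real b) * phi \<tau> z * (k0 + k2 * z\<^sup>2)" for z
    have gen: "E1 z = 0 \<and> E2 z = 0" if z: "z \<noteq> 0" "disp \<tau> z \<noteq> 0" for z
    proof -
      define s where "s = 2 * z\<^sup>2 + of_real b"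
      have e1: "(- 2 * z\<^sup>2 * dpsi \<tau> z) * A2 \<tau> z + s * phi \<tau> z * B2 \<tau> z = (g0 + g2 * z\<^sup>2) * disp \<tau> z"
        using g[of z] g[of "- z"] unfolding num1_def even_in_z s_def[symmetric] power2_minus
        by (simp add: power2_eq_square) (simp add: algebra_simps, algebra)
      have e2: "(- 2 * dpsi \<tau> z) * A1 \<tau> z - s * phi \<tau> z * B1 \<tau> z = g1 * disp \<tau> z"
      proof -
        have "2 * z * ((- 2 * dpsi \<tau> z) * A1 \<tau> z - s * phi \<tau> z * B1 \<tau> z) = 2 * z * (g1 * disp \<tau> z)"
          using g[of z] g[of "- z"] unfolding num1_def even_in_z s_def[symmetric] power2_minus
          by (simp add: power2_eq_square) (simp add: algebra_simps, algebra)
        thus ?thesis using z by simp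
      qed
      have e3: "- s * psi \<tau> z * A1 \<tau> z + 2 * z\<^sup>2 * dphi \<tau> z * B1 \<tau> z = (k0 + k2 * z\<^sup>2) * disp \<tau> z"
        using k[of z] k[of "- z"] unfolding num2_def even_in_z s_def[symmetric] power2_minus
        by (simp add: power2_eq_square) (simp add: algebra_simps, algebra)
      have e4: "- s * psi \<tau> z * A2 \<tau> z - 2 * dphi \<tau> z * B2 \<tau> z = k1 * disp \<tau> z"
      proof -
        have "2 * z * (- s * psi \<tau> z * A2 \<tau> z - 2 * dphi \<tau> z * B2 \<tau> z) = 2 * z * (k1 * disp \<tau> z)"
          using k[of z] k[of "- z"] unfolding num2_def even_in_z s_def[symmetric] power2_minus
          by (simp add: power2_eq_square) (simp add: algebra_simps, algebra)
        thus ?thesis using z by simp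
      qed
      have d: "disp \<tau> z = s\<^sup>2 * phi \<tau> z * psi \<tau> z + 4 * z\<^sup>2 * dphi \<tau> z * dpsi \<tau> z"
        by (simp add: disp_def s_def)
      have "disp \<tau> z * E2 z = 0"
        unfolding E2_def s_def[symmetric] using e1 e4 d by algebra
      moreover have "disp \<tau> z * E1 z = 0"
        unfolding E1_def s_def[symmetric] using e2 e3 d by algebra
      ultimately show ?thesis using z by simp
    qed
    have hE: "E1 holomorphic_on UNIV" "E2 holomorphic_on UNIV"
      unfolding E1_def E2_def by (intro holomorphic_intros entire)+
    \<comment> \<open>The elimination divides by z and by \<open>disp\<close>; the identity theorem
      extends the result from the open set where both are nonzero.\<close>
    have zeroE: "E1 z = 0" "E2 z = 0" for z
    proof -
      define S where "S = {z. z \<noteq> 0 \<and> disp \<tau> z \<noteq> 0}"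
      have "continuous_on UNIV (disp \<tau>)" using entire_disp(1) holomorphic_on_imp_continuous_on by blast
      hence "open S" unfolding S_def by (intro open_Collect_conj open_Collect_neq continuous_intros)
      obtain r0 C where rC: "r0 \<ge> 1" "\<And>z. \<lbrakk>\<bar>Re z\<bar> = \<bar>Im z\<bar>; norm z \<ge> r0\<rbrakk> \<Longrightarrow> disp \<tau> z \<noteq> 0"
        by (rule ray_bound) metis
      define w0 where "w0 = of_real r0 * (1 + \<i>)"
      have "norm w0 \<ge> \<bar>Re w0\<bar>" by (rule abs_Re_le_cmod)
      hence "w0 \<in> S" using rC(2)[of w0] rC(1) by (auto simp: w0_def S_def complex_eq_iff)
      hence ne: "S \<noteq> {}" by auto
      show "E1 z = 0"
        by (rule analytic_continuation_open[of S UNIV E1 "\<lambda>_. 0"])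
          (use \<open>open S\<close> ne hE gen in \<open>auto simp: S_def\<close>)
      show "E2 z = 0"
        by (rule analytic_continuation_open[of S UNIV E2 "\<lambda>_. 0"])
          (use \<open>open S\<close> ne hE gen in \<open>auto simp: S_def\<close>)
    qed
    obtain K where K: "K \<ge> 0"
      "\<And>m p. m \<in> {m1, m2} \<Longrightarrow> Im p \<ge> 1 \<Longrightarrow> norm (fourier m p) \<le> K * (1 + norm p) / sqrt (Im p) * exp (h * Im p)"
      "\<And>m p. m \<in> {m1, m2} \<Longrightarrow> Im p \<ge> 1 \<Longrightarrow> norm (fourier m (- p)) \<le> K * (1 + norm p) / sqrt (Im p) * exp (h * Im p)"
      using moment_bounds by blast
    define \<sigma> where "\<sigma> = trig_sign \<tau>"
    have \<sigma>: "\<sigma> * \<sigma> = 1" "norm \<sigma> = 1" by (simp_all add: \<sigma>_def trig_sign_def)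
    \<comment> \<open>For this z one has z^2 + a = (iy)^2, so \<phi> is cosh(yx) or
      sinh(yx)/y.\<close>
    define zz where "zz y = \<i> * of_real (sqrt (y\<^sup>2 + a))" for y :: real
    have zz2: "(zz y)\<^sup>2 = - of_real (y\<^sup>2 + a)" for y
      using a by (simp add: zz_def power_mult_distrib flip: of_real_power)
    \<comment> \<open>Removes the exponential growth and the prefactor of the series at h, leaving 1
      and y as the leading terms of \<open>phi\<close> and \<open>dphi\<close>.\<close>
    define W where "W y = 2 * trig_norm \<tau> (\<i> * of_real y) * \<sigma> * of_real (exp (- y * h))" for y :: real
    define E where "E y = complex_of_real (exp (- 2 * y * h))" for y
    have Wphi: "W y * phi \<tau> (zz y) = 1 + \<sigma> * E y" "W y * dphi \<tau> (zz y) = of_real y * (1 - \<sigma> * E y)"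
      and WA: "norm (W y * A2 \<tau> (zz y)) \<le> 2 * K * (1 + y) / sqrt y"
        "norm (W y * A1 \<tau> (zz y)) \<le> y * (2 * K * (1 + y) / sqrt y)" if y: "y \<ge> 1" for y
    proof -
      define p where "p = \<i> * complex_of_real y"
      have p: "p \<noteq> 0" "Im p = y" "norm p = y" using y by (auto simp: p_def norm_mult)
      have p2: "(zz y)\<^sup>2 + of_real a = p\<^sup>2" by (simp add: zz2 p_def power_mult_distrib)
      have tn: "trig_norm \<tau> p \<noteq> 0" using p by (simp add: trig_norm_def)
      have ex: "exp (\<i> * p * of_real h) = of_real (exp (- y * h))"
        by (simp add: p_def exp_of_real[symmetric])
      have ex': "exp (\<i> * - p * of_real h) = of_real (exp (y * h))"
        by (simp add: p_def exp_of_real[symmetric])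
      have ee: "of_real (exp (- y * h)) * of_real (exp (- y * h)) = E y"
        "of_real (exp (- y * h)) * of_real (exp (y * h)) = (1 :: complex)"
        by (simp_all add: E_def flip: of_real_mult exp_add)
      have "W y * phi \<tau> (zz y) = \<sigma> * (of_real (exp (- y * h)) * of_real (exp (- y * h)))
          + (\<sigma> * \<sigma>) * (of_real (exp (- y * h)) * of_real (exp (y * h)))"
        unfolding phi_def p2 trig_pairing_fourier[OF p(1) geom_bounded_power] fourier_power ex ex'
          W_def p_def[symmetric] \<sigma>_def[symmetric]
        using tn by (simp add: field_simps del: of_real_exp)
      thus "W y * phi \<tau> (zz y) = 1 + \<sigma> * E y" unfolding ee \<sigma> by simp
      have "W y * dphi \<tau> (zz y) = (\<i> * p) * (\<sigma> * (of_real (exp (- y * h)) * of_real (exp (- y * h)))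
          - (\<sigma> * \<sigma>) * (of_real (exp (- y * h)) * of_real (exp (y * h))))"
        unfolding dphi_def p2 trig_pairing_fourier'[OF p(1) geom_bounded_power] fourier_power ex ex'
          W_def p_def[symmetric] \<sigma>_def[symmetric]
        using tn by (simp add: field_simps del: of_real_exp)
      thus "W y * dphi \<tau> (zz y) = of_real y * (1 - \<sigma> * E y)" unfolding ee \<sigma>
        by (simp add: p_def algebra_simps)
      have nW: "norm (W y) = 2 * norm (trig_norm \<tau> p) * exp (- (y * h))"
        by (simp add: W_def norm_mult \<sigma> flip: p_def)
      have cancel: "norm (W y) * (X * (exp (h * Im p) / norm (trig_norm \<tau> p))) = 2 * X" for X
        unfolding nW p(2) using tn by (simp add: field_simps exp_minus)
      have "norm (A2 \<tau> (zz y)) \<le> (K * (1 + norm p) / sqrt (Im p)) * (exp (h * Im p) / norm (trig_norm \<tau> p))"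
        unfolding A2_def p2 by (rule trig_bounds(1)[OF _ gb(2)]) (use K(2,3)[of m2 p] p y in auto)
      from mult_left_mono[OF this norm_ge_zero[of "W y"]]
      show "norm (W y * A2 \<tau> (zz y)) \<le> 2 * K * (1 + y) / sqrt y"
        unfolding cancel norm_mult by (simp add: p)
      have "norm (A1 \<tau> (zz y)) \<le> norm p * (K * (1 + norm p) / sqrt (Im p)) * (exp (h * Im p) / norm (trig_norm \<tau> p))"
        unfolding A1_def p2 by (rule trig_bounds(2)[OF _ gb(1)]) (use K(2,3)[of m1 p] p y in auto)
      from mult_left_mono[OF this norm_ge_zero[of "W y"]]
      show "norm (W y * A1 \<tau> (zz y)) \<le> y * (2 * K * (1 + y) / sqrt y)"
        unfolding cancel norm_mult by (simp add: p mult_ac)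
    qed
    define R where "R y = complex_of_real (1 / y\<^sup>2)" for y
    have R: "(R \<longlongrightarrow> of_real 0) at_top" unfolding R_def by (intro tendsto_of_real) real_asymp
    have E: "(E \<longlongrightarrow> of_real 0) at_top" unfolding E_def using h by (intro tendsto_of_real) real_asymp
    \<comment> \<open>The decisive use of the square root: W A2 is at most of order sqrt y, whereas
      a nonzero g0 would contribute order y. For W A1 the corresponding orders are y^(3/2) and, from
      k0, y^2.\<close>
    have lim0: "((\<lambda>y. 2 * K * (1 + y) / sqrt y / y) \<longlongrightarrow> 0) at_top" using K(1) by real_asymp
    have ev: "\<forall>\<^sub>F y :: real in at_top. y \<ge> 1" by (rule eventually_ge_at_top)
    have R1: "of_real (y\<^sup>2) * R y = 1" if "y \<ge> 1" for y using that by (simp add: R_def)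
    have z1: "g2 = 0" "k1 = 0" "g0 = 0"
    proof -
      have lim: "((\<lambda>y. of_real (y\<^sup>2) * g2 * (2 * (1 - \<sigma> * E y) * (1 + of_real a * R y))
          + of_real y * k1 * ((2 + of_real (2 * a - b) * R y) * (1 + \<sigma> * E y)) + g0 * (- 2 * (1 - \<sigma> * E y))) \<longlongrightarrow> 0) at_top"
      proof (rule Lim_null_comparison[OF _ lim0])
        show "\<forall>\<^sub>F y in at_top. norm (of_real (y\<^sup>2) * g2 * (2 * (1 - \<sigma> * E y) * (1 + of_real a * R y))
          + of_real y * k1 * ((2 + of_real (2 * a - b) * R y) * (1 + \<sigma> * E y)) + g0 * (- 2 * (1 - \<sigma> * E y)))
          \<le> 2 * K * (1 + y) / sqrt y / y"
          using ev
        proof eventually_elim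
          case (elim y)
          have "W y * A2 \<tau> (zz y) = - 2 * (W y * dphi \<tau> (zz y)) * (g0 + g2 * (zz y)\<^sup>2)
              - (2 * (zz y)\<^sup>2 + of_real b) * (W y * phi \<tau> (zz y)) * k1"
            using zeroE(2)[of "zz y"] unfolding E2_def by algebra
          also have "\<dots> = of_real y * (of_real (y\<^sup>2) * g2 * (2 * (1 - \<sigma> * E y) * (1 + of_real a * R y))
            + of_real y * k1 * ((2 + of_real (2 * a - b) * R y) * (1 + \<sigma> * E y)) + g0 * (- 2 * (1 - \<sigma> * E y)))"
            unfolding Wphi[OF elim] zz2 using R1[OF elim] unfolding of_real_add of_real_diff of_real_mult of_real_power of_real_numeral
            by algebra
          finally have eq: "W y * A2 \<tau> (zz y) = of_real y * (of_real (y\<^sup>2) * g2 * (2 * (1 - \<sigma> * E y) * (1 + of_real a * R y))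
            + of_real y * k1 * ((2 + of_real (2 * a - b) * R y) * (1 + \<sigma> * E y)) + g0 * (- 2 * (1 - \<sigma> * E y)))" .
          have "norm (W y * A2 \<tau> (zz y)) \<le> \<bar>y\<bar> * (2 * K * (1 + y) / sqrt y / y)"
            using WA(1)[OF elim] elim by simp
          thus ?case unfolding eq norm_mult[of "of_real y"] norm_of_real
            by (rule mult_left_le_imp_le) (use elim in auto)
        qed
      qed
      have l1: "((\<lambda>y. 2 * (1 - \<sigma> * E y) * (1 + of_real a * R y)) \<longlongrightarrow> 2 * (1 - \<sigma> * of_real 0) * (1 + of_real a * of_real 0)) at_top"
        "((\<lambda>y. (2 + of_real (2 * a - b) * R y) * (1 + \<sigma> * E y)) \<longlongrightarrow> (2 + of_real (2 * a - b) * of_real 0) * (1 + \<sigma> * of_real 0)) at_top"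
        "((\<lambda>y. - 2 * (1 - \<sigma> * E y)) \<longlongrightarrow> - 2 * (1 - \<sigma> * of_real 0)) at_top"
        by (intro tendsto_intros E R)+
      show "g2 = 0" "k1 = 0" "g0 = 0" using quadratic_growth_vanishes[OF l1 _ _ _ lim] by simp_all
    qed
    have z2: "k2 = 0" "g1 = 0" "k0 = 0"
    proof -
      have lim: "((\<lambda>y. of_real (y\<^sup>2) * k2 * (- (2 + of_real (2 * a - b) * R y) * (1 + \<sigma> * E y) * (1 + of_real a * R y))
          + of_real y * g1 * (2 * (1 + of_real a * R y) * (1 - \<sigma> * E y)) + k0 * ((2 + of_real (2 * a - b) * R y) * (1 + \<sigma> * E y))) \<longlongrightarrow> 0) at_top"
      proof (rule Lim_null_comparison[OF _ lim0])
        show "\<forall>\<^sub>F y in at_top. norm (of_real (y\<^sup>2) * k2 * (- (2 + of_real (2 * a - b) * R y) * (1 + \<sigma> * E y) * (1 + of_real a * R y))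
          + of_real y * g1 * (2 * (1 + of_real a * R y) * (1 - \<sigma> * E y)) + k0 * ((2 + of_real (2 * a - b) * R y) * (1 + \<sigma> * E y)))
          \<le> 2 * K * (1 + y) / sqrt y / y"
          using ev
        proof eventually_elim
          case (elim y)
          have "W y * A1 \<tau> (zz y) = - 2 * (zz y)\<^sup>2 * (W y * dphi \<tau> (zz y)) * g1
              - (2 * (zz y)\<^sup>2 + of_real b) * (W y * phi \<tau> (zz y)) * (k0 + k2 * (zz y)\<^sup>2)"
            using zeroE(1)[of "zz y"] unfolding E1_def by algebra
          also have "\<dots> = of_real (y\<^sup>2) * (of_real (y\<^sup>2) * k2 * (- (2 + of_real (2 * a - b) * R y) * (1 + \<sigma> * E y) * (1 + of_real a * R y))
            + of_real y * g1 * (2 * (1 + of_real a * R y) * (1 - \<sigma> * E y)) + k0 * ((2 + of_real (2 * a - b) * R y) * (1 + \<sigma> * E y)))"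
            unfolding Wphi[OF elim] zz2 using R1[OF elim] unfolding of_real_add of_real_diff of_real_mult of_real_power of_real_numeral
            by algebra
          finally have eq: "W y * A1 \<tau> (zz y) = of_real (y\<^sup>2) * (of_real (y\<^sup>2) * k2 * (- (2 + of_real (2 * a - b) * R y) * (1 + \<sigma> * E y) * (1 + of_real a * R y))
            + of_real y * g1 * (2 * (1 + of_real a * R y) * (1 - \<sigma> * E y)) + k0 * ((2 + of_real (2 * a - b) * R y) * (1 + \<sigma> * E y)))" .
          have "norm (W y * A1 \<tau> (zz y)) \<le> y\<^sup>2 * (2 * K * (1 + y) / sqrt y / y)"
            using WA(2)[OF elim] elim by (simp add: power2_eq_square)
          thus ?case unfolding eq norm_mult[of "of_real (y\<^sup>2)"] norm_of_real abs_power2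
            by (rule mult_left_le_imp_le) (use elim in auto)
        qed
      qed
      have l1: "((\<lambda>y. - (2 + of_real (2 * a - b) * R y) * (1 + \<sigma> * E y) * (1 + of_real a * R y)) \<longlongrightarrow> - (2 + of_real (2 * a - b) * of_real 0) * (1 + \<sigma> * of_real 0) * (1 + of_real a * of_real 0)) at_top"
        "((\<lambda>y. 2 * (1 + of_real a * R y) * (1 - \<sigma> * E y)) \<longlongrightarrow> 2 * (1 + of_real a * of_real 0) * (1 - \<sigma> * of_real 0)) at_top"
        "((\<lambda>y. (2 + of_real (2 * a - b) * R y) * (1 + \<sigma> * E y)) \<longlongrightarrow> (2 + of_real (2 * a - b) * of_real 0) * (1 + \<sigma> * of_real 0)) at_top"
        by (intro tendsto_intros E R)+
      show "k2 = 0" "g1 = 0" "k0 = 0" using quadratic_growth_vanishes[OF l1 _ _ _ lim] by simp_all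
    qed
    show ?thesis using zeroE[of z] by (simp add: E1_def E2_def z1 z2)
  qed
  have root: "\<exists>z. z\<^sup>2 + of_real a = s" for s :: complex
    by (rule exI[of _ "csqrt (s - of_real a)"]) simp
  have v2: "pairing (trigc \<tau> s) m2 = 0" for \<tau> s
    using main[of \<tau>] root[of s] unfolding A2_def by metis
  \<comment> \<open>\<open>A1\<close> contains the factor \<open>trig_factor\<close>, which for one
    parity vanishes at s = 0 and has to be cancelled.\<close>
  have v1: "pairing (trigc \<tau> s) m1 = 0" if "s \<noteq> 0" for \<tau> s
  proof -
    obtain z where z: "z\<^sup>2 + of_real a = s" using root by blast
    have "trig_factor (\<not> \<tau>) s \<noteq> 0" using that by (simp add: trig_factor_def)
    thus ?thesis using main[of "\<not> \<tau>" z] unfolding A1_def z by simp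
  qed
  have "fourier m p = 0" if "p \<noteq> 0" "\<And>\<tau>. pairing (trigc \<tau> (p\<^sup>2)) m = 0" "geom_bounded m" for m p
    using trig_pairing_fourier[OF that(1,3), of True] trig_pairing_fourier[OF that(1,3), of False] that
    by (simp add: trig_sign_def trig_norm_def)
  thus "m1 n = 0" "m2 n = 0"
    using fourier_eq_0_imp[OF gb(1)] fourier_eq_0_imp[OF gb(2)] v1 v2 gb by auto
qed

end

section \<open>Power series as Sobolev functions\<close>

lemma set_borel_measurable_continuous:
  fixes u :: "real \<Rightarrow> 'a :: euclidean_space"
  assumes "continuous_on UNIV u"
  shows "set_borel_measurable lborel {a<..<b} u"
  unfolding set_borel_measurable_def using borel_measurable_continuous_onI[OF assms] by measurable

lemma set_integrable_continuous:
  fixes u :: "real \<Rightarrow> 'a :: euclidean_space"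
  assumes "continuous_on UNIV u"
  shows "set_integrable lborel {a<..<b} u"
proof (rule set_integrable_subset[of _ "{a..b}"])
  show "set_integrable lborel {a..b} u"
    by (rule borel_integrable_atLeastAtMost') (use assms continuous_on_subset in blast)
qed auto

lemma set_integral_continuous:
  fixes u :: "real \<Rightarrow> 'a :: euclidean_space"
  assumes "continuous_on UNIV u"
  shows "(LINT x:{a<..<b}|lborel. u x) = integral {a..b} u"
  using set_borel_integral_eq_integral(2)[OF set_integrable_continuous[OF assms]]
    integral_open_interval_real[of a b u] by metis

lemma L2_on_continuous:
  assumes "continuous_on UNIV u"
  shows "L2_on a b u"
  unfolding L2_on_def using assms
  by (auto intro!: set_borel_measurable_continuous set_integrable_continuous continuous_intros)

lemma test_fun_smooth:
  assumes "test_fun a b \<phi>"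
  shows "(\<phi> has_real_derivative deriv \<phi> x) (at x)" "continuous_on UNIV \<phi>" "continuous_on UNIV (deriv \<phi>)"
    "a \<le> b \<Longrightarrow> \<phi> a = 0" "a \<le> b \<Longrightarrow> \<phi> b = 0"
proof -
  obtain D where D: "D 0 = \<phi>" "\<And>k x. (D k has_real_derivative D (Suc k) x) (at x)"
    using assms unfolding test_fun_def by metis
  have d: "deriv \<phi> = D 1" using D(2)[of 0] by (auto simp: D(1) intro!: ext DERIV_imp_deriv)
  show "(\<phi> has_real_derivative deriv \<phi> x) (at x)" using D(2)[of 0 x] by (simp add: D(1) d)
  show "continuous_on UNIV \<phi>" using DERIV_continuous_on[of UNIV "D 0" "D 1"] D(2)[of 0] by (simp add: D(1))
  show "continuous_on UNIV (deriv \<phi>)" using DERIV_continuous_on[of UNIV "D 1" "D (Suc 1)"] D(2)[of 1] by (simp add: d)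
  obtain c d where cd: "a < c" "d < b" "\<And>x. x \<notin> {c..d} \<Longrightarrow> \<phi> x = 0"
    using assms unfolding test_fun_def by blast
  show "\<phi> a = 0" "\<phi> b = 0" using cd by auto
qed

lemma weak_deriv_on_C1:
  assumes d: "\<And>x. (u has_vector_derivative u1 x) (at x)" and c: "continuous_on UNIV u1"
  shows "weak_deriv_on a b u u1"
  unfolding weak_deriv_on_def
proof (intro allI impI)
  fix \<phi> assume t: "test_fun a b \<phi>"
  note \<phi> = test_fun_smooth[OF t]
  have cu: "continuous_on UNIV u"
    using d by (meson continuous_at_imp_continuous_on has_vector_derivative_continuous)
  show "(LINT x:{a<..<b}|lborel. deriv \<phi> x *\<^sub>R u x) = - (LINT x:{a<..<b}|lborel. \<phi> x *\<^sub>R u1 x)"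
  proof (cases "a \<le> b")
    case False
    hence "{a<..<b} = {}" by auto
    thus ?thesis by (simp add: set_lebesgue_integral_def)
  next
    case True
    have c1: "continuous_on UNIV (\<lambda>x. deriv \<phi> x *\<^sub>R u x)" "continuous_on UNIV (\<lambda>x. \<phi> x *\<^sub>R u1 x)"
      by (intro continuous_intros \<phi> cu c)+
    have "((\<lambda>x. \<phi> x *\<^sub>R u1 x + deriv \<phi> x *\<^sub>R u x) has_integral (\<phi> b *\<^sub>R u b - \<phi> a *\<^sub>R u a)) {a..b}"
    proof (rule fundamental_theorem_of_calculus[OF True])
      fix x
      have "((\<lambda>x. \<phi> x *\<^sub>R u x) has_vector_derivative (\<phi> x *\<^sub>R u1 x + deriv \<phi> x *\<^sub>R u x)) (at x)"
        by (rule has_vector_derivative_scaleR[OF \<phi>(1) d])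
      thus "((\<lambda>x. \<phi> x *\<^sub>R u x) has_vector_derivative (\<phi> x *\<^sub>R u1 x + deriv \<phi> x *\<^sub>R u x)) (at x within {a..b})"
        by (rule has_vector_derivative_at_within)
    qed
    hence "integral {a..b} (\<lambda>x. \<phi> x *\<^sub>R u1 x + deriv \<phi> x *\<^sub>R u x) = 0"
      using \<phi>(4,5)[OF True] by (simp add: has_integral_iff)
    moreover have "integral {a..b} (\<lambda>x. \<phi> x *\<^sub>R u1 x + deriv \<phi> x *\<^sub>R u x)
        = integral {a..b} (\<lambda>x. \<phi> x *\<^sub>R u1 x) + integral {a..b} (\<lambda>x. deriv \<phi> x *\<^sub>R u x)"
      by (rule integral_add) (use c1 in \<open>auto intro!: integrable_continuous_interval intro: continuous_on_subset\<close>)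
    ultimately show ?thesis
      unfolding set_integral_continuous[OF c1(1)] set_integral_continuous[OF c1(2)]
      by (simp add: eq_neg_iff_add_eq_0 add.commute)
  qed
qed

lemma H2_rep_smooth:
  assumes "\<And>x. (u has_vector_derivative u1 x) (at x)" "\<And>x. (u1 has_vector_derivative u2 x) (at x)"
    "continuous_on UNIV u2"
  shows "H2_rep a b u u1 u2"
proof -
  have c: "continuous_on UNIV u" "continuous_on UNIV u1"
    using assms by (meson continuous_at_imp_continuous_on has_vector_derivative_continuous)+
  show ?thesis
    unfolding H2_rep_def using assms c
    by (auto intro!: L2_on_continuous weak_deriv_on_C1 intro: continuous_on_subset)
qed

section \<open>Power series on the real line\<close>

definition pser :: "(nat \<Rightarrow> complex) \<Rightarrow> real \<Rightarrow> complex" where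
  "pser c x = pairing c (\<lambda>n. of_real x ^ n)"

lemma entire_coeffs_diffs:
  assumes "entire_coeffs c" shows "entire_coeffs (diffs c)"
proof -
  obtain M K where MK: "M \<ge> 0" "K \<ge> 0" "\<And>n. norm (c n) \<le> M * K ^ n / fact n"
    using assms unfolding entire_coeffs_def by blast
  have "norm (diffs c n) \<le> (M * K) * K ^ n / fact n" for n
  proof -
    have "norm (diffs c n) = real (Suc n) * norm (c (Suc n))" by (simp add: diffs_def norm_mult del: of_nat_Suc)
    also have "\<dots> \<le> real (Suc n) * (M * K ^ Suc n / fact (Suc n))" by (intro mult_left_mono MK) auto
    also have "\<dots> = (M * K) * K ^ n / fact n" by (simp add: fact_Suc del: of_nat_Suc)
    finally show ?thesis .
  qed
  thus ?thesis unfolding entire_coeffs_def using MK by (intro exI[of _ "M * K"] exI[of _ K]) auto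
qed

lemma pser_has_vector_derivative:
  assumes "entire_coeffs c"
  shows "(pser c has_vector_derivative pser (diffs c) x) (at x)"
proof -
  have "((\<lambda>x. \<Sum>n. c n * x ^ n) has_field_derivative (\<Sum>n. diffs c n * of_real x ^ n)) (at (of_real x))"
    using summable_pairing(2)[OF assms geom_bounded_power]
    by (intro termdiffs_strong_converges_everywhere) auto
  from has_vector_derivative_real_field[OF this]
  show ?thesis by (simp add: pser_def[abs_def] pairing_def)
qed

lemma continuous_on_pser: "entire_coeffs c \<Longrightarrow> continuous_on A (pser c)"
  using pser_has_vector_derivative
  by (meson continuous_at_imp_continuous_on has_vector_derivative_continuous)

text \<open>Zeros of a nonzero complex power series are isolated, but here the real points of (-h,
  h) accumulate at 0.\<close>

lemma pser_eq_0_imp: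
  assumes c: "entire_coeffs c" and h: "h > 0" and z: "\<And>x. -h < x \<Longrightarrow> x < h \<Longrightarrow> pser c x = 0"
  shows "c n = 0"
proof (rule ccontr)
  assume nz: "c n \<noteq> 0"
  define f where "f w = (\<Sum>n. c n * w ^ n)" for w
  have s: "(\<lambda>n. c n * w ^ n) sums f w" for w
    unfolding f_def by (rule summable_sums[OF summable_pairing(2)[OF c geom_bounded_power]])
  have f0: "f (of_real x) = 0" if "-h < x" "x < h" for x
    using z[OF that] by (simp add: pser_def pairing_def f_def)
  have f00: "f 0 = 0" using f0[of 0] h by simp
  have "c 0 = 0" using s[of 0] f00 by (simp only: powser_sums_zero_iff)
  hence "n > 0" using nz by (metis gr0I)
  obtain s where "s > 0" and ne: "\<And>w. w \<in> cball 0 s - {0} \<Longrightarrow> f w \<noteq> 0"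
    by (rule powser_0_nonzero[of 1 0 c f n]) (use s f00 nz \<open>n > 0\<close> in auto)
  define t where "t = min s (h / 2)"
  have t: "0 < t" "t \<le> s" "t < h" using \<open>s > 0\<close> h by (auto simp: t_def min_def)
  hence "of_real t \<in> cball 0 s - {0 :: complex}" by auto
  hence "f (of_real t) \<noteq> 0" by (rule ne)
  thus False using f0[of t] t by auto
qed

text \<open>The points of the interval where u is nonzero form an open null set, which must be
  empty.\<close>

lemma AE_zero_imp_zero:
  fixes u :: "real \<Rightarrow> 'a :: euclidean_space"
  assumes "AE x in lborel. x \<in> {a<..<b} \<longrightarrow> u x = 0" and c: "continuous_on UNIV u" and x: "x \<in> {a<..<b}"
  shows "u x = 0"
proof -
  define S where "S = {x. u x \<noteq> 0} \<inter> {a<..<b}"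
  have "open S" unfolding S_def by (intro open_Int open_Collect_neq c continuous_intros open_greaterThanLessThan)
  moreover have "S \<in> null_sets lborel"
  proof (subst AE_iff_null_sets)
    show "S \<in> sets lborel" using \<open>open S\<close> by simp
    show "AE x in lborel. x \<notin> S" using assms(1) by eventually_elim (auto simp: S_def)
  qed
  hence "negligible S" using negligible_iff_null_sets null_sets_completionI by blast
  ultimately have "S = {}" using open_not_negligible by blast
  thus ?thesis using x by (auto simp: S_def)
qed

section \<open>Vector-valued power series\<close>

definition vec2 :: "complex \<Rightarrow> complex \<Rightarrow> cvec" where
  "vec2 u v = (\<chi> i. if i = 1 then u else v)"

lemma vec2_nth [simp]: "vec2 u v $ 1 = u" "vec2 u v $ 2 = v"
  by (simp_all add: vec2_def)

lemma cvec_eq_iff: "(x :: cvec) = y \<longleftrightarrow> x $ 1 = y $ 1 \<and> x $ 2 = y $ 2"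
  by (simp add: vec_eq_iff forall_2)

lemma vec2_has_vector_derivative:
  assumes "(u has_vector_derivative u') F" "(v has_vector_derivative v') F"
  shows "((\<lambda>x. vec2 (u x) (v x)) has_vector_derivative vec2 u' v') F"
proof -
  have bl: "bounded_linear (\<lambda>x. vec2 x 0)" "bounded_linear (\<lambda>x. vec2 0 x)"
    by (intro bounded_linearI'; simp add: cvec_eq_iff)+
  have "((\<lambda>x. vec2 (u x) 0 + vec2 0 (v x)) has_vector_derivative vec2 u' 0 + vec2 0 v') F"
    by (intro has_vector_derivative_add bounded_linear.has_vector_derivative[OF bl(1)]
        bounded_linear.has_vector_derivative[OF bl(2)] assms)
  moreover have "vec2 x 0 + vec2 0 y = vec2 x y" for x y by (simp add: cvec_eq_iff)
  ultimately show ?thesis by simp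
qed

lemma continuous_on_vec2:
  assumes "continuous_on A u" "continuous_on A v"
  shows "continuous_on A (\<lambda>x. vec2 (u x) (v x))"
  unfolding vec2_def
proof (rule continuous_on_vec_lambda)
  show "continuous_on A (\<lambda>x. if i = 1 then u x else v x)" for i :: 2 using assms by (cases "i = 1") auto
qed

definition pvec :: "(nat \<Rightarrow> complex) \<Rightarrow> (nat \<Rightarrow> complex) \<Rightarrow> cfun" where
  "pvec c d x = vec2 (pser c x) (pser d x)"

lemma pvec_has_vector_derivative:
  "entire_coeffs c \<Longrightarrow> entire_coeffs d \<Longrightarrow> (pvec c d has_vector_derivative pvec (diffs c) (diffs d) x) (at x)"
  unfolding pvec_def[abs_def] by (intro vec2_has_vector_derivative pser_has_vector_derivative)

lemma continuous_on_pvec: "entire_coeffs c \<Longrightarrow> entire_coeffs d \<Longrightarrow> continuous_on A (pvec c d)"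
  unfolding pvec_def[abs_def] by (intro continuous_on_vec2 continuous_on_pser)

lemma H2_rep_pvec:
  "entire_coeffs c \<Longrightarrow> entire_coeffs d \<Longrightarrow>
    H2_rep a b (pvec c d) (pvec (diffs c) (diffs d)) (pvec (diffs (diffs c)) (diffs (diffs d)))"
  by (intro H2_rep_smooth pvec_has_vector_derivative continuous_on_pvec entire_coeffs_diffs)

lemma mat2_mult_nth: "(mat2 p q r s *v x) $ 1 = p * x $ 1 + q * x $ 2" "(mat2 p q r s *v x) $ 2 = r * x $ 1 + s * x $ 2"
  by (simp_all add: mat2_def matrix_vector_mult_def sum_2)

section \<open>Chains of associated modes\<close>

lemma PcoefI_nth:
  "PcoefI lam mu rho om k v v1 v2 x $ 1 =
    (if k = 0 then of_real (lam + 2 * mu) * v2 x $ 1 + of_real (om\<^sup>2 * rho) * v x $ 1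
     else if k = 1 then of_real (lam + mu) * v1 x $ 2 else if k = 2 then of_real mu * v x $ 1 else 0)"
  "PcoefI lam mu rho om k v v1 v2 x $ 2 =
    (if k = 0 then of_real mu * v2 x $ 2 + of_real (om\<^sup>2 * rho) * v x $ 2
     else if k = 1 then of_real (lam + mu) * v1 x $ 1 else if k = 2 then of_real (lam + 2 * mu) * v x $ 2 else 0)"
  by (simp_all add: PcoefI_def matA_def matB_def matC_def mat2_mult_nth)

lemma PcoefB_nth:
  "fst (PcoefB h lam mu k v v1) $ 1 = (if k = 0 then of_real (lam + 2 * mu) * v1 h $ 1 else if k = 1 then of_real lam * v h $ 2 else 0)"
  "fst (PcoefB h lam mu k v v1) $ 2 = (if k = 0 then of_real mu * v1 h $ 2 else if k = 1 then of_real mu * v h $ 1 else 0)"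
  "snd (PcoefB h lam mu k v v1) $ 1 = (if k = 0 then of_real (lam + 2 * mu) * v1 (- h) $ 1 else if k = 1 then of_real lam * v (- h) $ 2 else 0)"
  "snd (PcoefB h lam mu k v v1) $ 2 = (if k = 0 then of_real mu * v1 (- h) $ 2 else if k = 1 then of_real mu * v (- h) $ 1 else 0)"
  by (simp_all add: PcoefB_def matA_def matD_def mat2_mult_nth)

lemma sum_le_2: "(\<Sum>k\<le>2. f k) = f 0 + f 1 + f (2 :: nat)"
  by (simp add: eval_nat_numeral)

text \<open>The coefficient of the monomial z^k in P^(j)(z)/j!. For j > k the truncated subtraction
  makes the power 1, but the binomial is zero.\<close>

definition bcoef :: "nat \<Rightarrow> complex \<Rightarrow> nat \<Rightarrow> complex" where
  "bcoef k z j = of_nat (k choose j) * z ^ (k - j)"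

lemma PderI_nth:
  "PderI lam mu rho om j z v v1 v2 x $ 1 =
     of_real (lam + 2 * mu) * (bcoef 0 z j * v2 x $ 1) + of_real (om\<^sup>2 * rho) * (bcoef 0 z j * v x $ 1)
     + of_real (lam + mu) * (bcoef 1 z j * v1 x $ 2) + of_real mu * (bcoef 2 z j * v x $ 1)"
  "PderI lam mu rho om j z v v1 v2 x $ 2 =
     of_real mu * (bcoef 0 z j * v2 x $ 2) + of_real (om\<^sup>2 * rho) * (bcoef 0 z j * v x $ 2)
     + of_real (lam + mu) * (bcoef 1 z j * v1 x $ 1) + of_real (lam + 2 * mu) * (bcoef 2 z j * v x $ 2)"
  unfolding PderI_def sum_le_2 vector_add_component vector_smult_component PcoefI_nth bcoef_def
  by (simp_all add: algebra_simps)

lemma PderB_nth: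
  "fst (PderB h lam mu j z v v1) $ 1 = of_real (lam + 2 * mu) * (bcoef 0 z j * v1 h $ 1) + of_real lam * (bcoef 1 z j * v h $ 2)"
  "fst (PderB h lam mu j z v v1) $ 2 = of_real mu * (bcoef 0 z j * v1 h $ 2) + of_real mu * (bcoef 1 z j * v h $ 1)"
  "snd (PderB h lam mu j z v v1) $ 1 = of_real (lam + 2 * mu) * (bcoef 0 z j * v1 (- h) $ 1) + of_real lam * (bcoef 1 z j * v (- h) $ 2)"
  "snd (PderB h lam mu j z v v1) $ 2 = of_real mu * (bcoef 0 z j * v1 (- h) $ 2) + of_real mu * (bcoef 1 z j * v (- h) $ 1)"
  unfolding PderB_def sum_le_2 Let_def fst_add snd_add fst_conv snd_conv vector_add_component vector_smult_component PcoefB_nth bcoef_def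
  by (simp_all add: algebra_simps)

definition family_diffs :: "(nat \<Rightarrow> complex \<Rightarrow> complex) \<Rightarrow> nat \<Rightarrow> complex \<Rightarrow> complex" where
  "family_diffs c n z = of_nat (Suc n) * c (Suc n) z"

definition fser :: "(nat \<Rightarrow> complex \<Rightarrow> complex) \<Rightarrow> real \<Rightarrow> complex \<Rightarrow> complex" where
  "fser c x z = pser (\<lambda>n. c n z) x"

lemma entire_family_diffs:
  assumes "entire_family c" shows "entire_family (family_diffs c)"
  unfolding entire_family_def
proof (intro conjI allI)
  show "family_diffs c n holomorphic_on UNIV" for n
    using assms unfolding family_diffs_def[abs_def] entire_family_def by (intro holomorphic_intros) auto
  fix r :: real
  obtain M K where MK: "M \<ge> 0" "K \<ge> 0" "\<And>n z. norm z \<le> r \<Longrightarrow> norm (c n z) \<le> M * K ^ n / fact n"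
    using assms unfolding entire_family_def by metis
  have "norm (family_diffs c n z) \<le> (M * K) * K ^ n / fact n" if "norm z \<le> r" for n z
  proof -
    have "norm (family_diffs c n z) = real (Suc n) * norm (c (Suc n) z)"
      by (simp add: family_diffs_def norm_mult del: of_nat_Suc)
    also have "\<dots> \<le> real (Suc n) * (M * K ^ Suc n / fact (Suc n))" by (intro mult_left_mono MK that) auto
    also have "\<dots> = (M * K) * K ^ n / fact n" by (simp add: fact_Suc del: of_nat_Suc)
    finally show ?thesis .
  qed
  thus "\<exists>M K. M \<ge> 0 \<and> K \<ge> 0 \<and> (\<forall>n z. norm z \<le> r \<longrightarrow> norm (family_diffs c n z) \<le> M * K ^ n / fact n)"
    using MK by (intro exI[of _ "M * K"] exI[of _ K]) auto
qed

text \<open>Derivatives in x commute with Taylor coefficients in z, so the derivatives of a mode are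
  the Taylor coefficients of the differentiated family.\<close>

lemma diffs_tcoeff:
  assumes "entire_family c"
  shows "diffs (\<lambda>n. tcoeff j (c n) z) = (\<lambda>n. tcoeff j (family_diffs c n) z)"
  using assms unfolding diffs_def family_diffs_def[abs_def] entire_family_def
  by (simp add: tcoeff_cmult)

lemma holomorphic_fser: "entire_family c \<Longrightarrow> fser c x holomorphic_on UNIV"
  unfolding fser_def[abs_def] pser_def by (rule holomorphic_pairing[OF _ geom_bounded_power])

lemma tcoeff_fser: "entire_family c \<Longrightarrow> tcoeff j (fser c x) z = pser (\<lambda>n. tcoeff j (c n) z) x"
  unfolding fser_def[abs_def] pser_def by (rule tcoeff_pairing[OF _ geom_bounded_power])

lemma pser_zero [simp]: "pser (\<lambda>n. 0) x = 0"
  by (simp add: pser_def pairing_def)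

text \<open>In the Leibniz sum of order r + p the terms with j > p involve only the vanishing
  coefficients. What remains is the sum of order p for the shifted sequence, so a chain may start at
  the first nonzero coefficient.\<close>

lemma shifted_Leibniz:
  assumes c: "entire_family c" and r: "\<And>i n. i < r \<Longrightarrow> tcoeff i (c n) z = 0"
  shows "tcoeff (r + p) (\<lambda>z. z ^ k * fser c x z) z
    = (\<Sum>j\<le>p. bcoef k z j * pser (\<lambda>n. tcoeff (r + (p - j)) (c n) z) x)"
proof -
  have "tcoeff (r + p) (\<lambda>z. z ^ k * fser c x z) z
      = (\<Sum>j\<le>r + p. bcoef k z j * pser (\<lambda>n. tcoeff (r + p - j) (c n) z) x)"
    by (simp add: tcoeff_power_mult[OF holomorphic_fser[OF c]] tcoeff_fser[OF c] bcoef_def)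
  also have "\<dots> = (\<Sum>j\<le>p. bcoef k z j * pser (\<lambda>n. tcoeff (r + p - j) (c n) z) x)"
    by (rule sum.mono_neutral_right) (use r in auto)
  also have "\<dots> = (\<Sum>j\<le>p. bcoef k z j * pser (\<lambda>n. tcoeff (r + (p - j)) (c n) z) x)"
    by (rule sum.cong) auto
  finally show ?thesis .
qed

lemma sum_fst_nth: "fst (\<Sum>j\<in>A. f j) $ i = (\<Sum>j\<in>A. fst (f j) $ i)" for f :: "'a \<Rightarrow> cvec \<times> cvec"
  by (induction A rule: infinite_finite_induct) auto

lemma sum_snd_nth: "snd (\<Sum>j\<in>A. f j) $ i = (\<Sum>j\<in>A. snd (f j) $ i)" for f :: "'a \<Rightarrow> cvec \<times> cvec"
  by (induction A rule: infinite_finite_induct) auto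

text \<open>An entire family U(z) = (c1, c2) with interior part of P(z)U(z) identically zero and all
  four traction components constant multiples of one scalar function \<open>bd\<close>. Thus
  P(z)U(z) vanishes at \<xi> to order m as soon as \<open>bd\<close> does.\<close>

locale pencil_family =
  fixes h lam mu rho om :: real and c1 c2 :: "nat \<Rightarrow> complex \<Rightarrow> complex"
    and bd :: "complex \<Rightarrow> complex" and \<xi> :: complex and m :: nat
    and \<beta>1 \<beta>2 \<beta>3 \<beta>4 :: complex
  assumes h: "h > 0"
    and c1: "entire_family c1" and c2: "entire_family c2"
    and I1: "\<And>x z. of_real (lam + 2 * mu) * fser (family_diffs (family_diffs c1)) x z + of_real (om\<^sup>2 * rho) * fser c1 x z
       + of_real (lam + mu) * (z * fser (family_diffs c2) x z) + of_real mu * (z\<^sup>2 * fser c1 x z) = 0"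
    and I2: "\<And>x z. of_real mu * fser (family_diffs (family_diffs c2)) x z + of_real (om\<^sup>2 * rho) * fser c2 x z
       + of_real (lam + mu) * (z * fser (family_diffs c1) x z) + of_real (lam + 2 * mu) * (z\<^sup>2 * fser c2 x z) = 0"
    and bd: "bd holomorphic_on UNIV" "\<And>i. i < m \<Longrightarrow> tcoeff i bd \<xi> = 0"
    and B1: "\<And>z. of_real (lam + 2 * mu) * fser (family_diffs c1) h z + of_real lam * (z * fser c2 h z) = \<beta>1 * bd z"
    and B2: "\<And>z. of_real mu * fser (family_diffs c2) h z + of_real mu * (z * fser c1 h z) = \<beta>2 * bd z"
    and B3: "\<And>z. of_real (lam + 2 * mu) * fser (family_diffs c1) (- h) z + of_real lam * (z * fser c2 (- h) z) = \<beta>3 * bd z"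
    and B4: "\<And>z. of_real mu * fser (family_diffs c2) (- h) z + of_real mu * (z * fser c1 (- h) z) = \<beta>4 * bd z"
begin

definition V :: "nat \<Rightarrow> cfun" where
  "V j = pvec (\<lambda>n. tcoeff j (c1 n) \<xi>) (\<lambda>n. tcoeff j (c2 n) \<xi>)"
definition V1 :: "nat \<Rightarrow> cfun" where
  "V1 j = pvec (\<lambda>n. tcoeff j (family_diffs c1 n) \<xi>) (\<lambda>n. tcoeff j (family_diffs c2 n) \<xi>)"
definition V2 :: "nat \<Rightarrow> cfun" where
  "V2 j = pvec (\<lambda>n. tcoeff j (family_diffs (family_diffs c1) n) \<xi>) (\<lambda>n. tcoeff j (family_diffs (family_diffs c2) n) \<xi>)"

lemma H2_rep_V: "H2_rep a b (V j) (V1 j) (V2 j)"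
  using H2_rep_pvec[OF entire_coeffs_tcoeff[OF c1] entire_coeffs_tcoeff[OF c2], of a b j \<xi> j \<xi>]
  by (simp add: V_def V1_def V2_def diffs_tcoeff c1 c2 entire_family_diffs)

lemmas fam = c1 c2 entire_family_diffs[OF c1] entire_family_diffs[OF c2]
  entire_family_diffs[OF entire_family_diffs[OF c1]] entire_family_diffs[OF entire_family_diffs[OF c2]]

lemma V_nth:
  "V j x $ 1 = pser (\<lambda>n. tcoeff j (c1 n) \<xi>) x" "V j x $ 2 = pser (\<lambda>n. tcoeff j (c2 n) \<xi>) x"
  "V1 j x $ 1 = pser (\<lambda>n. tcoeff j (family_diffs c1 n) \<xi>) x" "V1 j x $ 2 = pser (\<lambda>n. tcoeff j (family_diffs c2 n) \<xi>) x"
  "V2 j x $ 1 = pser (\<lambda>n. tcoeff j (family_diffs (family_diffs c1) n) \<xi>) x"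
  "V2 j x $ 2 = pser (\<lambda>n. tcoeff j (family_diffs (family_diffs c2) n) \<xi>) x"
  by (simp_all add: V_def V1_def V2_def pvec_def)

lemma diffs_vanish:
  assumes "entire_family c" "\<And>n. tcoeff i (c n) \<xi> = 0"
  shows "tcoeff i (family_diffs c n) \<xi> = 0"
  using assms(1) unfolding family_diffs_def[abs_def] entire_family_def
  by (simp add: tcoeff_cmult assms(2) del: of_nat_Suc)

context
  fixes r :: nat
  assumes rz: "\<And>i n. i < r \<Longrightarrow> tcoeff i (c1 n) \<xi> = 0" "\<And>i n. i < r \<Longrightarrow> tcoeff i (c2 n) \<xi> = 0"
begin

lemma rzd: "i < r \<Longrightarrow> tcoeff i (family_diffs c1 n) \<xi> = 0" "i < r \<Longrightarrow> tcoeff i (family_diffs c2 n) \<xi> = 0"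
  "i < r \<Longrightarrow> tcoeff i (family_diffs (family_diffs c1) n) \<xi> = 0" "i < r \<Longrightarrow> tcoeff i (family_diffs (family_diffs c2) n) \<xi> = 0"
  by (intro diffs_vanish fam rz; assumption)+

lemma Leib:
  "tcoeff (r + p) (\<lambda>z. z ^ k * fser (c1) x z) \<xi> = (\<Sum>j\<le>p. bcoef k \<xi> j * pser (\<lambda>n. tcoeff (r + (p - j)) (c1 n) \<xi>) x)"
  "tcoeff (r + p) (\<lambda>z. z ^ k * fser (c2) x z) \<xi> = (\<Sum>j\<le>p. bcoef k \<xi> j * pser (\<lambda>n. tcoeff (r + (p - j)) (c2 n) \<xi>) x)"
  "tcoeff (r + p) (\<lambda>z. z ^ k * fser (family_diffs c1) x z) \<xi> = (\<Sum>j\<le>p. bcoef k \<xi> j * pser (\<lambda>n. tcoeff (r + (p - j)) (family_diffs c1 n) \<xi>) x)"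
  "tcoeff (r + p) (\<lambda>z. z ^ k * fser (family_diffs c2) x z) \<xi> = (\<Sum>j\<le>p. bcoef k \<xi> j * pser (\<lambda>n. tcoeff (r + (p - j)) (family_diffs c2 n) \<xi>) x)"
  "tcoeff (r + p) (\<lambda>z. z ^ k * fser (family_diffs (family_diffs c1)) x z) \<xi> = (\<Sum>j\<le>p. bcoef k \<xi> j * pser (\<lambda>n. tcoeff (r + (p - j)) (family_diffs (family_diffs c1) n) \<xi>) x)"
  "tcoeff (r + p) (\<lambda>z. z ^ k * fser (family_diffs (family_diffs c2)) x z) \<xi> = (\<Sum>j\<le>p. bcoef k \<xi> j * pser (\<lambda>n. tcoeff (r + (p - j)) (family_diffs (family_diffs c2) n) \<xi>) x)"
  by (rule shifted_Leibniz[OF fam(1)] shifted_Leibniz[OF fam(2)] shifted_Leibniz[OF fam(3)]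
      shifted_Leibniz[OF fam(4)] shifted_Leibniz[OF fam(5)] shifted_Leibniz[OF fam(6)],
      erule rz rzd)+

lemma hol_pow: "entire_family c \<Longrightarrow> (\<lambda>z. z ^ k * fser c x z) holomorphic_on UNIV"
  by (intro holomorphic_intros holomorphic_fser)

text \<open>The sum is the Taylor coefficient of order r + p of the interior part of P(z)U(z), which
  vanishes for all z; hence p is unrestricted here, while the boundary part requires r + p <
  m.\<close>

lemma chain_interior:
  "(\<Sum>j\<le>p. PderI lam mu rho om j \<xi> (V (r + (p - j))) (V1 (r + (p - j))) (V2 (r + (p - j))) x) = 0"
proof -
  have "(\<Sum>j\<le>p. PderI lam mu rho om j \<xi> (V (r + (p - j))) (V1 (r + (p - j))) (V2 (r + (p - j))) x) $ 1
      = of_real (lam + 2 * mu) * tcoeff (r + p) (\<lambda>z. z ^ 0 * fser (family_diffs (family_diffs c1)) x z) \<xi>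
      + of_real (om\<^sup>2 * rho) * tcoeff (r + p) (\<lambda>z. z ^ 0 * fser c1 x z) \<xi>
      + of_real (lam + mu) * tcoeff (r + p) (\<lambda>z. z ^ 1 * fser (family_diffs c2) x z) \<xi>
      + of_real mu * tcoeff (r + p) (\<lambda>z. z ^ 2 * fser c1 x z) \<xi>"
    unfolding sum_component PderI_nth V_nth Leib sum_distrib_left sum.distrib[symmetric] ..
  also have "\<dots> = tcoeff (r + p) (\<lambda>z. of_real (lam + 2 * mu) * (z ^ 0 * fser (family_diffs (family_diffs c1)) x z)
      + of_real (om\<^sup>2 * rho) * (z ^ 0 * fser c1 x z) + of_real (lam + mu) * (z ^ 1 * fser (family_diffs c2) x z)
      + of_real mu * (z ^ 2 * fser c1 x z)) \<xi>"
    by (simp only: tcoeff_add tcoeff_cmult holomorphic_on_add holomorphic_on_mult holomorphic_on_const hol_pow fam)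
  also have "\<dots> = 0" using I1 by simp
  finally have 1: "(\<Sum>j\<le>p. PderI lam mu rho om j \<xi> (V (r + (p - j))) (V1 (r + (p - j))) (V2 (r + (p - j))) x) $ 1 = 0" .
  have "(\<Sum>j\<le>p. PderI lam mu rho om j \<xi> (V (r + (p - j))) (V1 (r + (p - j))) (V2 (r + (p - j))) x) $ 2
      = of_real mu * tcoeff (r + p) (\<lambda>z. z ^ 0 * fser (family_diffs (family_diffs c2)) x z) \<xi>
      + of_real (om\<^sup>2 * rho) * tcoeff (r + p) (\<lambda>z. z ^ 0 * fser c2 x z) \<xi>
      + of_real (lam + mu) * tcoeff (r + p) (\<lambda>z. z ^ 1 * fser (family_diffs c1) x z) \<xi>
      + of_real (lam + 2 * mu) * tcoeff (r + p) (\<lambda>z. z ^ 2 * fser c2 x z) \<xi>"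
    unfolding sum_component PderI_nth V_nth Leib sum_distrib_left sum.distrib[symmetric] ..
  also have "\<dots> = tcoeff (r + p) (\<lambda>z. of_real mu * (z ^ 0 * fser (family_diffs (family_diffs c2)) x z)
      + of_real (om\<^sup>2 * rho) * (z ^ 0 * fser c2 x z) + of_real (lam + mu) * (z ^ 1 * fser (family_diffs c1) x z)
      + of_real (lam + 2 * mu) * (z ^ 2 * fser c2 x z)) \<xi>"
    by (simp only: tcoeff_add tcoeff_cmult holomorphic_on_add holomorphic_on_mult holomorphic_on_const hol_pow fam)
  also have "\<dots> = 0" using I2 by simp
  finally show ?thesis using 1 by (simp add: cvec_eq_iff)
qed

lemma boundary_aux:
  assumes "entire_family c" "entire_family d" "r + p < m"
    and "\<And>z. A * fser c x z + B * (z * fser d x z) = \<beta> * bd z"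
  shows "A * tcoeff (r + p) (\<lambda>z. z ^ 0 * fser c x z) \<xi> + B * tcoeff (r + p) (\<lambda>z. z ^ 1 * fser d x z) \<xi> = 0"
proof -
  have "A * tcoeff (r + p) (\<lambda>z. z ^ 0 * fser c x z) \<xi> + B * tcoeff (r + p) (\<lambda>z. z ^ 1 * fser d x z) \<xi>
      = tcoeff (r + p) (\<lambda>z. A * (z ^ 0 * fser c x z) + B * (z ^ 1 * fser d x z)) \<xi>"
    by (simp only: tcoeff_add tcoeff_cmult holomorphic_on_add holomorphic_on_mult holomorphic_on_const hol_pow assms)
  also have "\<dots> = tcoeff (r + p) (\<lambda>z. \<beta> * bd z) \<xi>" using assms(4) by simp
  also have "\<dots> = 0" using bd assms(3) by (simp add: tcoeff_cmult)
  finally show ?thesis .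
qed

lemma chain_boundary:
  assumes "r + p < m"
  shows "(\<Sum>j\<le>p. PderB h lam mu j \<xi> (V (r + (p - j))) (V1 (r + (p - j)))) = (0, 0)"
proof (rule prod_eqI)
  show "fst (\<Sum>j\<le>p. PderB h lam mu j \<xi> (V (r + (p - j))) (V1 (r + (p - j)))) = fst (0, 0)"
    unfolding cvec_eq_iff sum_fst_nth PderB_nth V_nth fst_conv zero_index sum.distrib sum_distrib_left[symmetric] Leib[symmetric]
    using boundary_aux[OF fam(3,2) assms B1] boundary_aux[OF fam(4,1) assms B2] by simp
  show "snd (\<Sum>j\<le>p. PderB h lam mu j \<xi> (V (r + (p - j))) (V1 (r + (p - j)))) = snd (0, 0)"
    unfolding cvec_eq_iff sum_snd_nth PderB_nth V_nth snd_conv zero_index sum.distrib sum_distrib_left[symmetric] Leib[symmetric]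
    using boundary_aux[OF fam(3,2) assms B3] boundary_aux[OF fam(4,1) assms B4] by simp
qed

end

text \<open>The family may itself vanish at \<xi>, while a chain has to begin with a nonzero mode.
  If r is the first index with a nonzero coefficient, the chain is V r, ..., V (m - 1) and contains
  V j at position j - r; if there is no such r <= j, then V j is zero.\<close>

lemma taylor_coefficient_mode:
  assumes "j < m"
  shows "V j \<in> lamb_modes h lam mu rho om \<or>
    ((\<forall>n. tcoeff j (c1 n) \<xi> = 0) \<and> (\<forall>n. tcoeff j (c2 n) \<xi> = 0))"
proof (cases "\<exists>r\<le>j. \<exists>n. tcoeff r (c1 n) \<xi> \<noteq> 0 \<or> tcoeff r (c2 n) \<xi> \<noteq> 0")
  case False
  thus ?thesis by auto
next
  case True
  define P where "P r \<longleftrightarrow> (\<exists>n. tcoeff r (c1 n) \<xi> \<noteq> 0 \<or> tcoeff r (c2 n) \<xi> \<noteq> 0)" for r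
  from True obtain r' where "r' \<le> j" "P r'" unfolding P_def by blast
  then obtain r where r: "P r" "\<And>i. i < r \<Longrightarrow> \<not> P i" "r \<le> j"
    by (metis exists_least_iff le_trans linorder_not_le order_le_less)
  have rz: "tcoeff i (c1 n) \<xi> = 0" "tcoeff i (c2 n) \<xi> = 0" if "i < r" for i n
    using r(2)[OF that] unfolding P_def by auto
  have "V j \<in> lamb_modes h lam mu rho om"
    unfolding lamb_modes_def mem_Collect_eq
  proof (intro exI conjI allI impI)
    \<comment> \<open>The last index of the shifted chain is m - 1 - r, because the boundary
      condition is available for orders r + p < m only.\<close>
    show "j - r \<le> m - 1 - r" using assms by simp
    show "V j = (\<lambda>i. V (r + i)) (j - r)" using r by simp
    show "H2_rep (- h) h (V (r + i)) (V1 (r + i)) (V2 (r + i))" for i by (rule H2_rep_V)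
    \<comment> \<open>Vanishing almost everywhere would, by continuity and the identity theorem,
      make all power series coefficients zero, contrary to the choice of r.\<close>
    show "\<not> (AE x in lborel. x \<in> {- h<..<h} \<longrightarrow> V (r + 0) x = 0)"
    proof
      assume ae: "AE x in lborel. x \<in> {- h<..<h} \<longrightarrow> V (r + 0) x = 0"
      have "continuous_on UNIV (V (r + 0))"
        unfolding V_def by (intro continuous_on_pvec entire_coeffs_tcoeff c1 c2)
      from AE_zero_imp_zero[OF ae this] have z: "V r x = 0" if "- h < x" "x < h" for x
        using that by simp
      have "tcoeff r (c1 n) \<xi> = 0" for n
        by (rule pser_eq_0_imp[OF entire_coeffs_tcoeff[OF c1] h])
          (use z in \<open>simp add: cvec_eq_iff V_nth\<close>)
      moreover have "tcoeff r (c2 n) \<xi> = 0" for n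
        by (rule pser_eq_0_imp[OF entire_coeffs_tcoeff[OF c2] h])
          (use z in \<open>simp add: cvec_eq_iff V_nth\<close>)
      ultimately show False using r(1) by (simp add: P_def)
    qed
    fix p assume p: "p \<le> m - 1 - r"
    show "AE x in lborel. x \<in> {- h<..<h} \<longrightarrow>
        (\<Sum>ja\<le>p. PderI lam mu rho om ja \<xi> (V (r + (p - ja))) (V1 (r + (p - ja))) (V2 (r + (p - ja))) x) = 0"
      using chain_interior[OF rz] by simp
    show "(\<Sum>ja\<le>p. PderB h lam mu ja \<xi> (V (r + (p - ja))) (V1 (r + (p - ja)))) = (0, 0)"
      by (rule chain_boundary[OF rz]) (use p assms r(3) in auto)
  qed
  thus ?thesis ..
qed

end

section \<open>Combinations of longitudinal and shear waves as families for the pencil\<close>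

lemma trig_factor_mult: "trig_factor \<tau> s * trig_factor (\<not> \<tau>) s = - s"
  by (cases \<tau>) (simp_all add: trig_factor_def)

lemma trigc_pairing_minus:
  "pairing (trigc \<tau> s) (\<lambda>n. of_real (- x) ^ n) = trig_sign \<tau> * pairing (trigc \<tau> s) (\<lambda>n. of_real x ^ n)"
proof -
  have "trigc \<tau> s n * of_real (- x) ^ n = (trig_sign \<tau> * trigc \<tau> s n) * of_real x ^ n" for n
    by (cases \<tau>) (auto simp: trigc_def trig_sign_def power_minus_even power_minus_odd)
  hence "pairing (trigc \<tau> s) (\<lambda>n. of_real (- x) ^ n) = pairing (\<lambda>n. trig_sign \<tau> * trigc \<tau> s n) (\<lambda>n. of_real x ^ n)"
    by (simp only: pairing_def)
  thus ?thesis by (simp add: pairing_cmult[OF entire_coeffs_trigc geom_bounded_power])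
qed

lemma entire_coeffs_cmult:
  assumes "entire_coeffs c" shows "entire_coeffs (\<lambda>n. x * c n)"
proof -
  obtain M K where MK: "0 \<le> M" "0 \<le> K" "\<And>n. norm (c n) \<le> M * K ^ n / fact n"
    using assms unfolding entire_coeffs_def by blast
  have "norm (x * c n) \<le> (norm x * M) * K ^ n / fact n" for n
    using mult_left_mono[OF MK(3)[of n] norm_ge_zero[of x]] by (simp add: norm_mult mult.assoc)
  thus ?thesis unfolding entire_coeffs_def using MK
    by (intro exI[of _ "norm x * M"] exI[of _ K]) simp
qed

context annihilated_moments
begin

text \<open>Each component of the waves, and each of its x-derivatives, is of this form: one
  longitudinal and one shear series of the same parity, with coefficients entire in z.\<close>

definition lin :: "bool \<Rightarrow> (complex \<Rightarrow> complex) \<Rightarrow> (complex \<Rightarrow> complex) \<Rightarrow> nat \<Rightarrow> complex \<Rightarrow> complex" where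
  "lin \<tau> A B n z = A z * trigc \<tau> (z\<^sup>2 + of_real a) n + B z * trigc \<tau> (z\<^sup>2 + of_real b) n"

lemma entire_family_lin:
  "A holomorphic_on UNIV \<Longrightarrow> B holomorphic_on UNIV \<Longrightarrow> entire_family (lin \<tau> A B)"
  unfolding lin_def[abs_def] by (intro entire_family_add entire_family_mult entire_family_trigc)

lemma family_diffs_lin: "family_diffs (lin \<tau> A B) =
    lin (\<not> \<tau>) (\<lambda>z. A z * trig_factor \<tau> (z\<^sup>2 + of_real a)) (\<lambda>z. B z * trig_factor \<tau> (z\<^sup>2 + of_real b))"
proof (intro ext)
  fix n z
  have "family_diffs (lin \<tau> A B) n z = A z * (of_nat (Suc n) * trigc \<tau> (z\<^sup>2 + of_real a) (Suc n))
      + B z * (of_nat (Suc n) * trigc \<tau> (z\<^sup>2 + of_real b) (Suc n))"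
    unfolding family_diffs_def lin_def by (simp only: algebra_simps)
  thus "family_diffs (lin \<tau> A B) n z =
    lin (\<not> \<tau>) (\<lambda>z. A z * trig_factor \<tau> (z\<^sup>2 + of_real a)) (\<lambda>z. B z * trig_factor \<tau> (z\<^sup>2 + of_real b)) n z"
    unfolding trigc_Suc by (simp add: lin_def mult.assoc)
qed

lemma pairing_lin:
  assumes "geom_bounded m"
  shows "pairing (\<lambda>n. lin \<tau> A B n z) m =
    A z * pairing (trigc \<tau> (z\<^sup>2 + of_real a)) m + B z * pairing (trigc \<tau> (z\<^sup>2 + of_real b)) m"
  unfolding lin_def
  by (simp add: pairing_add entire_coeffs_cmult entire_coeffs_trigc assms pairing_cmult)

lemma fser_lin: "fser (lin \<tau> A B) x z =
    A z * pairing (trigc \<tau> (z\<^sup>2 + of_real a)) (\<lambda>n. of_real x ^ n) + B z * pairing (trigc \<tau> (z\<^sup>2 + of_real b)) (\<lambda>n. of_real x ^ n)"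
  unfolding fser_def pser_def by (rule pairing_lin[OF geom_bounded_power])

context
  fixes lam mu rho om :: real
  assumes La: "(lam + 2 * mu) * a = om\<^sup>2 * rho" and Lb: "mu * b = om\<^sup>2 * rho"
    and kill: "\<And>c d. entire_coeffs c \<Longrightarrow> entire_coeffs d \<Longrightarrow> pvec c d \<in> lamb_modes h lam mu rho om \<Longrightarrow>
      pairing c m1 + pairing d m2 = 0"
begin

text \<open>At a zero of \<open>disp\<close> of order at least m the first m Taylor coefficients of
  U(z) are modes or zero, hence are annihilated. Since the functional commutes with Taylor
  expansion, l(U(z)) vanishes there to order m as well.\<close>

lemma zero_order_aux:
  assumes hol: "\<alpha> holomorphic_on UNIV" "\<beta> holomorphic_on UNIV"
    and t1: "\<And>z. - (2 * z\<^sup>2 + of_real b) * \<alpha> z * phi \<tau> z - 2 * z * \<beta> z * dpsi \<tau> z = \<beta>1 * disp \<tau> z"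
    and t2: "\<And>z. 2 * z * \<alpha> z * dphi \<tau> z - (2 * z\<^sup>2 + of_real b) * \<beta> z * psi \<tau> z = \<beta>2 * disp \<tau> z"
    and z: "\<And>i. i < m \<Longrightarrow> (deriv ^^ i) (disp \<tau>) \<xi> = 0" and i: "i < m"
  shows "(deriv ^^ i) (\<lambda>z. \<alpha> z * (A1 \<tau> z + z * A2 \<tau> z) + \<beta> z * (- z * B1 \<tau> z + B2 \<tau> z)) \<xi> = 0"
proof -
  \<comment> \<open>The components of U(z) = \<alpha>(\<phi>', z\<phi>) + \<beta>(-z\<psi>,
    \<psi>'), with the x-derivatives expressed through \<open>trig_factor\<close>.\<close>
  define c1 where "c1 = lin (\<not> \<tau>) (\<lambda>z. \<alpha> z * trig_factor \<tau> (z\<^sup>2 + of_real a)) (\<lambda>z. - z * \<beta> z)"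
  define c2 where "c2 = lin \<tau> (\<lambda>z. z * \<alpha> z) (\<lambda>z. \<beta> z * trig_factor (\<not> \<tau>) (z\<^sup>2 + of_real b))"
  have fam: "entire_family c1" "entire_family c2" unfolding c1_def c2_def
    by (intro entire_family_lin holomorphic_intros hol trig_factor_entire)+
  have cLa: "(of_real lam + 2 * of_real mu) * of_real a = (of_real (om\<^sup>2 * rho) :: complex)"
    using arg_cong[OF La, of complex_of_real] by simp
  have cLb: "of_real mu * of_real b = (of_real (om\<^sup>2 * rho) :: complex)"
    using arg_cong[OF Lb, of complex_of_real] by simp
  note tfa = trig_factor_mult[of \<tau> "z\<^sup>2 + of_real a" for z]
  note tfb = trig_factor_mult[of \<tau> "z\<^sup>2 + of_real b" for z]
  interpret pencil_family h lam mu rho om c1 c2 "disp \<tau>" \<xi> m "of_real mu * \<beta>1" "of_real mu * \<beta>2"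
     "of_real mu * \<beta>1 * trig_sign \<tau>" "of_real mu * \<beta>2 * trig_sign (\<not> \<tau>)"
  proof
    fix x :: real and z :: complex
    show "of_real (lam + 2 * mu) * fser (family_diffs (family_diffs c1)) x z + of_real (om\<^sup>2 * rho) * fser c1 x z
       + of_real (lam + mu) * (z * fser (family_diffs c2) x z) + of_real mu * (z\<^sup>2 * fser c1 x z) = 0"
      unfolding c1_def c2_def family_diffs_lin fser_lin not_not
      using tfa[of z] tfb[of z] cLa cLb by (simp only: of_real_add of_real_mult of_real_numeral) algebra
    show "of_real mu * fser (family_diffs (family_diffs c2)) x z + of_real (om\<^sup>2 * rho) * fser c2 x z
       + of_real (lam + mu) * (z * fser (family_diffs c1) x z) + of_real (lam + 2 * mu) * (z\<^sup>2 * fser c2 x z) = 0"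
      unfolding c1_def c2_def family_diffs_lin fser_lin not_not
      using tfa[of z] tfb[of z] cLa cLb by (simp only: of_real_add of_real_mult of_real_numeral) algebra
  next
    fix z :: complex
    \<comment> \<open>For the longitudinal part (\<lambda> + 2\<mu>)\<phi>'' + \<lambda>z^2\<phi> =
      -(2\<mu>z^2 + \<omega>^2\<rho>)\<phi>, and \<omega>^2\<rho> = \<mu>b; this is how b, and not
      a, enters the traction.\<close>
    have b1: "of_real (lam + 2 * mu) * fser (family_diffs c1) h z + of_real lam * (z * fser c2 h z) = of_real mu * \<beta>1 * disp \<tau> z"
    proof -
      have "of_real (lam + 2 * mu) * fser (family_diffs c1) h z + of_real lam * (z * fser c2 h z)
        = of_real mu * (- (2 * z\<^sup>2 + of_real b) * \<alpha> z * phi \<tau> z - 2 * z * \<beta> z * dpsi \<tau> z)"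
        unfolding c1_def c2_def family_diffs_lin fser_lin not_not phi_def dpsi_def
        using tfa[of z] cLa cLb by (simp only: of_real_add of_real_mult of_real_numeral) algebra
      thus ?thesis unfolding t1 by (simp add: mult.assoc)
    qed
    have b2: "of_real mu * fser (family_diffs c2) h z + of_real mu * (z * fser c1 h z) = of_real mu * \<beta>2 * disp \<tau> z"
    proof -
      have "of_real mu * fser (family_diffs c2) h z + of_real mu * (z * fser c1 h z)
        = of_real mu * (2 * z * \<alpha> z * dphi \<tau> z - (2 * z\<^sup>2 + of_real b) * \<beta> z * psi \<tau> z)"
        unfolding c1_def c2_def family_diffs_lin fser_lin not_not dphi_def psi_def
        using tfb[of z] by algebra
      thus ?thesis unfolding t2 by (simp add: mult.assoc)
    qed
    show "of_real (lam + 2 * mu) * fser (family_diffs c1) h z + of_real lam * (z * fser c2 h z) = of_real mu * \<beta>1 * disp \<tau> z"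
      "of_real mu * fser (family_diffs c2) h z + of_real mu * (z * fser c1 h z) = of_real mu * \<beta>2 * disp \<tau> z"
      by (fact b1 b2)+
    \<comment> \<open>The tractions on the two faces differ only by parity signs, so the same scalar
      function \<open>disp\<close> controls both.\<close>
    have odd: "fser (lin \<tau>' A B) (- h) z = trig_sign \<tau>' * fser (lin \<tau>' A B) h z" for \<tau>' A B
      unfolding fser_lin trigc_pairing_minus by (simp add: algebra_simps)
    have p1: "fser (family_diffs c1) (- h) z = trig_sign \<tau> * fser (family_diffs c1) h z"
        "fser c2 (- h) z = trig_sign \<tau> * fser c2 h z"
      unfolding c1_def c2_def family_diffs_lin not_not by (rule odd)+
    have p2: "fser (family_diffs c2) (- h) z = trig_sign (\<not> \<tau>) * fser (family_diffs c2) h z"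
        "fser c1 (- h) z = trig_sign (\<not> \<tau>) * fser c1 h z"
      unfolding c1_def c2_def family_diffs_lin by (rule odd)+
    show "of_real (lam + 2 * mu) * fser (family_diffs c1) (- h) z + of_real lam * (z * fser c2 (- h) z) = of_real mu * \<beta>1 * trig_sign \<tau> * disp \<tau> z"
      unfolding p1 using b1 by algebra
    show "of_real mu * fser (family_diffs c2) (- h) z + of_real mu * (z * fser c1 (- h) z) = of_real mu * \<beta>2 * trig_sign (\<not> \<tau>) * disp \<tau> z"
      unfolding p2 using b2 by algebra
  qed (use h fam entire_disp z in \<open>auto simp: tcoeff_def\<close>)
  have "pairing (\<lambda>n. tcoeff i (c1 n) \<xi>) m1 + pairing (\<lambda>n. tcoeff i (c2 n) \<xi>) m2 = 0"
    using taylor_coefficient_mode[OF i]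
  proof
    assume "V i \<in> lamb_modes h lam mu rho om"
    thus ?thesis unfolding V_def by (intro kill entire_coeffs_tcoeff fam)
  next
    assume "(\<forall>n. tcoeff i (c1 n) \<xi> = 0) \<and> (\<forall>n. tcoeff i (c2 n) \<xi> = 0)"
    thus ?thesis by (simp add: pairing_def)
  qed
  hence "tcoeff i (\<lambda>z. pairing (\<lambda>n. c1 n z) m1 + pairing (\<lambda>n. c2 n z) m2) \<xi> = 0"
    using gb fam by (simp add: tcoeff_add holomorphic_pairing tcoeff_pairing)
  moreover have "(\<lambda>z. pairing (\<lambda>n. c1 n z) m1 + pairing (\<lambda>n. c2 n z) m2)
      = (\<lambda>z. \<alpha> z * (A1 \<tau> z + z * A2 \<tau> z) + \<beta> z * (- z * B1 \<tau> z + B2 \<tau> z))"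
    unfolding c1_def c2_def pairing_lin[OF gb(1)] pairing_lin[OF gb(2)] A1_def A2_def B1_def B2_def
    by (simp add: algebra_simps)
  ultimately show ?thesis by (simp add: tcoeff_def)
qed

lemma moments_vanish_modes: "m1 n = 0" "m2 n = 0"
proof -
  have o1: "(deriv ^^ i) (num1 \<tau>) \<xi> = 0" if "\<And>i. i < m \<Longrightarrow> (deriv ^^ i) (disp \<tau>) \<xi> = 0" "i < m" for \<tau> \<xi> m i
    unfolding num1_def[abs_def]
  proof (rule zero_order_aux[where ?\<beta>1.0 = 0 and ?\<beta>2.0 = "- 1", OF _ _ _ _ that])
    show "(\<lambda>z. - 2 * z * dpsi \<tau> z) holomorphic_on UNIV" "(\<lambda>z. (2 * z\<^sup>2 + of_real b) * phi \<tau> z) holomorphic_on UNIV"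
      by (intro holomorphic_intros entire)+
  qed (auto simp: disp_def algebra_simps power2_eq_square)
  have o2: "(deriv ^^ i) (num2 \<tau>) \<xi> = 0" if "\<And>i. i < m \<Longrightarrow> (deriv ^^ i) (disp \<tau>) \<xi> = 0" "i < m" for \<tau> \<xi> m i
    unfolding num2_def[abs_def]
  proof (rule zero_order_aux[where ?\<beta>1.0 = 1 and ?\<beta>2.0 = 0, OF _ _ _ _ that])
    show "(\<lambda>z. - (2 * z\<^sup>2 + of_real b) * psi \<tau> z) holomorphic_on UNIV" "(\<lambda>z. - 2 * z * dphi \<tau> z) holomorphic_on UNIV"
      by (intro holomorphic_intros entire)+
  qed (auto simp: disp_def algebra_simps power2_eq_square)
  show "m1 n = 0" "m2 n = 0" by (rule moments_vanish[OF o1 o2]; assumption)+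
qed

end

end

section \<open>Separation in semi-inner product spaces\<close>

lemma quadratic_nonneg_discriminant:
  fixes a b c :: real
  assumes "\<And>t. 0 \<le> a + 2 * t * b + t\<^sup>2 * c" "c \<ge> 0"
  shows "b\<^sup>2 \<le> a * c"
proof -
  consider "c > 0" | "c = 0" using assms(2) by linarith
  thus ?thesis
  proof cases
    case 1
    have "0 \<le> a + 2 * (- b / c) * b + (- b / c)\<^sup>2 * c" by (rule assms(1))
    also have "\<dots> = a - b\<^sup>2 / c" using 1 by (simp add: field_simps power2_eq_square)
    finally show ?thesis using 1 by (simp add: field_simps)
  next
    case 2
    have "b = 0"
    proof (rule ccontr)
      assume "b \<noteq> 0"
      hence "a + 2 * (- (a + 1) / (2 * b)) * b + (- (a + 1) / (2 * b))\<^sup>2 * c = - 1" using 2 by (simp add: field_simps)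
      thus False using assms(1)[of "- (a + 1) / (2 * b)"] by simp
    qed
    thus ?thesis using 2 by simp
  qed
qed

text \<open>The form may be degenerate and the set need not be complete. This covers both C^1
  functions with the H^1 form and square integrable functions without identification almost
  everywhere.\<close>

locale semi_inner =
  fixes V :: "('x \<Rightarrow> 'b :: real_vector) set" and B :: "('x \<Rightarrow> 'b) \<Rightarrow> ('x \<Rightarrow> 'b) \<Rightarrow> real"
  assumes lc: "u \<in> V \<Longrightarrow> w \<in> V \<Longrightarrow> (\<lambda>x. u x + c *\<^sub>R w x) \<in> V"
    and sym: "u \<in> V \<Longrightarrow> w \<in> V \<Longrightarrow> B u w = B w u"
    and lin: "u \<in> V \<Longrightarrow> w \<in> V \<Longrightarrow> g \<in> V \<Longrightarrow> B (\<lambda>x. u x + c *\<^sub>R w x) g = B u g + c * B w g"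
    and pos: "u \<in> V \<Longrightarrow> B u u \<ge> 0"
begin

lemma expand:
  assumes "u \<in> V" "w \<in> V"
  shows "B (\<lambda>x. u x + c *\<^sub>R w x) (\<lambda>x. u x + c *\<^sub>R w x) = B u u + 2 * c * B u w + c\<^sup>2 * B w w"
proof -
  note l = lc[OF assms, of c]
  show ?thesis
    using lin[OF assms l, of c] lin[OF assms assms(1), of c] lin[OF assms assms(2), of c]
      sym[OF assms(1) l] sym[OF assms(2) l] sym[OF assms]
    by (simp add: algebra_simps power2_eq_square)
qed

lemma Cauchy_Schwarz:
  assumes "u \<in> V" "w \<in> V"
  shows "\<bar>B u w\<bar> \<le> sqrt (B u u) * sqrt (B w w)"
proof -
  have "(B u w)\<^sup>2 \<le> B u u * B w w"
  proof (rule quadratic_nonneg_discriminant)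
    show "0 \<le> B u u + 2 * t * B u w + t\<^sup>2 * B w w" for t
      using pos[OF lc[OF assms]] by (simp only: expand[OF assms])
  qed (rule pos[OF assms(2)])
  thus ?thesis by (simp add: real_le_rsqrt flip: real_sqrt_mult)
qed

text \<open>In a complete space l would be the inner product with f minus its projection on S. The
  projection may fail to exist, but inner products with f - u_n converge along a minimising
  sequence, and their limit serves as l. It is bounded because the norms of f - u_n are, and l f is
  the squared distance d >= \<delta>.\<close>

lemma separating_functional:
  assumes S: "S \<subseteq> V" "S \<noteq> {}" "\<And>u w c. u \<in> S \<Longrightarrow> w \<in> S \<Longrightarrow> (\<lambda>x. u x + c *\<^sub>R w x) \<in> S"
    and f: "f \<in> V" and \<delta>: "\<delta> > 0"
    and dist: "\<And>u. u \<in> S \<Longrightarrow> B (\<lambda>x. f x - u x) (\<lambda>x. f x - u x) \<ge> \<delta>"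
  obtains l K where "K \<ge> 0"
    "\<And>u w c. u \<in> V \<Longrightarrow> w \<in> V \<Longrightarrow> l (\<lambda>x. u x + c *\<^sub>R w x) = l u + c * (l w :: real)"
    "\<And>u. u \<in> V \<Longrightarrow> \<bar>l u\<bar> \<le> K * sqrt (B u u)" "\<And>u. u \<in> S \<Longrightarrow> l u = 0" "l f \<noteq> 0"
proof -
  define Q where "Q u = B (\<lambda>x. f x - u x) (\<lambda>x. f x - u x)" for u
  define d where "d = (INF u\<in>S. Q u)"
  have bdd: "bdd_below (Q ` S)" using dist by (auto simp: Q_def intro!: bdd_belowI[of _ \<delta>])
  have dle: "d \<le> Q u" if "u \<in> S" for u unfolding d_def by (rule cINF_lower[OF bdd that])
  have d\<delta>: "d \<ge> \<delta>" unfolding d_def using S(2) dist by (intro cINF_greatest) (auto simp: Q_def)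
  have "\<exists>u\<in>S. Q u < d + 1 / real (Suc n)" for n
  proof -
    have "Inf (Q ` S) < d + 1 / real (Suc n)" by (simp add: d_def)
    from cInf_lessD[OF _ this] show ?thesis using S(2) by auto
  qed
  then obtain un where un: "\<And>n. un n \<in> S" "\<And>n. Q (un n) < d + 1 / real (Suc n)" by metis
  define e where "e n x = f x - un n x" for n x
  have eV: "e n \<in> V" for n
    using lc[OF f, of "un n" "- 1"] un(1) S(1) by (auto simp: e_def[abs_def])
  define \<epsilon> where "\<epsilon> n = B (e n) (e n) - d" for n
  have \<epsilon>: "0 \<le> \<epsilon> n" "\<epsilon> n < 1 / real (Suc n)" for n
    using un(2)[of n] dle[OF un(1)[of n]] by (simp_all add: \<epsilon>_def Q_def e_def[abs_def])
  have \<epsilon>0: "\<epsilon> \<longlonglongrightarrow> 0"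
    by (rule tendsto_sandwich[OF _ _ tendsto_const LIMSEQ_inverse_real_of_nat])
      (use \<epsilon> in \<open>auto intro!: always_eventually less_imp_le simp: inverse_eq_divide\<close>)
  have shift: "B (\<lambda>x. e n x + t *\<^sub>R w x) (\<lambda>x. e n x + t *\<^sub>R w x) \<ge> d" if "w \<in> S" for n t w
  proof -
    have "(\<lambda>x. un n x + (- t) *\<^sub>R w x) \<in> S" using S(3) un(1) that by blast
    from dle[OF this] show ?thesis
      by (simp add: Q_def e_def algebra_simps)
  qed
  \<comment> \<open>Moving e n by any multiple of w cannot bring the squared norm below d; the
    resulting quadratic in the multiple is nonnegative, and its discriminant gives near
    orthogonality.\<close>
  have orth: "(B (e n) w)\<^sup>2 \<le> \<epsilon> n * B w w" if "w \<in> S" for n w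
  proof (rule quadratic_nonneg_discriminant)
    fix t
    have wV: "w \<in> V" using that S(1) by auto
    show "0 \<le> \<epsilon> n + 2 * t * B (e n) w + t\<^sup>2 * B w w"
      using shift[OF that, of n t] expand[OF eV[of n] wV, of t] by (simp add: \<epsilon>_def)
  qed (use pos that S(1) in auto)
  define w where "w n m = (\<lambda>x. un m x + (- 1) *\<^sub>R un n x)" for n m
  have wS: "w n m \<in> S" for n m unfolding w_def by (intro S(3) un)
  hence wV: "w n m \<in> V" for n m using S(1) by auto
  have ew: "e n = (\<lambda>x. e m x + 1 *\<^sub>R w n m x)" for n m by (auto simp: e_def w_def)
  \<comment> \<open>The parallelogram argument: the midpoint of \<open>un n\<close> and
    \<open>un m\<close> is again in S, so its squared distance from f is at least d.\<close>
  have Bw: "B (w n m) (w n m) \<le> 2 * (\<epsilon> n + \<epsilon> m)" for n m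
  proof -
    have "B (e n) (e n) = B (e m) (e m) + 2 * B (e m) (w n m) + B (w n m) (w n m)"
      using expand[OF eV[of m] wV[of n m], of 1] ew[of n m] by simp
    moreover have "d \<le> B (e m) (e m) + B (e m) (w n m) + B (w n m) (w n m) / 4"
      using shift[OF wS[of n m], of m "1/2"] expand[OF eV[of m] wV[of n m], of "1/2"]
      by (simp add: power2_eq_square)
    ultimately show ?thesis by (simp add: \<epsilon>_def)
  qed
  have diff: "\<bar>B g (e n) - B g (e m)\<bar> \<le> sqrt (B g g) * sqrt (2 * (\<epsilon> n + \<epsilon> m))" if g: "g \<in> V" for g n m
  proof -
    have "B (e n) g = B (e m) g + 1 * B (w n m) g"
      by (subst ew[of n m]) (rule lin[OF eV wV g])
    hence "B g (e n) - B g (e m) = B g (w n m)" using sym g eV wV by simp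
    also have "\<bar>\<dots>\<bar> \<le> sqrt (B g g) * sqrt (B (w n m) (w n m))" by (rule Cauchy_Schwarz[OF g wV])
    also have "\<dots> \<le> sqrt (B g g) * sqrt (2 * (\<epsilon> n + \<epsilon> m))"
      using Bw pos[OF g] by (intro mult_left_mono) auto
    finally show ?thesis .
  qed
  define l where "l g = lim (\<lambda>n. B g (e n))" for g
  have conv: "(\<lambda>n. B g (e n)) \<longlonglongrightarrow> l g" if g: "g \<in> V" for g
  proof -
    have "Cauchy (\<lambda>n. B g (e n))"
    proof (rule metric_CauchyI)
      fix r :: real assume "r > 0"
      have "(\<lambda>n. sqrt (B g g) * sqrt (4 * \<epsilon> n)) \<longlonglongrightarrow> sqrt (B g g) * sqrt (4 * 0)"
        by (intro tendsto_intros \<epsilon>0)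
      moreover have "(\<lambda>n. 4 * inverse (real (Suc n))) \<longlonglongrightarrow> 4 * 0"
        by (intro tendsto_intros LIMSEQ_inverse_real_of_nat)
      hence "(\<lambda>n. sqrt (B g g) * sqrt (4 * inverse (real (Suc n)))) \<longlonglongrightarrow> sqrt (B g g) * sqrt (4 * 0)"
        by (intro tendsto_intros) auto
      hence "\<forall>\<^sub>F n in sequentially. sqrt (B g g) * sqrt (4 * inverse (real (Suc n))) < r"
        using \<open>r > 0\<close> by (intro order_tendstoD) auto
      then obtain N where N: "sqrt (B g g) * sqrt (4 * inverse (real (Suc N))) < r"
        by (auto simp: eventually_sequentially)
      have "dist (B g (e n)) (B g (e m)) < r" if "n \<ge> N" "m \<ge> N" for n m
      proof -
        have le: "\<epsilon> k \<le> inverse (real (Suc N))" if "k \<ge> N" for k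
          using \<epsilon>(2)[of k] that by (simp add: inverse_eq_divide frac_le order.trans[OF less_imp_le])
        have "\<bar>B g (e n) - B g (e m)\<bar> \<le> sqrt (B g g) * sqrt (2 * (\<epsilon> n + \<epsilon> m))" by (rule diff[OF g])
        also have "\<dots> \<le> sqrt (B g g) * sqrt (4 * inverse (real (Suc N)))"
          using le[OF that(1)] le[OF that(2)] pos[OF g] by (intro mult_left_mono) auto
        finally show ?thesis using N by (simp add: dist_real_def)
      qed
      thus "\<exists>M. \<forall>m\<ge>M. \<forall>n\<ge>M. dist (B g (e m)) (B g (e n)) < r" by blast
    qed
    thus ?thesis unfolding l_def by (simp add: Cauchy_convergent_iff convergent_LIMSEQ_iff)
  qed
  have orth0: "(\<lambda>n. B (e n) (wn n)) \<longlonglongrightarrow> 0" if "\<And>n. wn n \<in> S" "\<And>n. B (wn n) (wn n) \<le> M" for wn M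
  proof -
    have "(\<lambda>n. (B (e n) (wn n))\<^sup>2) \<longlonglongrightarrow> 0"
    proof (rule tendsto_sandwich[OF _ _ tendsto_const])
      show "\<forall>\<^sub>F n in sequentially. (B (e n) (wn n))\<^sup>2 \<le> \<epsilon> n * M"
        using orth[OF that(1)] that(2) \<epsilon>(1)
        by (intro always_eventually allI) (meson mult_left_mono order_trans)
      show "(\<lambda>n. \<epsilon> n * M) \<longlonglongrightarrow> 0" using tendsto_mult[OF \<epsilon>0 tendsto_const[of M]] by simp
    qed auto
    from tendsto_real_sqrt[OF this] show ?thesis by (simp add: tendsto_rabs_zero_iff)
  qed
  show ?thesis
  proof (rule that[of "sqrt (d + 1)" l])
    show "sqrt (d + 1) \<ge> 0" using d\<delta> \<delta> by simp
    fix u v c assume uv: "u \<in> V" "v \<in> V"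
    have "(\<lambda>n. B u (e n) + c * B v (e n)) \<longlonglongrightarrow> l u + c * l v" by (intro tendsto_intros conv uv)
    hence "(\<lambda>n. B (\<lambda>x. u x + c *\<^sub>R v x) (e n)) \<longlonglongrightarrow> l u + c * l v" by (simp add: lin uv eV)
    thus "l (\<lambda>x. u x + c *\<^sub>R v x) = l u + c * l v" using LIMSEQ_unique conv[OF lc[OF uv]] by blast
  next
    fix u assume u: "u \<in> V"
    have "\<bar>B u (e n)\<bar> \<le> sqrt (d + 1) * sqrt (B u u)" for n
    proof -
      have "1 / real (Suc n) \<le> 1" by simp
      hence "B (e n) (e n) \<le> d + 1" using \<epsilon>(2)[of n] unfolding \<epsilon>_def by linarith
      hence "sqrt (B u u) * sqrt (B (e n) (e n)) \<le> sqrt (B u u) * sqrt (d + 1)"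
        using pos[OF u] by (intro mult_left_mono) auto
      thus ?thesis using Cauchy_Schwarz[OF u eV[of n]] by (simp add: mult.commute)
    qed
    thus "\<bar>l u\<bar> \<le> sqrt (d + 1) * sqrt (B u u)"
      using tendsto_rabs[OF conv[OF u]] by (intro LIMSEQ_le_const2) auto
  next
    fix u assume u: "u \<in> S"
    have "(\<lambda>n. B (e n) u) \<longlonglongrightarrow> 0" using orth0[of "\<lambda>_. u" "B u u"] u by simp
    moreover have "(\<lambda>n. B (e n) u) \<longlonglongrightarrow> l u" using conv[of u] u S(1) sym eV by auto
    ultimately show "l u = 0" using LIMSEQ_unique by blast
  next
    have "(\<lambda>n. B f (e n)) \<longlonglongrightarrow> d"
    proof -
      have u0: "un 0 \<in> V" using un(1) S(1) by auto
      \<comment> \<open>Here f is split as e n + (un n - un 0) + un 0. The last two summands lie in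
        S and have bounded norms, so their products with e n tend to 0.\<close>
      have eq: "B f (e n) = d + \<epsilon> n + B (e n) (w 0 n) + B (e n) (un 0)" for n
      proof -
        have "f = (\<lambda>x. (\<lambda>x. e n x + 1 *\<^sub>R w 0 n x) x + 1 *\<^sub>R un 0 x)" by (auto simp: e_def w_def)
        hence "B f (e n) = B (\<lambda>x. (\<lambda>x. e n x + 1 *\<^sub>R w 0 n x) x + 1 *\<^sub>R un 0 x) (e n)" by metis
        also have "\<dots> = B (\<lambda>x. e n x + 1 *\<^sub>R w 0 n x) (e n) + 1 * B (un 0) (e n)"
          by (rule lin[OF lc[OF eV wV] u0 eV])
        also have "B (\<lambda>x. e n x + 1 *\<^sub>R w 0 n x) (e n) = B (e n) (e n) + 1 * B (w 0 n) (e n)"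
          by (rule lin[OF eV wV eV])
        finally show ?thesis using sym[OF eV u0, of n] sym[OF eV wV, of n 0 n] by (simp add: \<epsilon>_def)
      qed
      have "(\<lambda>n. d + \<epsilon> n + B (e n) (w 0 n) + B (e n) (un 0)) \<longlonglongrightarrow> d + 0 + 0 + 0"
      proof (intro tendsto_intros \<epsilon>0)
        have "1 / real (Suc n) \<le> 1" for n by simp
        hence e1: "\<epsilon> n \<le> 1" for n using \<epsilon>(2)[of n] by (meson less_imp_le order_trans)
        have "2 * (\<epsilon> 0 + \<epsilon> n) \<le> 2 * (1 + 1)" for n
          by (intro mult_left_mono add_mono e1) auto
        hence "B (w 0 n) (w 0 n) \<le> 2 * (1 + 1)" for n using Bw[of 0 n] by (meson order_trans)
        thus "(\<lambda>n. B (e n) (w 0 n)) \<longlonglongrightarrow> 0" by (intro orth0 wS)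
        show "(\<lambda>n. B (e n) (un 0)) \<longlonglongrightarrow> 0" by (rule orth0[OF un(1) order_refl])
      qed
      thus ?thesis by (simp add: eq)
    qed
    thus "l f \<noteq> 0" using conv[OF f] LIMSEQ_unique d\<delta> \<delta> by fastforce
  qed
qed

end

section \<open>Bounded functionals annihilating all modes\<close>

text \<open>Functions are taken on the whole line so that two-sided derivatives exist at the
  endpoints; the form \<open>H1_form\<close> sees only [-h, h].\<close>

definition C1_fun :: "cfun set" where
  "C1_fun = {u. (\<forall>x. (u has_vector_derivative vector_derivative u (at x)) (at x)) \<and>
     continuous_on UNIV (\<lambda>x. vector_derivative u (at x))}"

definition H1_form :: "real \<Rightarrow> cfun \<Rightarrow> cfun \<Rightarrow> real" where
  "H1_form h u w = integral {-h..h} (\<lambda>x. u x \<bullet> w x + vector_derivative u (at x) \<bullet> vector_derivative w (at x))"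

lemma C1_funI:
  assumes "\<And>x. (u has_vector_derivative u1 x) (at x)" "continuous_on UNIV u1"
  shows "u \<in> C1_fun" "vector_derivative u (at x) = u1 x"
proof -
  have "vector_derivative u (at x) = u1 x" for x by (rule vector_derivative_at[OF assms(1)])
  thus "u \<in> C1_fun" "vector_derivative u (at x) = u1 x" using assms by (auto simp: C1_fun_def)
qed

lemma C1_funD:
  assumes "u \<in> C1_fun"
  shows "(u has_vector_derivative vector_derivative u (at x)) (at x)"
    "continuous_on A (\<lambda>x. vector_derivative u (at x))" "continuous_on A u"
proof -
  show 1: "(u has_vector_derivative vector_derivative u (at x)) (at x)" for x using assms by (auto simp: C1_fun_def)
  show "continuous_on A (\<lambda>x. vector_derivative u (at x))"
    using assms continuous_on_subset by (auto simp: C1_fun_def)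
  show "continuous_on A u"
    using 1 by (meson continuous_at_imp_continuous_on has_vector_derivative_continuous)
qed

lemma C1_fun_lc:
  assumes "u \<in> C1_fun" "w \<in> C1_fun"
  shows "(\<lambda>x. u x + c *\<^sub>R w x) \<in> C1_fun"
    "vector_derivative (\<lambda>x. u x + c *\<^sub>R w x) (at x) = vector_derivative u (at x) + c *\<^sub>R vector_derivative w (at x)"
proof -
  have d: "((\<lambda>x. u x + c *\<^sub>R w x) has_vector_derivative
      vector_derivative u (at x) + c *\<^sub>R vector_derivative w (at x)) (at x)" for x
    by (intro has_vector_derivative_add bounded_linear.has_vector_derivative[OF bounded_linear_scaleR_right] C1_funD assms)
  have c: "continuous_on UNIV (\<lambda>x. vector_derivative u (at x) + c *\<^sub>R vector_derivative w (at x))"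
    by (intro continuous_on_add continuous_on_scaleR continuous_on_const C1_funD assms)
  show "(\<lambda>x. u x + c *\<^sub>R w x) \<in> C1_fun"
    "vector_derivative (\<lambda>x. u x + c *\<^sub>R w x) (at x) = vector_derivative u (at x) + c *\<^sub>R vector_derivative w (at x)"
    by (rule C1_funI[OF d c])+
qed

lemma bounded_linear_smult: "bounded_linear (\<lambda>v :: cvec. c *s v)"
  by (intro bounded_linearI') (auto simp: vec_eq_iff algebra_simps)

lemma C1_fun_smult:
  assumes "u \<in> C1_fun" shows "(\<lambda>x. c *s u x) \<in> C1_fun"
proof (rule C1_funI(1))
  show "((\<lambda>x. c *s u x) has_vector_derivative c *s vector_derivative u (at x)) (at x)" for x
    by (rule bounded_linear.has_vector_derivative[OF bounded_linear_smult C1_funD(1)[OF assms]])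
  show "continuous_on UNIV (\<lambda>x. c *s vector_derivative u (at x))"
    by (rule bounded_linear.continuous_on[OF bounded_linear_smult C1_funD(2)[OF assms]])
qed

lemma integrable_H1_form:
  assumes "u \<in> C1_fun" "w \<in> C1_fun"
  shows "(\<lambda>x. u x \<bullet> w x + vector_derivative u (at x) \<bullet> vector_derivative w (at x)) integrable_on {-h..h}"
  by (intro integrable_continuous_interval continuous_on_add continuous_on_inner C1_funD assms)

interpretation H1: semi_inner C1_fun "H1_form h" for h
proof
  fix u w g :: cfun and c :: real
  assume u: "u \<in> C1_fun" and w: "w \<in> C1_fun"
  show "(\<lambda>x. u x + c *\<^sub>R w x) \<in> C1_fun" by (rule C1_fun_lc[OF u w])
  show "H1_form h u w = H1_form h w u" by (simp add: H1_form_def inner_commute)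
  assume g: "g \<in> C1_fun"
  have "H1_form h (\<lambda>x. u x + c *\<^sub>R w x) g = integral {-h..h} (\<lambda>x.
     (u x \<bullet> g x + vector_derivative u (at x) \<bullet> vector_derivative g (at x))
     + c * (w x \<bullet> g x + vector_derivative w (at x) \<bullet> vector_derivative g (at x)))"
    unfolding H1_form_def C1_fun_lc(2)[OF u w] by (simp add: inner_left_distrib algebra_simps)
  also have "\<dots> = H1_form h u g + c * H1_form h w g"
    unfolding H1_form_def
    by (subst integral_add)
      (use integrable_H1_form[OF u g] integrable_on_mult_right[OF integrable_H1_form[OF w g], of c] in auto)
  finally show "H1_form h (\<lambda>x. u x + c *\<^sub>R w x) g = H1_form h u g + c * H1_form h w g" .
next
  fix u :: cfun assume "u \<in> C1_fun"
  show "H1_form h u u \<ge> 0" unfolding H1_form_def by (rule integral_nonneg) (use integrable_H1_form \<open>u \<in> C1_fun\<close> in auto)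
qed

lemma H1_form_le:
  assumes u: "u \<in> C1_fun" and h: "h \<ge> 0"
    and b: "\<And>x. x \<in> {-h..h} \<Longrightarrow> norm (u x) \<le> A" "\<And>x. x \<in> {-h..h} \<Longrightarrow> norm (vector_derivative u (at x)) \<le> A"
  shows "sqrt (H1_form h u u) \<le> sqrt (4 * h) * A"
proof -
  have A: "A \<ge> 0" using order_trans[OF norm_ge_zero b(1)[of 0]] h by simp
  have "H1_form h u u \<le> integral {-h..h} (\<lambda>x. 2 * A\<^sup>2)"
    unfolding H1_form_def
  proof (rule integral_le)
    fix x assume x: "x \<in> {-h..h}"
    show "u x \<bullet> u x + vector_derivative u (at x) \<bullet> vector_derivative u (at x) \<le> 2 * A\<^sup>2"
      using power_mono[OF b(1)[OF x], of 2] power_mono[OF b(2)[OF x], of 2] by (simp add: dot_square_norm)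
  qed (use integrable_H1_form u in auto)
  also have "\<dots> = (4 * h) * A\<^sup>2" using h by simp
  finally have "sqrt (H1_form h u u) \<le> sqrt ((4 * h) * A\<^sup>2)" by simp
  thus ?thesis using A by (simp add: real_sqrt_mult)
qed

lemma pvec_C1:
  assumes "entire_coeffs c" "entire_coeffs d"
  shows "pvec c d \<in> C1_fun" "vector_derivative (pvec c d) (at x) = pvec (diffs c) (diffs d) x"
  using C1_funI[OF pvec_has_vector_derivative[OF assms]] continuous_on_pvec entire_coeffs_diffs assms by auto

lemma norm_vec2: "norm (vec2 u v) \<le> norm u + norm v"
proof -
  have "norm (vec2 u v) \<le> (\<Sum>i\<in>UNIV. norm (vec2 u v $ i))"
    unfolding norm_vec_def by (rule L2_set_le_sum) auto
  thus ?thesis by (simp add: sum_2)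
qed

lemma vec2_inner_self: "vec2 u v \<bullet> vec2 u v = (norm u)\<^sup>2 + (norm v)\<^sup>2"
  by (simp add: inner_vec_def sum_2 dot_square_norm)

lemma cspan_fun_lc:
  assumes "u \<in> cspan_fun S" "w \<in> cspan_fun S"
  shows "(\<lambda>x. u x + c *s w x) \<in> cspan_fun S"
proof -
  obtain n :: nat and a U where u: "\<forall>i<n. U i \<in> S" "u = (\<lambda>x. \<Sum>i<n. a i *s U i x)"
    using assms(1) unfolding cspan_fun_def by blast
  obtain k :: nat and b W where w: "\<forall>i<k. W i \<in> S" "w = (\<lambda>x. \<Sum>i<k. b i *s W i x)"
    using assms(2) unfolding cspan_fun_def by blast
  define a' where "a' i = (if i < n then a i else c * b (i - n))" for i
  define U' where "U' i = (if i < n then U i else W (i - n))" for i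
  have split: "(\<Sum>i<n + k. f i) = (\<Sum>i<n. f i) + (\<Sum>i<k. f (n + i))" for f :: "nat \<Rightarrow> cvec"
    by (induction k) (auto simp: add.assoc)
  have "(\<Sum>i<n + k. a' i *s U' i x) = u x + c *s w x" for x
    unfolding split u(2) w(2) a'_def U'_def
    by (simp add: vec_eq_iff sum_distrib_left mult.assoc)
  moreover have "U' i \<in> S" if "i < n + k" for i using that u(1) w(1) by (auto simp: U'_def)
  ultimately show ?thesis unfolding cspan_fun_def
    by (intro CollectI exI[of _ "n + k"] exI[of _ a'] exI[of _ U']) auto
qed

lemma cspan_fun_zero: "(\<lambda>x. 0) \<in> cspan_fun S"
  unfolding cspan_fun_def by (intro CollectI exI[of _ 0]) auto

lemma cspan_fun_base: "u \<in> S \<Longrightarrow> (\<lambda>x. c *s u x) \<in> cspan_fun S"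
  unfolding cspan_fun_def
  by (intro CollectI exI[of _ "1 :: nat"] exI[of _ "\<lambda>_. c"] exI[of _ "\<lambda>_. u"]) auto

lemma scaleR_eq_smult: "c *\<^sub>R (v :: cvec) = complex_of_real c *s v"
  unfolding vec_eq_iff vector_scaleR_component vector_smult_component by (simp add: scaleR_conv_of_real)

section \<open>The complexified functional and its moments\<close>

locale H1_functional =
  fixes h :: real and l :: "cfun \<Rightarrow> real" and K :: real
  assumes h: "h > 0" and K: "K \<ge> 0"
    and linear: "u \<in> C1_fun \<Longrightarrow> w \<in> C1_fun \<Longrightarrow> l (\<lambda>x. u x + c *\<^sub>R w x) = l u + c * l w"
    and bounded: "u \<in> C1_fun \<Longrightarrow> \<bar>l u\<bar> \<le> K * sqrt (H1_form h u u)"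
begin

text \<open>The complex-linear functional with real part l, that is l(u) - i l(iu).\<close>

definition L :: "cfun \<Rightarrow> complex" where "L u = Complex (l u) (- l (\<lambda>x. \<i> *s u x))"

lemma l_zero: "l (\<lambda>x. 0) = 0"
proof -
  have z: "(\<lambda>x. 0) \<in> C1_fun" by (rule C1_funI(1)[where ?u1.0 = "\<lambda>x. 0"]) auto
  show ?thesis using linear[OF z z, of 1] by simp
qed

lemma L_add: "u \<in> C1_fun \<Longrightarrow> w \<in> C1_fun \<Longrightarrow> L (\<lambda>x. u x + w x) = L u + L w"
  using linear[of u w 1] linear[of "\<lambda>x. \<i> *s u x" "\<lambda>x. \<i> *s w x" 1] C1_fun_smult
  by (simp add: L_def complex_eq_iff vector_add_ldistrib)

lemma l_smult:
  assumes u: "u \<in> C1_fun"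
  shows "l (\<lambda>x. z *s u x) = Re z * l u + Im z * l (\<lambda>x. \<i> *s u x)"
proof -
  have z0: "(\<lambda>x. 0) \<in> C1_fun" by (rule C1_funI(1)[where ?u1.0 = "\<lambda>x. 0"]) auto
  have ru: "(\<lambda>x. 0 + Re z *\<^sub>R u x) \<in> C1_fun" by (rule C1_fun_lc[OF z0 u])
  have eq: "(\<lambda>x. z *s u x) = (\<lambda>x. (0 + Re z *\<^sub>R u x) + Im z *\<^sub>R (\<i> *s u x))"
    by (auto simp: vec_eq_iff complex_eq_iff)
  show ?thesis
    unfolding eq using linear[OF ru C1_fun_smult[OF u], of "Im z" \<i>] linear[OF z0 u, of "Re z"] l_zero by simp
qed

lemma L_smult:
  assumes u: "u \<in> C1_fun" shows "L (\<lambda>x. z *s u x) = z * L u"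
proof -
  have "(\<lambda>x. \<i> *s (z *s u x)) = (\<lambda>x. (\<i> * z) *s u x)" by (simp add: vector_smult_assoc)
  thus ?thesis unfolding L_def using l_smult[OF u, of z] l_smult[OF u, of "\<i> * z"]
    by (simp add: complex_eq_iff)
qed

lemma L_bounded:
  assumes u: "u \<in> C1_fun" shows "norm (L u) \<le> 2 * K * sqrt (H1_form h u u)"
proof -
  have vd: "vector_derivative (\<lambda>x. \<i> *s u x) (at x) = \<i> *s vector_derivative u (at x)" for x
    by (intro vector_derivative_at bounded_linear.has_vector_derivative[OF bounded_linear_smult] C1_funD[OF u])
  have "(\<i> *s v) \<bullet> (\<i> *s v) = v \<bullet> v" for v :: cvec
    by (simp add: inner_vec_def dot_square_norm norm_mult)
  hence "H1_form h (\<lambda>x. \<i> *s u x) (\<lambda>x. \<i> *s u x) = H1_form h u u" unfolding H1_form_def vd by simp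
  hence "\<bar>l (\<lambda>x. \<i> *s u x)\<bar> \<le> K * sqrt (H1_form h u u)" using bounded[OF C1_fun_smult[OF u, of \<i>]] by simp
  thus ?thesis using bounded[OF u] cmod_le[of "L u"] by (simp add: L_def)
qed

definition mom1 :: "nat \<Rightarrow> complex" where "mom1 n = L (\<lambda>x. vec2 (of_real x ^ n) 0)"
definition mom2 :: "nat \<Rightarrow> complex" where "mom2 n = L (\<lambda>x. vec2 0 (of_real x ^ n))"

lemma power_has_vector_derivative:
  "((\<lambda>x. of_real x ^ n :: complex) has_vector_derivative of_nat n * of_real x ^ (n - 1)) (at x)"
  by (rule has_vector_derivative_real_field) (auto intro!: derivative_eq_intros)

lemma mono_C1:
  "(\<lambda>x. vec2 (of_real x ^ n) 0) \<in> C1_fun" "(\<lambda>x. vec2 0 (of_real x ^ n)) \<in> C1_fun"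
  "vector_derivative (\<lambda>x. vec2 (of_real x ^ n) 0) (at x) = vec2 (of_nat n * of_real x ^ (n - 1)) 0"
  "vector_derivative (\<lambda>x. vec2 0 (of_real x ^ n)) (at x) = vec2 0 (of_nat n * of_real x ^ (n - 1))"
proof -
  have 1: "((\<lambda>x. vec2 (of_real x ^ n) 0) has_vector_derivative vec2 (of_nat n * of_real x ^ (n - 1)) 0) (at x)"
    "((\<lambda>x. vec2 0 (of_real x ^ n)) has_vector_derivative vec2 0 (of_nat n * of_real x ^ (n - 1))) (at x)" for x
    by (intro vec2_has_vector_derivative power_has_vector_derivative has_vector_derivative_const)+
  have 2: "continuous_on UNIV (\<lambda>x. vec2 (of_nat n * of_real x ^ (n - 1)) 0)"
    "continuous_on UNIV (\<lambda>x. vec2 0 (of_nat n * of_real x ^ (n - 1)))"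
    by (intro continuous_on_vec2 continuous_intros)+
  show "(\<lambda>x. vec2 (of_real x ^ n) 0) \<in> C1_fun" "(\<lambda>x. vec2 0 (of_real x ^ n)) \<in> C1_fun"
    "vector_derivative (\<lambda>x. vec2 (of_real x ^ n) 0) (at x) = vec2 (of_nat n * of_real x ^ (n - 1)) 0"
    "vector_derivative (\<lambda>x. vec2 0 (of_real x ^ n)) (at x) = vec2 0 (of_nat n * of_real x ^ (n - 1))"
    using C1_funI[OF 1(1) 2(1)] C1_funI[OF 1(2) 2(2)] by auto
qed

text \<open>On [-h, h] both x^n and its derivative n x^(n-1) are at most (2H)^n with H = max h 1,
  because n < 2^n; the H^1 bound on L does the rest.\<close>

lemma geom_bounded_moments: "geom_bounded mom1" "geom_bounded mom2"
proof -
  define H where "H = max h 1"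
  have H: "H \<ge> 1" "h \<le> H" by (auto simp: H_def)
  have p1: "norm (of_real x ^ n :: complex) \<le> (2 * H) ^ n" if "x \<in> {-h..h}" for x n
    unfolding norm_power using that H by (intro power_mono) auto
  have p2: "norm (of_nat n * of_real x ^ (n - 1) :: complex) \<le> (2 * H) ^ n" if "x \<in> {-h..h}" for x n
  proof -
    have "norm (of_nat n * of_real x ^ (n - 1) :: complex) = real n * \<bar>x\<bar> ^ (n - 1)"
      by (simp add: norm_mult norm_power)
    also have "\<dots> \<le> 2 ^ n * H ^ (n - 1)"
      using that H by (intro mult_mono power_mono less_imp_le[OF of_nat_less_two_power]) auto
    also have "\<dots> \<le> 2 ^ n * H ^ n" using H by (intro mult_left_mono power_increasing) auto
    finally show ?thesis by (simp add: power_mult_distrib)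
  qed
  have n1: "norm (vec2 u 0) \<le> norm u" "norm (vec2 0 u) \<le> norm u" for u
    using norm_vec2[of u 0] norm_vec2[of 0 u] by auto
  have "norm (mom1 n) \<le> (2 * K * sqrt (4 * h)) * (2 * H) ^ n" for n
  proof -
    have "norm (mom1 n) \<le> 2 * K * sqrt (H1_form h (\<lambda>x. vec2 (of_real x ^ n) 0) (\<lambda>x. vec2 (of_real x ^ n) 0))"
      unfolding mom1_def by (rule L_bounded[OF mono_C1(1)])
    also have "\<dots> \<le> 2 * K * (sqrt (4 * h) * (2 * H) ^ n)"
    proof (intro mult_left_mono H1_form_le mono_C1)
      fix x assume x: "x \<in> {-h..h}"
      show "norm (vec2 (of_real x ^ n) 0) \<le> (2 * H) ^ n" by (rule order_trans[OF n1(1) p1[OF x]])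
      show "norm (vector_derivative (\<lambda>x. vec2 (of_real x ^ n) 0) (at x)) \<le> (2 * H) ^ n"
        unfolding mono_C1 by (rule order_trans[OF n1(1) p2[OF x]])
    qed (use K h in auto)
    finally show ?thesis by simp
  qed
  thus "geom_bounded mom1" unfolding geom_bounded_def using K h H
    by (intro exI[of _ "2 * K * sqrt (4 * h)"] exI[of _ "2 * H"]) auto
  have "norm (mom2 n) \<le> (2 * K * sqrt (4 * h)) * (2 * H) ^ n" for n
  proof -
    have "norm (mom2 n) \<le> 2 * K * sqrt (H1_form h (\<lambda>x. vec2 0 (of_real x ^ n)) (\<lambda>x. vec2 0 (of_real x ^ n)))"
      unfolding mom2_def by (rule L_bounded[OF mono_C1(2)])
    also have "\<dots> \<le> 2 * K * (sqrt (4 * h) * (2 * H) ^ n)"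
    proof (intro mult_left_mono H1_form_le mono_C1)
      fix x assume x: "x \<in> {-h..h}"
      show "norm (vec2 0 (of_real x ^ n)) \<le> (2 * H) ^ n" by (rule order_trans[OF n1(2) p1[OF x]])
      show "norm (vector_derivative (\<lambda>x. vec2 0 (of_real x ^ n)) (at x)) \<le> (2 * H) ^ n"
        unfolding mono_C1 by (rule order_trans[OF n1(2) p2[OF x]])
    qed (use K h in auto)
    finally show ?thesis by simp
  qed
  thus "geom_bounded mom2" unfolding geom_bounded_def using K h H
    by (intro exI[of _ "2 * K * sqrt (4 * h)"] exI[of _ "2 * H"]) auto
qed

definition head :: "nat \<Rightarrow> (nat \<Rightarrow> complex) \<Rightarrow> nat \<Rightarrow> complex" where "head N c n = (if n < N then c n else 0)"
definition tail :: "nat \<Rightarrow> (nat \<Rightarrow> complex) \<Rightarrow> nat \<Rightarrow> complex" where "tail N c n = (if n < N then 0 else c n)"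

lemma entire_coeffs_head_tail: "entire_coeffs c \<Longrightarrow> entire_coeffs (head N c)" "entire_coeffs c \<Longrightarrow> entire_coeffs (tail N c)"
proof -
  assume "entire_coeffs c"
  then obtain M K where MK: "M \<ge> 0" "K \<ge> 0" "\<And>n. norm (c n) \<le> M * K ^ n / fact n"
    unfolding entire_coeffs_def by blast
  hence "norm (head N c n) \<le> M * K ^ n / fact n" "norm (tail N c n) \<le> M * K ^ n / fact n" for n
    by (auto simp: head_def tail_def)
  thus "entire_coeffs (head N c)" "entire_coeffs (tail N c)" using MK unfolding entire_coeffs_def by blast+
qed

lemma pser_head_tail: "entire_coeffs c \<Longrightarrow> pser c x = pser (head N c) x + pser (tail N c) x"
  using pairing_add[OF entire_coeffs_head_tail(1) entire_coeffs_head_tail(2) geom_bounded_power, of c c N N "of_real x"]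
  by (simp add: pser_def head_def tail_def if_distrib cong: if_cong)

lemma L_head: "L (pvec (head N c) (head N d)) = (\<Sum>n<N. c n * mom1 n + d n * mom2 n)"
proof -
  have ph: "pser (head N c) x = (\<Sum>n<N. c n * of_real x ^ n)" for c x
    unfolding pser_def pairing_def head_def
    by (subst suminf_finite[of "{..<N}"]) auto
  define U where "U N x = vec2 (\<Sum>n<N. c n * of_real x ^ n) (\<Sum>n<N. d n * of_real x ^ n)" for N and x :: real
  have "L (U N) = (\<Sum>n<N. c n * mom1 n + d n * mom2 n) \<and> U N \<in> C1_fun"
  proof (induction N)
    case 0
    have "U 0 = (\<lambda>x. 0)" by (auto simp: U_def cvec_eq_iff)
    moreover have "(\<lambda>x. 0) \<in> C1_fun" by (rule C1_funI(1)[where ?u1.0 = "\<lambda>x. 0"]) auto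
    ultimately show ?case by (simp add: L_def l_zero complex_eq_iff)
  next
    case (Suc N)
    let ?a = "\<lambda>x. c N *s vec2 (of_real x ^ N) 0" and ?b = "\<lambda>x. d N *s vec2 0 (of_real x ^ N)"
    have eq: "U (Suc N) = (\<lambda>x. U N x + (?a x + ?b x))" by (auto simp: U_def cvec_eq_iff)
    have ab: "?a \<in> C1_fun" "?b \<in> C1_fun" by (intro C1_fun_smult mono_C1)+
    have abs: "(\<lambda>x. ?a x + ?b x) \<in> C1_fun" using C1_fun_lc(1)[OF ab, of 1] by simp
    have "L (U (Suc N)) = L (U N) + (L ?a + L ?b)"
      unfolding eq using Suc ab abs by (simp add: L_add)
    also have "\<dots> = L (U N) + (c N * mom1 N + d N * mom2 N)"
      by (simp add: L_smult mono_C1 mom1_def mom2_def)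
    finally show ?case using Suc abs C1_fun_lc(1)[of "U N" _ 1] by (auto simp: eq)
  qed
  moreover have "pvec (head N c) (head N d) = U N" by (auto simp: pvec_def U_def ph)
  ultimately show ?thesis by simp
qed

lemma pser_tail_small:
  assumes c: "entire_coeffs c" and r: "r > 0"
  shows "\<forall>\<^sub>F N in sequentially. \<forall>x\<in>{-h..h}. norm (pser (tail N c) x) \<le> r"
proof -
  have s: "summable (\<lambda>n. norm (c n * of_real h ^ n))"
    by (rule summable_pairing(1)[OF c geom_bounded_power])
  obtain N0 where N0: "\<And>N. N \<ge> N0 \<Longrightarrow> norm (\<Sum>i. norm (c (i + N) * of_real h ^ (i + N))) < r"
    using suminf_exist_split[OF r s] by blast
  have "norm (pser (tail N c) x) \<le> r" if N: "N \<ge> N0" and x: "x \<in> {-h..h}" for N x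
  proof -
    have st: "summable (\<lambda>n. tail N c n * of_real x ^ n)"
      by (rule summable_pairing(2)[OF entire_coeffs_head_tail(2)[OF c] geom_bounded_power])
    have "pser (tail N c) x = (\<Sum>i. tail N c (i + N) * of_real x ^ (i + N))"
      unfolding pser_def pairing_def using suminf_split_initial_segment[OF st, of N] by (simp add: tail_def)
    also have "norm \<dots> \<le> (\<Sum>i. norm (c (i + N) * of_real h ^ (i + N)))"
    proof (rule norm_suminf_le)
      show "summable (\<lambda>i. norm (c (i + N) * of_real h ^ (i + N)))" using summable_ignore_initial_segment[OF s, of N] .
      show "norm (tail N c (i + N) * of_real x ^ (i + N)) \<le> norm (c (i + N) * of_real h ^ (i + N))" for i
        using x h by (auto simp: tail_def norm_mult norm_power intro!: mult_left_mono power_mono)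
    qed
    also have "\<dots> \<le> r" using N0[OF N] by simp
    finally show ?thesis .
  qed
  thus ?thesis unfolding eventually_sequentially by blast
qed

lemma diffs_tail: "diffs (tail (Suc N) c) = tail N (diffs c)"
  by (auto simp: diffs_def tail_def)

text \<open>Partial sums are covered by linearity. The tails tend to 0 uniformly on [-h, h] together
  with their derivatives, hence in H^1, and boundedness lets L pass to the limit.\<close>

lemma L_pvec:
  assumes c: "entire_coeffs c" and d: "entire_coeffs d"
  shows "L (pvec c d) = pairing c mom1 + pairing d mom2"
proof -
  have t: "entire_coeffs (tail N c)" "entire_coeffs (tail N d)" "entire_coeffs (head N c)" "entire_coeffs (head N d)" for N
    using entire_coeffs_head_tail c d by auto
  have split: "L (pvec c d) = L (pvec (head N c) (head N d)) + L (pvec (tail N c) (tail N d))" for N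
  proof -
    have "pvec c d = (\<lambda>x. pvec (head N c) (head N d) x + pvec (tail N c) (tail N d) x)"
      by (auto simp: pvec_def cvec_eq_iff pser_head_tail[OF c, of _ N] pser_head_tail[OF d, of _ N])
    thus ?thesis by (simp add: L_add pvec_C1(1) t)
  qed
  \<comment> \<open>The index is \<open>Suc N\<close> because the derivative of the tail from N + 1
    is the tail from N of the differentiated series.\<close>
  have "(\<lambda>N. L (pvec (tail (Suc N) c) (tail (Suc N) d))) \<longlonglongrightarrow> 0"
  proof (rule tendstoI)
    fix e :: real assume e: "e > 0"
    define r where "r = e / (4 * (2 * K * sqrt (4 * h) + 1))"
    have den: "2 * K * sqrt (4 * h) + 1 > 0" using K h by (simp add: add_nonneg_pos)
    have r: "r > 0" unfolding r_def using e den by simp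
    have "\<forall>\<^sub>F N in sequentially. \<forall>x\<in>{-h..h}. norm (pser (tail (Suc N) c) x) \<le> r"
      "\<forall>\<^sub>F N in sequentially. \<forall>x\<in>{-h..h}. norm (pser (tail (Suc N) d) x) \<le> r"
      using pser_tail_small[OF c r] pser_tail_small[OF d r]
        eventually_sequentially_Suc[of "\<lambda>N. \<forall>x\<in>{-h..h}. norm (pser (tail N c) x) \<le> r"]
        eventually_sequentially_Suc[of "\<lambda>N. \<forall>x\<in>{-h..h}. norm (pser (tail N d) x) \<le> r"]
      by simp_all
    moreover note pser_tail_small[OF entire_coeffs_diffs[OF c] r] pser_tail_small[OF entire_coeffs_diffs[OF d] r]
    ultimately show "\<forall>\<^sub>F N in sequentially. dist (L (pvec (tail (Suc N) c) (tail (Suc N) d))) 0 < e"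
    proof eventually_elim
      case (elim N)
      have C1: "pvec (tail (Suc N) c) (tail (Suc N) d) \<in> C1_fun" by (rule pvec_C1(1)[OF t(1,2)])
      have "norm (L (pvec (tail (Suc N) c) (tail (Suc N) d))) \<le> 2 * K * (sqrt (4 * h) * (2 * r))"
      proof (rule order_trans[OF L_bounded[OF C1]], intro mult_left_mono H1_form_le[OF C1])
        fix x assume x: "x \<in> {-h..h}"
        show "norm (pvec (tail (Suc N) c) (tail (Suc N) d) x) \<le> 2 * r"
          unfolding pvec_def using norm_vec2[of "pser (tail (Suc N) c) x" "pser (tail (Suc N) d) x"] elim(1,2) x by force
        show "norm (vector_derivative (pvec (tail (Suc N) c) (tail (Suc N) d)) (at x)) \<le> 2 * r"
          unfolding pvec_C1(2)[OF t(1,2)] diffs_tail unfolding pvec_def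
          using norm_vec2[of "pser (tail N (diffs c)) x" "pser (tail N (diffs d)) x"] elim(3,4) x by force
      qed (use K h in auto)
      also have "\<dots> \<le> (2 * K * sqrt (4 * h) + 1) * (2 * r)" using r by (simp add: algebra_simps)
      also have "\<dots> = e / 2" unfolding r_def using den by (simp add: field_simps)
      also have "\<dots> < e" using e by simp
      finally show ?case by simp
    qed
  qed
  from tendsto_diff[OF tendsto_const[of "L (pvec c d)"] this]
  have "(\<lambda>N. L (pvec c d) - L (pvec (tail (Suc N) c) (tail (Suc N) d))) \<longlonglongrightarrow> L (pvec c d)" by simp
  moreover have "L (pvec c d) - L (pvec (tail N c) (tail N d)) = L (pvec (head N c) (head N d))" for N
    using split[of N] by (metis add_diff_cancel_right')
  ultimately have "(\<lambda>N. L (pvec (head (Suc N) c) (head (Suc N) d))) \<longlonglongrightarrow> L (pvec c d)" by simp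
  hence "(\<lambda>N. \<Sum>n<Suc N. c n * mom1 n + d n * mom2 n) \<longlonglongrightarrow> L (pvec c d)" by (simp only: L_head)
  hence "(\<lambda>n. c n * mom1 n + d n * mom2 n) sums L (pvec c d)"
    unfolding sums_def by (simp only: filterlim_sequentially_Suc[of "\<lambda>N. \<Sum>n<N. c n * mom1 n + d n * mom2 n"])
  moreover have "(\<lambda>n. c n * mom1 n + d n * mom2 n) sums (pairing c mom1 + pairing d mom2)"
    unfolding pairing_def using summable_pairing(2) geom_bounded_moments c d
    by (intro sums_add summable_sums) auto
  ultimately show ?thesis by (rule sums_unique2)
qed

end

text \<open>The source of the factor 1/sqrt|Im p|: it is applied with k = -2 Im p to the square of
  |exp(ipx)|.\<close>

lemma integral_exp_bound:
  fixes k h :: real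
  assumes "k \<noteq> 0" "h > 0"
  shows "integral {-h..h} (\<lambda>x. exp (k * x)) \<le> exp (\<bar>k\<bar> * h) / \<bar>k\<bar>"
proof -
  have "((\<lambda>x. exp (k * x)) has_integral (exp (k * h) / k - exp (k * (-h)) / k)) {-h..h}"
  proof (rule fundamental_theorem_of_calculus)
    show "((\<lambda>x. exp (k * x) / k) has_vector_derivative exp (k * x)) (at x within {-h..h})" for x
      using assms by (auto intro!: derivative_eq_intros simp: has_real_derivative_iff_has_vector_derivative[symmetric])
  qed (use assms in auto)
  hence "integral {-h..h} (\<lambda>x. exp (k * x)) = exp (k * h) / k - exp (k * (-h)) / k" by (rule integral_unique)
  also have "\<dots> \<le> exp (\<bar>k\<bar> * h) / \<bar>k\<bar>"
    using assms mult_nonpos_nonneg[of k "exp (h * k)"] by (cases "k > 0") (auto simp: field_simps)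
  finally show ?thesis .
qed

context H1_functional
begin

lemma pser_exp: "pser (\<lambda>n. p ^ n / fact n) x = exp (p * of_real x)"
  unfolding pser_def pairing_def using exp_converges[of "p * of_real x"]
  by (simp add: sums_iff power_mult_distrib scaleR_conv_of_real field_simps)

lemma diffs_exp: "diffs (\<lambda>n. p ^ n / fact n) = (\<lambda>n. p * (p ^ n / fact n))" for p :: complex
  by (auto simp: diffs_def field_simps fact_Suc simp del: of_nat_Suc)

lemma pser_cmult: "entire_coeffs c \<Longrightarrow> pser (\<lambda>n. p * c n) x = p * pser c x"
  unfolding pser_def by (rule pairing_cmult[OF _ geom_bounded_power])

text \<open>v stands for exp(ipx) in either component. Only pointwise norms of v and of its
  derivative enter the H^1 form, so one estimate serves both components.\<close>

lemma fourier_aux: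
  assumes v: "v \<in> C1_fun" and p: "\<bar>Im p\<bar> \<ge> 1"
    and nv: "\<And>x. v x \<bullet> v x = (norm (exp (\<i> * p * of_real x)))\<^sup>2"
    and ndv: "\<And>x. vector_derivative v (at x) \<bullet> vector_derivative v (at x) = (norm (\<i> * p * exp (\<i> * p * of_real x)))\<^sup>2"
  shows "norm (L v) \<le> (2 * K) * (1 + norm p) * exp (h * \<bar>Im p\<bar>) / sqrt \<bar>Im p\<bar>"
proof -
  have sq: "(exp t)\<^sup>2 = exp (2 * t)" for t :: real by (simp add: exp_double)
  have "H1_form h v v = integral {-h..h} (\<lambda>x. (1 + (norm p)\<^sup>2) * exp ((- 2 * Im p) * x))"
    unfolding H1_form_def nv ndv by (simp add: norm_mult power_mult_distrib sq algebra_simps)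
  also have "\<dots> = (1 + (norm p)\<^sup>2) * integral {-h..h} (\<lambda>x. exp ((- 2 * Im p) * x))" by simp
  also have "\<dots> \<le> (1 + (norm p)\<^sup>2) * (exp (\<bar>- 2 * Im p\<bar> * h) / \<bar>- 2 * Im p\<bar>)"
    using p h by (intro mult_left_mono integral_exp_bound) auto
  also have "\<dots> \<le> (1 + norm p)\<^sup>2 * (exp (2 * (h * \<bar>Im p\<bar>)) / \<bar>Im p\<bar>)"
  proof (rule mult_mono)
    show "1 + (norm p)\<^sup>2 \<le> (1 + norm p)\<^sup>2" by (simp add: power2_sum)
    show "exp (\<bar>- 2 * Im p\<bar> * h) / \<bar>- 2 * Im p\<bar> \<le> exp (2 * (h * \<bar>Im p\<bar>)) / \<bar>Im p\<bar>"
      using p by (intro frac_le) (auto simp: abs_mult mult_ac)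
  qed auto
  also have "\<dots> = ((1 + norm p) * exp (h * \<bar>Im p\<bar>) / sqrt \<bar>Im p\<bar>)\<^sup>2"
    by (simp add: power_mult_distrib power_divide sq)
  finally have "sqrt (H1_form h v v) \<le> (1 + norm p) * exp (h * \<bar>Im p\<bar>) / sqrt \<bar>Im p\<bar>"
    by (intro real_le_lsqrt) auto
  hence "2 * K * sqrt (H1_form h v v) \<le> 2 * K * ((1 + norm p) * exp (h * \<bar>Im p\<bar>) / sqrt \<bar>Im p\<bar>)"
    using K by (intro mult_left_mono) auto
  thus ?thesis using L_bounded[OF v] by (simp add: mult.assoc)
qed

lemma entire_coeffs_zero: "entire_coeffs (\<lambda>n. 0)"
  unfolding entire_coeffs_def by (intro exI[of _ 0]) auto

lemma diffs_zero: "diffs (\<lambda>n. 0 :: complex) = (\<lambda>n. 0)" by (simp add: diffs_def)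

lemma decaying_fourier_moments: "decaying_fourier h mom1" "decaying_fourier h mom2"
proof -
  note ec = entire_coeffs_exp entire_coeffs_zero
  have 1: "fourier mom1 p = L (pvec (\<lambda>n. (\<i> * p) ^ n / fact n) (\<lambda>n. 0))"
    "fourier mom2 p = L (pvec (\<lambda>n. 0) (\<lambda>n. (\<i> * p) ^ n / fact n))" for p
    by (simp_all add: L_pvec ec fourier_def) (simp_all add: pairing_def)
  have nrm: "pvec (\<lambda>n. (\<i> * p) ^ n / fact n) (\<lambda>n. 0) x \<bullet> pvec (\<lambda>n. (\<i> * p) ^ n / fact n) (\<lambda>n. 0) x = (norm (exp (\<i> * p * of_real x)))\<^sup>2"
    "pvec (\<lambda>n. 0) (\<lambda>n. (\<i> * p) ^ n / fact n) x \<bullet> pvec (\<lambda>n. 0) (\<lambda>n. (\<i> * p) ^ n / fact n) x = (norm (exp (\<i> * p * of_real x)))\<^sup>2" for p x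
    unfolding pvec_def vec2_inner_self pser_exp by simp_all
  have nrm': "vector_derivative (pvec (\<lambda>n. (\<i> * p) ^ n / fact n) (\<lambda>n. 0)) (at x) \<bullet> vector_derivative (pvec (\<lambda>n. (\<i> * p) ^ n / fact n) (\<lambda>n. 0)) (at x) = (norm (\<i> * p * exp (\<i> * p * of_real x)))\<^sup>2"
    "vector_derivative (pvec (\<lambda>n. 0) (\<lambda>n. (\<i> * p) ^ n / fact n)) (at x) \<bullet> vector_derivative (pvec (\<lambda>n. 0) (\<lambda>n. (\<i> * p) ^ n / fact n)) (at x) = (norm (\<i> * p * exp (\<i> * p * of_real x)))\<^sup>2" for p x
    unfolding pvec_C1(2)[OF ec] pvec_C1(2)[OF ec(2,1)] diffs_exp diffs_zero
    unfolding pvec_def vec2_inner_self pser_cmult[OF ec(1)] pser_exp by simp_all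
  have "norm (fourier mom1 p) \<le> (2 * K) * (1 + norm p) * exp (h * \<bar>Im p\<bar>) / sqrt \<bar>Im p\<bar>"
    "norm (fourier mom2 p) \<le> (2 * K) * (1 + norm p) * exp (h * \<bar>Im p\<bar>) / sqrt \<bar>Im p\<bar>" if "\<bar>Im p\<bar> \<ge> 1" for p
    unfolding 1
    by (rule fourier_aux[OF pvec_C1(1)[OF ec] that nrm(1) nrm'(1)] fourier_aux[OF pvec_C1(1)[OF ec(2,1)] that nrm(2) nrm'(2)])+
  thus "decaying_fourier h mom1" "decaying_fourier h mom2"
    unfolding decaying_fourier_def using K by (auto intro!: exI[of _ "2 * K"])
qed

end

text \<open>The modes given by everywhere convergent power series, as the construction produces
  them. A general element of \<open>lamb_modes\<close> is arbitrary outside [-h, h] and may fail to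
  lie in \<open>C1_fun\<close>.\<close>

definition smooth_modes :: "real \<Rightarrow> real \<Rightarrow> real \<Rightarrow> real \<Rightarrow> real \<Rightarrow> cfun set" where
  "smooth_modes h lam mu rho om =
     lamb_modes h lam mu rho om \<inter> {pvec c d | c d. entire_coeffs c \<and> entire_coeffs d}"

lemma cspan_smooth_modes_C1: "cspan_fun (smooth_modes h lam mu rho om) \<subseteq> C1_fun"
proof
  fix u assume "u \<in> cspan_fun (smooth_modes h lam mu rho om)"
  then obtain n :: nat and a U where u: "\<forall>i<n. U i \<in> smooth_modes h lam mu rho om" "u = (\<lambda>x. \<Sum>i<n. a i *s U i x)"
    unfolding cspan_fun_def by blast
  have UC: "U i \<in> C1_fun" if "i < n" for i using u(1) that pvec_C1(1) by (auto simp: smooth_modes_def)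
  have "k \<le> n \<Longrightarrow> (\<lambda>x. \<Sum>i<k. a i *s U i x) \<in> C1_fun" for k
  proof (induction k)
    case 0
    show ?case by (rule C1_funI(1)[where ?u1.0 = "\<lambda>x. 0"]) auto
  next
    case (Suc k)
    show ?case using C1_fun_lc(1)[OF Suc.IH C1_fun_smult[OF UC, of k "a k"], of 1] Suc.prems by simp
  qed
  thus "u \<in> C1_fun" using u(2) by simp
qed

text \<open>The targets are power series because the functional is computed only on these: vanishing
  moments give L = 0 on \<open>pvec c d\<close>, contrary to the separation. General H^1 functions
  are reached through polynomials.\<close>

theorem modes_approximate_entire:
  fixes h lam mu rho om :: real
  assumes "h > 0" and "mu > 0" and "3 * lam + 2 * mu > 0" and "rho > 0" and "om > 0"
    and c: "entire_coeffs c" and d: "entire_coeffs d" and e: "\<epsilon> > 0"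
  shows "\<exists>u\<in>cspan_fun (smooth_modes h lam mu rho om). H1_form h (\<lambda>x. pvec c d x - u x) (\<lambda>x. pvec c d x - u x) < \<epsilon>"
proof (rule ccontr)
  define S where "S = cspan_fun (smooth_modes h lam mu rho om)"
  assume "\<not> ?thesis"
  hence far: "H1_form h (\<lambda>x. pvec c d x - u x) (\<lambda>x. pvec c d x - u x) \<ge> \<epsilon>" if "u \<in> S" for u
    using that by (force simp: S_def)
  have S1: "S \<subseteq> C1_fun" unfolding S_def by (rule cspan_smooth_modes_C1)
  have S2: "S \<noteq> {}" unfolding S_def using cspan_fun_zero by blast
  have S3: "(\<lambda>x. u x + c *\<^sub>R w x) \<in> S" if "u \<in> S" "w \<in> S" for u w c
    using that unfolding S_def scaleR_eq_smult by (rule cspan_fun_lc)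
  obtain l K where lK: "K \<ge> 0"
    "\<And>u w c. u \<in> C1_fun \<Longrightarrow> w \<in> C1_fun \<Longrightarrow> l (\<lambda>x. u x + c *\<^sub>R w x) = l u + c * (l w :: real)"
    "\<And>u. u \<in> C1_fun \<Longrightarrow> \<bar>l u\<bar> \<le> K * sqrt (H1_form h u u)" "\<And>u. u \<in> S \<Longrightarrow> l u = 0" "l (pvec c d) \<noteq> 0"
    by (rule H1.separating_functional[OF S1 S2 S3 pvec_C1(1)[OF c d] e far]) (assumption | rule that)+
  interpret H1_functional h l K by unfold_locales (use assms lK in auto)
  define a where "a = om\<^sup>2 * rho / (lam + 2 * mu)"
  define b where "b = om\<^sup>2 * rho / mu"
  \<comment> \<open>From 3\<lambda> + 2\<mu> > 0 and \<mu> > 0 follows \<lambda> + 2\<mu> > 4\<mu>/3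
    > \<mu>, which yields a < b.\<close>
  have pos: "lam + 2 * mu > 0" "om\<^sup>2 * rho > 0" "mu < lam + 2 * mu" using assms by auto
  have ab: "0 < a" "a < b" using pos assms by (auto simp: a_def b_def intro!: divide_strict_left_mono)
  interpret annihilated_moments h a b mom1 mom2
    by unfold_locales (use assms ab geom_bounded_moments decaying_fourier_moments in auto)
  have kill: "pairing c mom1 + pairing d mom2 = 0"
    if "entire_coeffs c" "entire_coeffs d" "pvec c d \<in> lamb_modes h lam mu rho om" for c d
  proof -
    \<comment> \<open>The span is complex, so l vanishes at u and at iu, and both parts of L u are
      zero.\<close>
    have "(\<lambda>x. z *s pvec c d x) \<in> S" for z
      unfolding S_def by (rule cspan_fun_base) (use that in \<open>auto simp: smooth_modes_def\<close>)
    from lK(4)[OF this] have "l (\<lambda>x. z *s pvec c d x) = 0" for z .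
    from this[of 1] this[of \<i>] have "L (pvec c d) = 0" by (simp add: L_def complex_eq_iff)
    thus ?thesis using L_pvec[OF that(1,2)] by simp
  qed
  have La: "(lam + 2 * mu) * a = om\<^sup>2 * rho" and Lb: "mu * b = om\<^sup>2 * rho"
    using pos assms by (auto simp: a_def b_def)
  have "mom1 n = 0" "mom2 n = 0" for n
    using moments_vanish_modes[OF La Lb kill] by auto
  hence "L (pvec c d) = 0" using L_pvec[OF c d] by (simp add: pairing_def)
  hence "l (pvec c d) = 0" by (simp add: L_def complex_eq_iff)
  with lK(5) show False by simp
qed

section \<open>Square integrable functions on an interval\<close>

definition mu_on :: "real \<Rightarrow> real measure" where
  "mu_on h = restrict_space lborel {-h<..<h}"

definition sq_int :: "real \<Rightarrow> (real \<Rightarrow> real) set" where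
  "sq_int h = {F. F \<in> borel_measurable (mu_on h) \<and> integrable (mu_on h) (\<lambda>x. (F x)\<^sup>2)}"

definition L2_form :: "real \<Rightarrow> (real \<Rightarrow> real) \<Rightarrow> (real \<Rightarrow> real) \<Rightarrow> real" where
  "L2_form h F G = (LINT x|mu_on h. F x * G x)"

lemma space_mu_on [simp]: "space (mu_on h) = {-h<..<h}"
  by (simp add: mu_on_def space_restrict_space)

lemma measurable_mu_on:
  fixes f :: "real \<Rightarrow> 'a :: euclidean_space"
  shows "f \<in> borel_measurable (mu_on h) \<longleftrightarrow> set_borel_measurable lborel {-h<..<h} f"
  unfolding mu_on_def set_borel_measurable_def by (subst borel_measurable_restrict_space_iff) auto

lemma integrable_mu_on:
  fixes f :: "real \<Rightarrow> 'a :: euclidean_space"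
  shows "integrable (mu_on h) f \<longleftrightarrow> set_integrable lborel {-h<..<h} f"
  unfolding mu_on_def set_integrable_def by (subst integrable_restrict_space) auto

lemma integral_mu_on:
  fixes f :: "real \<Rightarrow> 'a :: euclidean_space"
  shows "(LINT x|mu_on h. f x) = (LINT x:{-h<..<h}|lborel. f x)"
  unfolding mu_on_def set_lebesgue_integral_def by (subst integral_restrict_space) auto

lemma integrable_mult_sq_int:
  assumes "F \<in> sq_int h" "G \<in> sq_int h"
  shows "integrable (mu_on h) (\<lambda>x. F x * G x)"
proof (rule Bochner_Integration.integrable_bound)
  show "integrable (mu_on h) (\<lambda>x. (F x)\<^sup>2 + (G x)\<^sup>2)" using assms by (auto simp: sq_int_def)
  show "(\<lambda>x. F x * G x) \<in> borel_measurable (mu_on h)" using assms by (auto simp: sq_int_def)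
  have "\<bar>u * v\<bar> \<le> u\<^sup>2 + v\<^sup>2" for u v :: real
    using sum_squares_bound[of "\<bar>u\<bar>" "\<bar>v\<bar>"] mult_nonneg_nonneg[of "\<bar>u\<bar>" "\<bar>v\<bar>"]
    unfolding abs_mult power2_abs by linarith
  thus "AE x in mu_on h. norm (F x * G x) \<le> norm ((F x)\<^sup>2 + (G x)\<^sup>2)" by auto
qed

lemma sq_int_lc:
  assumes "F \<in> sq_int h" "G \<in> sq_int h"
  shows "(\<lambda>x. F x + c *\<^sub>R G x) \<in> sq_int h"
proof -
  have "integrable (mu_on h) (\<lambda>x. (F x)\<^sup>2 + 2 * c * (F x * G x) + c\<^sup>2 * (G x)\<^sup>2)"
    using assms integrable_mult_sq_int[OF assms] by (auto simp: sq_int_def)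
  moreover have "(\<lambda>x. (F x)\<^sup>2 + 2 * c * (F x * G x) + c\<^sup>2 * (G x)\<^sup>2) = (\<lambda>x. (F x + c *\<^sub>R G x)\<^sup>2)"
    by (auto simp: power2_eq_square algebra_simps)
  ultimately show ?thesis using assms by (auto simp: sq_int_def)
qed

lemma sq_int_diff: "F \<in> sq_int h \<Longrightarrow> G \<in> sq_int h \<Longrightarrow> (\<lambda>x. F x - G x) \<in> sq_int h"
  using sq_int_lc[of F h G "- 1"] by simp

lemma sq_int_continuous:
  assumes "continuous_on UNIV F" shows "F \<in> sq_int h"
  unfolding sq_int_def measurable_mu_on integrable_mu_on
  by (auto intro!: set_borel_measurable_continuous set_integrable_continuous continuous_intros assms)

interpretation L2: semi_inner "sq_int h" "L2_form h" for h
proof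
  fix u w g :: "real \<Rightarrow> real" and c :: real
  assume u: "u \<in> sq_int h" and w: "w \<in> sq_int h"
  show "(\<lambda>x. u x + c *\<^sub>R w x) \<in> sq_int h" by (rule sq_int_lc[OF u w])
  show "L2_form h u w = L2_form h w u" by (simp add: L2_form_def mult.commute)
  assume g: "g \<in> sq_int h"
  have "L2_form h (\<lambda>x. u x + c *\<^sub>R w x) g = (LINT x|mu_on h. u x * g x + c * (w x * g x))"
    by (simp add: L2_form_def algebra_simps)
  also have "\<dots> = L2_form h u g + c * L2_form h w g"
    unfolding L2_form_def using integrable_mult_sq_int u w g by (subst Bochner_Integration.integral_add) auto
  finally show "L2_form h (\<lambda>x. u x + c *\<^sub>R w x) g = L2_form h u g + c * L2_form h w g" .
next
  fix u :: "real \<Rightarrow> real"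
  show "L2_form h u u \<ge> 0" by (simp add: L2_form_def)
qed

lemma L2_form_sum_le:
  assumes "u \<in> sq_int h" "w \<in> sq_int h"
  shows "L2_form h (\<lambda>x. u x + w x) (\<lambda>x. u x + w x) \<le> 2 * L2_form h u u + 2 * L2_form h w w"
  using L2.expand[OF assms, of 1] L2.expand[OF assms, of "- 1"] L2.pos[OF sq_int_diff[OF assms]]
  by (simp add: power2_eq_square)

lemma L2_form_triangle:
  assumes "u \<in> sq_int h" "v \<in> sq_int h" "w \<in> sq_int h"
  shows "L2_form h (\<lambda>x. u x - w x) (\<lambda>x. u x - w x) \<le>
    2 * L2_form h (\<lambda>x. u x - v x) (\<lambda>x. u x - v x) + 2 * L2_form h (\<lambda>x. v x - w x) (\<lambda>x. v x - w x)"
  using L2_form_sum_le[OF sq_int_diff[OF assms(1,2)] sq_int_diff[OF assms(2,3)]] by simp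

lemma measure_mu_on: "h > 0 \<Longrightarrow> (LINT x|mu_on h. (c :: real)) = 2 * h * c"
  unfolding integral_mu_on by (subst set_integral_continuous) (auto intro: continuous_intros)

lemma integrable_const_mu_on: "integrable (mu_on h) (\<lambda>x. c :: real)"
  unfolding integrable_mu_on by (intro set_integrable_continuous continuous_intros)

lemma L2_form_le_sup:
  assumes "h > 0" "F \<in> sq_int h" "\<And>x. x \<in> {-h<..<h} \<Longrightarrow> \<bar>F x\<bar> \<le> A"
  shows "L2_form h F F \<le> 2 * h * A\<^sup>2"
proof -
  have "L2_form h F F \<le> (LINT x|mu_on h. A\<^sup>2)"
    unfolding L2_form_def
  proof (rule integral_mono)
    show "F x * F x \<le> A\<^sup>2" if "x \<in> space (mu_on h)" for x
      using power_mono[OF assms(3), of x 2] that by (simp add: power2_eq_square)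
  qed (use integrable_mult_sq_int assms integrable_const_mu_on in auto)
  thus ?thesis unfolding measure_mu_on[OF assms(1)] .
qed

lemma L2_dominated_convergence:
  assumes F: "F \<in> sq_int h" and Fn: "\<And>n. Fn n \<in> sq_int h"
    and lim: "AE x in mu_on h. (\<lambda>n. Fn n x) \<longlonglongrightarrow> F x"
    and W: "integrable (mu_on h) W" and dom: "\<And>n. AE x in mu_on h. (F x - Fn n x)\<^sup>2 \<le> W x"
  shows "(\<lambda>n. L2_form h (\<lambda>x. F x - Fn n x) (\<lambda>x. F x - Fn n x)) \<longlonglongrightarrow> 0"
proof -
  have [measurable]: "F \<in> borel_measurable (mu_on h)" "\<And>n. Fn n \<in> borel_measurable (mu_on h)"
    using F Fn by (auto simp: sq_int_def)
  have "(\<lambda>n. LINT x|mu_on h. (F x - Fn n x) * (F x - Fn n x)) \<longlonglongrightarrow> (LINT x|mu_on h. 0)"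
  proof (rule integral_dominated_convergence[where w = W])
    show "AE x in mu_on h. (\<lambda>n. (F x - Fn n x) * (F x - Fn n x)) \<longlonglongrightarrow> 0"
      using lim
    proof eventually_elim
      case (elim x)
      have "(\<lambda>n. (F x - Fn n x) * (F x - Fn n x)) \<longlonglongrightarrow> (F x - F x) * (F x - F x)"
        by (intro tendsto_intros elim)
      thus ?case by simp
    qed
    show "AE x in mu_on h. norm ((F x - Fn n x) * (F x - Fn n x)) \<le> W x" for n
      using dom[of n] by (simp add: power2_eq_square)
  qed (use W in measurable)
  thus ?thesis by (simp add: L2_form_def)
qed

definition clip :: "real \<Rightarrow> real \<Rightarrow> real" where "clip M t = max (- M) (min M t)"

lemma clip_bound: "M \<ge> 0 \<Longrightarrow> \<bar>clip M t\<bar> \<le> M" "M \<ge> 0 \<Longrightarrow> \<bar>t - clip M t\<bar> \<le> \<bar>t\<bar>" "\<bar>t\<bar> \<le> M \<Longrightarrow> clip M t = t"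
  by (auto simp: clip_def max_def min_def)

lemma continuous_on_clip: "continuous_on A F \<Longrightarrow> continuous_on A (\<lambda>x. clip M (F x))"
  unfolding clip_def by (intro continuous_intros)

lemma AE_mu_on:
  assumes "negligible N" "\<And>x. x \<in> {-h<..<h} \<Longrightarrow> x \<notin> N \<Longrightarrow> P x"
  shows "AE x in mu_on h. P x"
proof -
  obtain N' where N': "N \<subseteq> N'" "N' \<in> null_sets lborel"
    using assms(1) unfolding negligible_iff_null_sets null_sets_completion_iff2 by blast
  have "AE x in lborel. x \<notin> N'" by (rule AE_not_in[OF N'(2)])
  hence "AE x in lborel. x \<in> {-h<..<h} \<longrightarrow> P x"
    by eventually_elim (use N'(1) assms(2) in blast)
  thus ?thesis unfolding mu_on_def by (subst AE_restrict_space_iff) auto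
qed

text \<open>A measurable function is an almost everywhere limit of continuous ones, possibly without
  any common bound. Hence F is first cut at a height M, and then the approximants are cut at the
  same height, which supplies a constant dominating function.\<close>

lemma L2_approx_continuous:
  assumes h: "h > 0" and F: "F \<in> sq_int h" and e: "\<epsilon> > 0"
  shows "\<exists>g. continuous_on UNIV g \<and> L2_form h (\<lambda>x. F x - g x) (\<lambda>x. F x - g x) < \<epsilon>"
proof -
  define F0 where "F0 x = indicator {-h<..<h} x *\<^sub>R F x" for x
  have mF: "F \<in> borel_measurable (mu_on h)" "integrable (mu_on h) (\<lambda>x. (F x)\<^sup>2)" using F by (auto simp: sq_int_def)
  have "F0 \<in> borel_measurable lborel"
    using mF(1) unfolding measurable_mu_on set_borel_measurable_def F0_def[abs_def] .
  hence "F0 \<in> borel_measurable lebesgue" by (simp add: measurable_completion)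
  hence "F0 measurable_on UNIV" by (intro lebesgue_measurable_imp_measurable_on) auto
  then obtain N g where g: "negligible N" "\<And>n. continuous_on UNIV (g n)" "\<And>x. x \<notin> N \<Longrightarrow> (\<lambda>n. g n x) \<longlonglongrightarrow> F0 x"
    unfolding measurable_on_def by auto
  have clipF: "(\<lambda>x. clip M (F x)) \<in> sq_int h" if "M \<ge> 0" for M
  proof -
    have m: "(\<lambda>x. clip M (F x)) \<in> borel_measurable (mu_on h)" unfolding clip_def using mF(1) by measurable
    moreover have "integrable (mu_on h) (\<lambda>x. (clip M (F x))\<^sup>2)"
    proof (rule Bochner_Integration.integrable_bound[OF integrable_const_mu_on[of h "M\<^sup>2"]])
      show "AE x in mu_on h. norm ((clip M (F x))\<^sup>2) \<le> norm (M\<^sup>2)"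
        using power_mono[OF clip_bound(1)[OF that] abs_ge_zero, of _ 2] by auto
    qed (use m in measurable)
    ultimately show ?thesis by (simp add: sq_int_def)
  qed
  have "(\<lambda>n. L2_form h (\<lambda>x. F x - clip (real n) (F x)) (\<lambda>x. F x - clip (real n) (F x))) \<longlonglongrightarrow> 0"
  proof (rule L2_dominated_convergence[OF F clipF _ mF(2)])
    show "AE x in mu_on h. (\<lambda>n. clip (real n) (F x)) \<longlonglongrightarrow> F x"
    proof (intro AE_I2 tendsto_eventually)
      fix x
      obtain n0 where "\<bar>F x\<bar> \<le> real n0" using real_arch_simple by blast
      thus "\<forall>\<^sub>F n in sequentially. clip (real n) (F x) = F x"
        unfolding eventually_sequentially
        by (intro exI[of _ n0] allI impI clip_bound(3)) (meson of_nat_mono order_trans)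
    qed
    show "AE x in mu_on h. (F x - clip (real n) (F x))\<^sup>2 \<le> (F x)\<^sup>2" for n
      using power_mono[OF clip_bound(2)[of "real n"] abs_ge_zero, of _ 2] by auto
  qed auto
  from order_tendstoD(2)[OF this, of "\<epsilon> / 4"] e
  obtain n where n: "L2_form h (\<lambda>x. F x - clip (real n) (F x)) (\<lambda>x. F x - clip (real n) (F x)) < \<epsilon> / 4"
    using eventually_happens[of _ sequentially] by auto
  define M where "M = real n"
  have M: "M \<ge> 0" by (simp add: M_def)
  have gC: "(\<lambda>x. clip M (g k x)) \<in> sq_int h" for k
    by (intro sq_int_continuous continuous_on_clip g)
  have "(\<lambda>k. L2_form h (\<lambda>x. clip M (F x) - clip M (g k x)) (\<lambda>x. clip M (F x) - clip M (g k x))) \<longlonglongrightarrow> 0"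
  proof (rule L2_dominated_convergence[OF clipF[OF M] gC _ integrable_const_mu_on[of h "(2 * M)\<^sup>2"]])
    show "AE x in mu_on h. (\<lambda>k. clip M (g k x)) \<longlonglongrightarrow> clip M (F x)"
    proof (rule AE_mu_on[OF g(1)])
      fix x assume "x \<in> {-h<..<h}" "x \<notin> N"
      hence "(\<lambda>k. g k x) \<longlonglongrightarrow> F x" using g(3)[of x] by (simp add: F0_def)
      thus "(\<lambda>k. clip M (g k x)) \<longlonglongrightarrow> clip M (F x)" unfolding clip_def by (intro tendsto_intros)
    qed
    show "AE x in mu_on h. (clip M (F x) - clip M (g k x))\<^sup>2 \<le> (2 * M)\<^sup>2" for k
    proof (rule AE_I2)
      fix x
      have "\<bar>clip M (F x) - clip M (g k x)\<bar> \<le> 2 * M"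
        using clip_bound(1)[OF M, of "F x"] clip_bound(1)[OF M, of "g k x"] by linarith
      from power_mono[OF this abs_ge_zero, of 2] show "(clip M (F x) - clip M (g k x))\<^sup>2 \<le> (2 * M)\<^sup>2" by simp
    qed
  qed
  from order_tendstoD(2)[OF this, of "\<epsilon> / 4"] e
  obtain k where k: "L2_form h (\<lambda>x. clip M (F x) - clip M (g k x)) (\<lambda>x. clip M (F x) - clip M (g k x)) < \<epsilon> / 4"
    using eventually_happens[of _ sequentially] by auto
  have "L2_form h (\<lambda>x. F x - clip M (g k x)) (\<lambda>x. F x - clip M (g k x)) < \<epsilon>"
    using L2_form_triangle[OF F clipF[OF M] gC[of k]] k n unfolding M_def by linarith
  thus ?thesis using continuous_on_clip[OF g(2)] by blast
qed

definition rpoly :: "(nat \<Rightarrow> real) \<Rightarrow> nat \<Rightarrow> real \<Rightarrow> real" where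
  "rpoly a n x = (\<Sum>i\<le>n. a i * x ^ i)"

lemma continuous_on_rpoly: "continuous_on A (rpoly a n)"
  unfolding rpoly_def[abs_def] by (intro continuous_intros)

lemma L2_approx_poly:
  assumes h: "h > 0" and F: "F \<in> sq_int h" and e: "\<epsilon> > 0"
  shows "\<exists>a n. L2_form h (\<lambda>x. F x - rpoly a n x) (\<lambda>x. F x - rpoly a n x) < \<epsilon>"
proof -
  obtain g where g: "continuous_on UNIV g" "L2_form h (\<lambda>x. F x - g x) (\<lambda>x. F x - g x) < \<epsilon> / 4"
    using L2_approx_continuous[OF h F, of "\<epsilon> / 4"] e by auto
  \<comment> \<open>A uniform error r on an interval of length 2h costs 2h r^2 = \<epsilon>/4 in the
    squared norm.\<close>
  define r where "r = sqrt (\<epsilon> / (8 * h))"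
  have r: "r > 0" "r\<^sup>2 = \<epsilon> / (8 * h)" using e h by (auto simp: r_def)
  obtain p where p: "real_polynomial_function p" "\<And>x. x \<in> {-h..h} \<Longrightarrow> \<bar>g x - p x\<bar> < r"
    using Stone_Weierstrass_real_polynomial_function[of "{-h..h}" g r] g(1) r(1) continuous_on_subset by blast
  obtain a n where an: "p = rpoly a n"
    using p(1) unfolding real_polynomial_function_iff_sum rpoly_def[abs_def] by blast
  have s: "g \<in> sq_int h" "rpoly a n \<in> sq_int h" by (intro sq_int_continuous g continuous_on_rpoly)+
  have "L2_form h (\<lambda>x. g x - rpoly a n x) (\<lambda>x. g x - rpoly a n x) \<le> 2 * h * r\<^sup>2"
    by (rule L2_form_le_sup[OF h sq_int_diff[OF s]]) (use p(2) an in \<open>auto intro: less_imp_le\<close>)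
  also have "\<dots> = \<epsilon> / 4" using r h by (simp add: field_simps)
  finally have "L2_form h (\<lambda>x. F x - rpoly a n x) (\<lambda>x. F x - rpoly a n x) < \<epsilon>"
    using L2_form_triangle[OF F s] g(2) e by linarith
  thus ?thesis by blast
qed

section \<open>Smooth cutoffs and density of test functions\<close>

definition expinv :: "nat \<Rightarrow> real \<Rightarrow> real" where
  "expinv n y = (if y > 0 then exp (- 1 / y) / y ^ n else 0)"

lemma expinv_tendsto_0: "(expinv n \<longlongrightarrow> 0) (at 0)"
proof -
  have "((\<lambda>y. (inverse y) ^ n / exp (inverse y)) \<longlongrightarrow> (0 :: real)) (at_right 0)"
    by (rule filterlim_compose[OF tendsto_power_div_exp_0 filterlim_inverse_at_top_right])
  hence "(expinv n \<longlongrightarrow> 0) (at_right 0)"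
  proof (rule Lim_transform_eventually)
    show "\<forall>\<^sub>F y in at_right 0. (inverse y) ^ n / exp (inverse y) = expinv n y"
      unfolding eventually_at_right_field
      by (intro exI[of _ 1]) (auto simp: expinv_def exp_minus field_simps)
  qed
  moreover have "(expinv n \<longlongrightarrow> 0) (at_left 0)"
    by (rule tendsto_eventually) (auto simp: expinv_def eventually_at_filter)
  ultimately show ?thesis by (simp add: filterlim_at_split)
qed

text \<open>The functions exp(-1/y)/y^n are closed under differentiation up to linear combination.
  At 0 the difference quotient of \<open>expinv n\<close> is \<open>expinv (Suc n)\<close>, which
  tends to 0.\<close>

lemma expinv_has_derivative:
  "(expinv n has_real_derivative expinv (n + 2) y - real n * expinv (n + 1) y) (at y)"
proof -
  consider "y > 0" | "y < 0" | "y = 0" by linarith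
  thus ?thesis
  proof cases
    case 1
    have "((\<lambda>y. exp (- 1 / y) / y ^ n) has_real_derivative expinv (n + 2) y - real n * expinv (n + 1) y) (at y)"
    proof (cases n)
      case 0
      show ?thesis using 1 unfolding 0 expinv_def
        by (auto intro!: derivative_eq_intros simp: field_simps power2_eq_square)
    next
      case (Suc k)
      have "k = 0 \<or> y ^ k = y * y ^ (k - Suc 0)" by (cases k) auto
      thus ?thesis using 1 unfolding Suc expinv_def
        by (auto intro!: derivative_eq_intros simp: field_simps power2_eq_square)
    qed
    moreover have ev: "\<forall>\<^sub>F t in nhds y. exp (- 1 / t) / t ^ n = expinv n t"
    proof -
      have "\<forall>\<^sub>F t in nhds y. t \<in> {0<..}" using 1 by (intro eventually_nhds_in_open) auto
      thus ?thesis by eventually_elim (simp add: expinv_def)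
    qed
    ultimately show ?thesis using DERIV_cong_ev[OF refl ev refl] by simp
  next
    case 2
    have ev: "\<forall>\<^sub>F t in nhds y. 0 = expinv n t"
    proof -
      have "\<forall>\<^sub>F t in nhds y. t \<in> {..<0}" using 2 by (intro eventually_nhds_in_open) auto
      thus ?thesis by eventually_elim (simp add: expinv_def)
    qed
    moreover have "((\<lambda>t. 0) has_real_derivative expinv (n + 2) y - real n * expinv (n + 1) y) (at y)"
      using 2 by (simp add: expinv_def)
    ultimately show ?thesis using DERIV_cong_ev[OF refl ev refl] by simp
  next
    case 3
    have "(expinv n has_real_derivative 0) (at 0)"
      unfolding has_field_derivative_iff
    proof (rule Lim_transform_eventually[OF expinv_tendsto_0[of "Suc n"]])
      show "\<forall>\<^sub>F t in at 0. expinv (Suc n) t = (expinv n t - expinv n 0) / (t - 0)"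
        by (auto simp: eventually_at_filter expinv_def)
    qed
    thus ?thesis using 3 by (simp add: expinv_def)
  qed
qed

text \<open>A syntactic class closed under derivatives and containing polynomials times cutoffs;
  iterating derivatives inside it yields the infinite sequence that \<open>test_fun\<close> asks
  for.\<close>

inductive smooth_fun :: "(real \<Rightarrow> real) \<Rightarrow> bool" where
  smooth_const: "smooth_fun (\<lambda>x. c)"
| smooth_ident: "smooth_fun (\<lambda>x. x)"
| smooth_expinv: "smooth_fun (\<lambda>x. expinv n (c * x + d))"
| smooth_add: "smooth_fun f \<Longrightarrow> smooth_fun g \<Longrightarrow> smooth_fun (\<lambda>x. f x + g x)"
| smooth_mult: "smooth_fun f \<Longrightarrow> smooth_fun g \<Longrightarrow> smooth_fun (\<lambda>x. f x * g x)"

lemma smooth_fun_derivative: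
  assumes "smooth_fun f"
  shows "\<exists>f'. smooth_fun f' \<and> (\<forall>x. (f has_real_derivative f' x) (at x))"
  using assms
proof induction
  case (smooth_const c)
  show ?case by (intro exI[of _ "\<lambda>x. 0"]) (auto intro: smooth_fun.intros)
next
  case smooth_ident
  show ?case by (intro exI[of _ "\<lambda>x. 1"]) (auto intro: smooth_fun.intros)
next
  case (smooth_expinv n c d)
  let ?f' = "\<lambda>x. c * (expinv (n + 2) (c * x + d) + (- real n) * expinv (n + 1) (c * x + d))"
  have "smooth_fun ?f'" by (intro smooth_fun.intros)
  moreover have "((\<lambda>x. expinv n (c * x + d)) has_real_derivative ?f' x) (at x)" for x
  proof -
    have "((\<lambda>x. c * x + d) has_real_derivative c) (at x)" by (auto intro!: derivative_eq_intros)
    from DERIV_chain2[OF expinv_has_derivative this] show ?thesis by (simp add: algebra_simps)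
  qed
  ultimately show ?case by blast
next
  case (smooth_add f g)
  then obtain f' g' where "smooth_fun f'" "\<And>x. (f has_real_derivative f' x) (at x)"
    "smooth_fun g'" "\<And>x. (g has_real_derivative g' x) (at x)" by blast
  thus ?case by (intro exI[of _ "\<lambda>x. f' x + g' x"]) (auto intro: smooth_fun.intros DERIV_add)
next
  case (smooth_mult f g)
  then obtain f' g' where d: "smooth_fun f'" "\<And>x. (f has_real_derivative f' x) (at x)"
    "smooth_fun g'" "\<And>x. (g has_real_derivative g' x) (at x)" by blast
  have "smooth_fun (\<lambda>x. f' x * g x + g' x * f x)" using d smooth_mult by (intro smooth_fun.intros)
  moreover have "((\<lambda>x. f x * g x) has_real_derivative f' x * g x + g' x * f x) (at x)" for x
    using DERIV_mult[OF d(2) d(4)] .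
  ultimately show ?case by blast
qed

lemma smooth_fun_sequence:
  assumes "smooth_fun f"
  shows "\<exists>D :: nat \<Rightarrow> real \<Rightarrow> real. D 0 = f \<and> (\<forall>k x. (D k has_real_derivative D (Suc k) x) (at x))"
proof -
  define der where "der f = (SOME f'. smooth_fun f' \<and> (\<forall>x. (f has_real_derivative f' x) (at x)))" for f :: "real \<Rightarrow> real"
  have der: "smooth_fun (der f) \<and> (\<forall>x. (f has_real_derivative der f x) (at x))" if "smooth_fun f" for f
    unfolding der_def by (rule someI_ex[OF smooth_fun_derivative[OF that]])
  define D where "D k = (der ^^ k) f" for k
  have "smooth_fun (D k)" for k by (induction k) (use assms der in \<open>auto simp: D_def\<close>)
  thus ?thesis using der by (intro exI[of _ D]) (auto simp: D_def)
qed

lemma smooth_rpoly: "smooth_fun (rpoly a n)"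
proof -
  have "smooth_fun (\<lambda>x. x ^ i)" for i by (induction i) (auto intro: smooth_fun.intros)
  hence s: "smooth_fun (\<lambda>x. a i * x ^ i)" for i by (intro smooth_mult smooth_const)
  show ?thesis unfolding rpoly_def[abs_def]
  proof (induction n)
    case 0
    show ?case using s[of 0] by simp
  next
    case (Suc n)
    show ?case using smooth_add[OF Suc s[of "Suc n"]] by simp
  qed
qed

text \<open>The arguments are n(x + h) - 1 and n(h - x) - 1. The product vanishes unless x has
  distance more than 1/n from both endpoints; at a fixed interior point both arguments tend to
  infinity, and the value to 1.\<close>

definition cutoff :: "real \<Rightarrow> nat \<Rightarrow> real \<Rightarrow> real" where
  "cutoff h n x = expinv 0 (real n * x + (real n * h - 1)) * expinv 0 ((- real n) * x + (real n * h - 1))"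

lemma test_fun_cutoff:
  assumes "n > 0" "smooth_fun f"
  shows "test_fun (- h) h (\<lambda>x. cutoff h n x * f x)"
  unfolding test_fun_def
proof
  have "smooth_fun (\<lambda>x. cutoff h n x * f x)"
    unfolding cutoff_def by (intro smooth_mult smooth_expinv assms)
  thus "\<exists>D :: nat \<Rightarrow> real \<Rightarrow> real. D 0 = (\<lambda>x. cutoff h n x * f x) \<and> (\<forall>k x. (D k has_real_derivative D (Suc k) x) (at x))"
    by (rule smooth_fun_sequence)
  show "\<exists>c d. - h < c \<and> d < h \<and> (\<forall>x. x \<notin> {c..d} \<longrightarrow> cutoff h n x * f x = 0)"
  proof (rule exI[of _ "1 / real n - h"], rule exI[of _ "h - 1 / real n"], intro conjI allI impI)
    fix x assume "x \<notin> {1 / real n - h..h - 1 / real n}"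
    hence "x < 1 / real n - h \<or> x > h - 1 / real n" by auto
    hence "real n * x < real n * (1 / real n - h) \<or> real n * x > real n * (h - 1 / real n)" using assms by auto
    hence "real n * x + (real n * h - 1) \<le> 0 \<or> (- real n) * x + (real n * h - 1) \<le> 0"
      using assms by (auto simp: algebra_simps)
    thus "cutoff h n x * f x = 0" by (auto simp: cutoff_def expinv_def)
  qed (use assms in auto)
qed

lemma expinv_bounds: "0 \<le> expinv 0 y" "expinv 0 y \<le> 1"
  by (auto simp: expinv_def)

lemma cutoff_bounds: "0 \<le> cutoff h n x" "cutoff h n x \<le> 1"
  unfolding cutoff_def using expinv_bounds by (auto intro!: mult_le_one)

lemma cutoff_tendsto:
  assumes "x \<in> {-h<..<h}"
  shows "(\<lambda>n. cutoff h n x) \<longlonglongrightarrow> 1"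
proof -
  have *: "(\<lambda>n. expinv 0 (real n * c - 1)) \<longlonglongrightarrow> 1" if "c > 0" for c
  proof -
    have "((\<lambda>y :: real. exp (- 1 / y)) \<longlongrightarrow> 1) at_top" by real_asymp
    hence "(expinv 0 \<longlongrightarrow> 1) at_top"
      by (rule Lim_transform_eventually) (use eventually_gt_at_top[of "0 :: real"] in eventually_elim, simp add: expinv_def)
    moreover have "filterlim (\<lambda>n. real n * c - 1) at_top sequentially" using that by real_asymp
    ultimately show ?thesis by (rule filterlim_compose)
  qed
  have "(\<lambda>n. expinv 0 (real n * (x + h) - 1) * expinv 0 (real n * (h - x) - 1)) \<longlonglongrightarrow> 1 * 1"
    using assms by (intro tendsto_mult *) auto
  thus ?thesis by (simp add: cutoff_def algebra_simps)
qed

lemma L2_approx_test: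
  assumes h: "h > 0" and F: "F \<in> sq_int h" and e: "\<epsilon> > 0"
  shows "\<exists>\<psi>. test_fun (- h) h \<psi> \<and> L2_form h (\<lambda>x. F x - \<psi> x) (\<lambda>x. F x - \<psi> x) < \<epsilon>"
proof -
  obtain a n where an: "L2_form h (\<lambda>x. F x - rpoly a n x) (\<lambda>x. F x - rpoly a n x) < \<epsilon> / 4"
    using L2_approx_poly[OF h F, of "\<epsilon> / 4"] e by auto
  let ?q = "rpoly a n"
  have q: "?q \<in> sq_int h" by (intro sq_int_continuous continuous_on_rpoly)
  have t: "test_fun (- h) h (\<lambda>x. cutoff h (Suc k) x * ?q x)" for k
    by (intro test_fun_cutoff smooth_rpoly) auto
  have ts: "(\<lambda>x. cutoff h (Suc k) x * ?q x) \<in> sq_int h" for k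
    by (intro sq_int_continuous test_fun_smooth(2)[OF t])
  have "(\<lambda>k. L2_form h (\<lambda>x. ?q x - cutoff h (Suc k) x * ?q x) (\<lambda>x. ?q x - cutoff h (Suc k) x * ?q x)) \<longlonglongrightarrow> 0"
  proof (rule L2_dominated_convergence[OF q ts])
    show "AE x in mu_on h. (\<lambda>k. cutoff h (Suc k) x * ?q x) \<longlonglongrightarrow> ?q x"
    proof (rule AE_I2)
      fix x assume "x \<in> space (mu_on h)"
      hence "(\<lambda>k. cutoff h (Suc k) x) \<longlonglongrightarrow> 1" using LIMSEQ_Suc[OF cutoff_tendsto[of x h]] by simp
      from tendsto_mult[OF this tendsto_const[of "?q x"]] show "(\<lambda>k. cutoff h (Suc k) x * ?q x) \<longlonglongrightarrow> ?q x" by simp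
    qed
    show "integrable (mu_on h) (\<lambda>x. (?q x)\<^sup>2)" using q by (simp add: sq_int_def)
    show "AE x in mu_on h. (?q x - cutoff h (Suc k) x * ?q x)\<^sup>2 \<le> (?q x)\<^sup>2" for k
    proof (rule AE_I2)
      fix x
      have "?q x - cutoff h (Suc k) x * ?q x = (1 - cutoff h (Suc k) x) * ?q x" by (simp add: algebra_simps)
      moreover have "(1 - cutoff h (Suc k) x)\<^sup>2 \<le> 1"
        using cutoff_bounds[of h "Suc k" x] by (intro power_le_one) auto
      ultimately show "(?q x - cutoff h (Suc k) x * ?q x)\<^sup>2 \<le> (?q x)\<^sup>2"
        using mult_right_mono[of "(1 - cutoff h (Suc k) x)\<^sup>2" 1 "(?q x)\<^sup>2"] by (simp add: power_mult_distrib)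
    qed
  qed
  from order_tendstoD(2)[OF this, of "\<epsilon> / 4"] e
  obtain k where k: "L2_form h (\<lambda>x. ?q x - cutoff h (Suc k) x * ?q x) (\<lambda>x. ?q x - cutoff h (Suc k) x * ?q x) < \<epsilon> / 4"
    using eventually_happens[of _ sequentially] by auto
  have "L2_form h (\<lambda>x. F x - cutoff h (Suc k) x * ?q x) (\<lambda>x. F x - cutoff h (Suc k) x * ?q x) < \<epsilon>"
    using L2_form_triangle[OF F q ts[of k]] k an by linarith
  thus ?thesis using t by blast
qed

lemma test_fun_lc:
  assumes "test_fun a b \<phi>" "test_fun a b \<psi>"
  shows "test_fun a b (\<lambda>x. \<phi> x + c * \<psi> x)"
proof -
  obtain D where D: "D 0 = \<phi>" "\<And>k x. (D k has_real_derivative D (Suc k) x) (at x)"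
    using assms(1) unfolding test_fun_def by metis
  obtain E where E: "E 0 = \<psi>" "\<And>k x. (E k has_real_derivative E (Suc k) x) (at x)"
    using assms(2) unfolding test_fun_def by metis
  obtain p q where pq: "a < p" "q < b" "\<And>x. x \<notin> {p..q} \<Longrightarrow> \<phi> x = 0"
    using assms(1) unfolding test_fun_def by blast
  obtain p' q' where pq': "a < p'" "q' < b" "\<And>x. x \<notin> {p'..q'} \<Longrightarrow> \<psi> x = 0"
    using assms(2) unfolding test_fun_def by blast
  have "((\<lambda>x. D k x + c * E k x) has_real_derivative D (Suc k) x + c * E (Suc k) x) (at x)" for k x
    by (intro DERIV_add DERIV_cmult D E)
  hence 1: "\<exists>F :: nat \<Rightarrow> real \<Rightarrow> real. F 0 = (\<lambda>x. \<phi> x + c * \<psi> x) \<and> (\<forall>k x. (F k has_real_derivative F (Suc k) x) (at x))"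
    by (intro exI[of _ "\<lambda>k x. D k x + c * E k x"]) (auto simp: D(1) E(1))
  have "\<phi> x + c * \<psi> x = 0" if "x \<notin> {min p p'..max q q'}" for x
  proof -
    have "x \<notin> {p..q}" "x \<notin> {p'..q'}" using that by auto
    thus ?thesis using pq(3) pq'(3) by simp
  qed
  moreover have "a < min p p'" "max q q' < b" using pq pq' by auto
  ultimately have "\<exists>u v. a < u \<and> v < b \<and> (\<forall>x. x \<notin> {u..v} \<longrightarrow> \<phi> x + c * \<psi> x = 0)" by blast
  with 1 show ?thesis unfolding test_fun_def by blast
qed

text \<open>Mean zero is what makes the antiderivative vanish beyond both ends of the support of
  \<theta>. The pointwise bound is the Cauchy-Schwarz inequality for |\<theta>| and 1.\<close>

lemma test_fun_antiderivative:
  assumes t: "test_fun (- h) h \<theta>" and h: "h > 0" and z: "(LINT x|mu_on h. \<theta> x) = 0"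
  obtains \<phi> where "test_fun (- h) h \<phi>" "deriv \<phi> = \<theta>"
    "\<And>x. x \<in> {-h<..<h} \<Longrightarrow> \<bar>\<phi> x\<bar> \<le> sqrt (2 * h) * sqrt (L2_form h \<theta> \<theta>)"
proof -
  note \<theta> = test_fun_smooth[OF t]
  obtain D where D: "D 0 = \<theta>" "\<And>k x. (D k has_real_derivative D (Suc k) x) (at x)"
    using t unfolding test_fun_def by metis
  obtain c d where cd: "- h < c" "d < h" "\<And>x. x \<notin> {c..d} \<Longrightarrow> \<theta> x = 0"
    using t unfolding test_fun_def by blast
  obtain \<Phi> where \<Phi>: "\<And>x. (\<Phi> has_vector_derivative \<theta> x) (at x)"
    using einterval_antiderivative[of "-\<infinity>" \<infinity> \<theta>] \<theta>(2) by (auto simp: continuous_on_eq_continuous_at)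
  define \<phi> where "\<phi> x = \<Phi> x - \<Phi> (- h)" for x
  have d: "(\<phi> has_real_derivative \<theta> x) (at x)" for x
    unfolding \<phi>_def[abs_def] using \<Phi>[of x]
    by (auto intro!: derivative_eq_intros simp: has_real_derivative_iff_has_vector_derivative)
  have ftc: "(\<theta> has_integral \<phi> y - \<phi> x) {x..y}" if "x \<le> y" for x y
    by (rule fundamental_theorem_of_calculus[OF that])
      (use d in \<open>auto simp: has_real_derivative_iff_has_vector_derivative intro: has_vector_derivative_at_within\<close>)
  have "\<phi> h - \<phi> (- h) = integral {-h..h} \<theta>" using ftc[of "-h" h] h by (simp add: has_integral_iff)
  also have "\<dots> = 0" using z unfolding integral_mu_on set_integral_continuous[OF \<theta>(2)] .
  finally have ends: "\<phi> h = 0" "\<phi> (- h) = 0" by (auto simp: \<phi>_def)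
  have vanish: "\<phi> y = \<phi> x" if "x \<le> y" "\<And>t. t \<in> {x..y} \<Longrightarrow> \<theta> t = 0" for x y
  proof -
    have "((\<lambda>t. 0) has_integral \<phi> y - \<phi> x) {x..y}"
      by (rule has_integral_eq[OF _ ftc[OF that(1)]]) (use that(2) in auto)
    thus ?thesis by (metis has_integral_0_eq right_minus_eq)
  qed
  show ?thesis
  proof (rule that[of \<phi>])
    show "test_fun (- h) h \<phi>" unfolding test_fun_def
    proof
      show "\<exists>E :: nat \<Rightarrow> real \<Rightarrow> real. E 0 = \<phi> \<and> (\<forall>k x. (E k has_real_derivative E (Suc k) x) (at x))"
      proof (intro exI[of _ "\<lambda>k. case k of 0 \<Rightarrow> \<phi> | Suc k \<Rightarrow> D k"] conjI allI)
        show "((case k of 0 \<Rightarrow> \<phi> | Suc k \<Rightarrow> D k) has_real_derivative (case Suc k of 0 \<Rightarrow> \<phi> | Suc k \<Rightarrow> D k) x) (at x)" for k x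
          using d D by (cases k) auto
      qed auto
      show "\<exists>c d. - h < c \<and> d < h \<and> (\<forall>x. x \<notin> {c..d} \<longrightarrow> \<phi> x = 0)"
      proof (rule exI[of _ c], rule exI[of _ d], intro conjI allI impI)
      fix x assume x: "x \<notin> {c..d}"
      show "\<phi> x = 0"
      proof (cases "x < c")
        case True
        show ?thesis
        proof (cases "x \<le> - h")
          case True
          thus ?thesis using vanish[of x "- h"] cd ends by auto
        next
          case False
          thus ?thesis using vanish[of "- h" x] cd ends \<open>x < c\<close> by auto
        qed
      next
        case False
        hence "x > d" using x by auto
        show ?thesis
        proof (cases "x \<le> h")
          case True
          thus ?thesis using vanish[of x h] cd ends \<open>x > d\<close> by auto
        next
          case False
          thus ?thesis using vanish[of h x] cd ends by auto
        qed
      qed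
      qed (use cd in auto)
    qed
    show "deriv \<phi> = \<theta>" using d by (auto intro!: DERIV_imp_deriv)
    fix x assume x: "x \<in> {-h<..<h}"
    have ca: "continuous_on UNIV (\<lambda>x. \<bar>\<theta> x\<bar>)" by (intro continuous_intros \<theta>)
    have ai: "(\<lambda>x. \<bar>\<theta> x\<bar>) integrable_on {u..v}" for u v
      by (intro integrable_continuous_interval continuous_on_subset[OF ca]) auto
    have "\<bar>\<phi> x\<bar> = \<bar>integral {-h..x} \<theta>\<bar>" using ftc[of "-h" x] x ends by (simp add: has_integral_iff)
    also have "\<dots> \<le> integral {-h..x} (\<lambda>x. \<bar>\<theta> x\<bar>)"
      using integral_norm_bound_integral[of \<theta> "{-h..x}" "\<lambda>x. \<bar>\<theta> x\<bar>"] ai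
        integrable_continuous_interval[OF continuous_on_subset[OF \<theta>(2)]] by auto
    also have "\<dots> \<le> integral {-h..h} (\<lambda>x. \<bar>\<theta> x\<bar>)"
      using x ai by (intro integral_subset_le) auto
    also have "\<dots> = L2_form h (\<lambda>x. \<bar>\<theta> x\<bar>) (\<lambda>x. 1)"
      unfolding L2_form_def integral_mu_on by (subst set_integral_continuous) (use ca in auto)
    also have "\<dots> \<le> \<bar>L2_form h (\<lambda>x. \<bar>\<theta> x\<bar>) (\<lambda>x. 1)\<bar>" by simp
    also have "\<dots> \<le> sqrt (L2_form h (\<lambda>x. \<bar>\<theta> x\<bar>) (\<lambda>x. \<bar>\<theta> x\<bar>)) * sqrt (L2_form h (\<lambda>x. 1) (\<lambda>x. 1))"
      by (intro L2.Cauchy_Schwarz sq_int_continuous ca continuous_intros)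
    also have "L2_form h (\<lambda>x. \<bar>\<theta> x\<bar>) (\<lambda>x. \<bar>\<theta> x\<bar>) = L2_form h \<theta> \<theta>" by (simp add: L2_form_def)
    also have "L2_form h (\<lambda>x. 1) (\<lambda>x. 1) = 2 * h" unfolding L2_form_def mult_1_right measure_mu_on[OF h] by simp
    finally show "\<bar>\<phi> x\<bar> \<le> sqrt (2 * h) * sqrt (L2_form h \<theta> \<theta>)" by (simp add: mult.commute)
  qed
qed

section \<open>Density of polynomials in the Sobolev space\<close>

definition weak_real :: "real \<Rightarrow> (real \<Rightarrow> real) \<Rightarrow> (real \<Rightarrow> real) \<Rightarrow> bool" where
  "weak_real h w k \<longleftrightarrow> (\<forall>\<phi>. test_fun (- h) h \<phi> \<longrightarrow> L2_form h (deriv \<phi>) w = - L2_form h \<phi> k)"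

lemma test_fun_sq_int:
  assumes "test_fun (- h) h \<phi>" shows "\<phi> \<in> sq_int h" "deriv \<phi> \<in> sq_int h"
  using test_fun_smooth[OF assms] by (auto intro: sq_int_continuous)

lemma sq_int_const: "(\<lambda>x. c) \<in> sq_int h"
  by (intro sq_int_continuous continuous_intros)

lemma L2_form_const: "L2_form h F (\<lambda>x. c) = c * (LINT x|mu_on h. F x)"
  by (simp add: L2_form_def)

lemma L2_form_one: "h > 0 \<Longrightarrow> L2_form h (\<lambda>x. 1) (\<lambda>x. 1) = 2 * h"
  unfolding L2_form_def mult_1_right by (simp only: measure_mu_on)

text \<open>A test function of mean zero is orthogonal to 1, so its squared distance to 1 is at
  least 2h; one that is closer has nonzero mean and can be rescaled.\<close>

lemma normalized_test_fun:
  assumes h: "h > 0"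
  obtains \<psi> where "test_fun (- h) h \<psi>" "L2_form h \<psi> (\<lambda>x. 1) = 1"
proof -
  obtain \<psi> where \<psi>: "test_fun (- h) h \<psi>" "L2_form h (\<lambda>x. 1 - \<psi> x) (\<lambda>x. 1 - \<psi> x) < 2 * h"
    using L2_approx_test[OF h sq_int_const, of "2 * h" 1] h by auto
  note s = test_fun_sq_int(1)[OF \<psi>(1)]
  define I where "I = L2_form h \<psi> (\<lambda>x. 1)"
  have "I \<noteq> 0"
  proof
    assume "I = 0"
    hence "L2_form h (\<lambda>x. 1 - \<psi> x) (\<lambda>x. 1 - \<psi> x) = 2 * h + L2_form h \<psi> \<psi>"
      using L2.expand[OF sq_int_const[of 1 h] s, of "- 1"] L2.sym[OF s sq_int_const[of 1 h]] L2_form_one[OF h]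
      by (simp add: I_def)
    thus False using \<psi>(2) L2.pos[OF s] by simp
  qed
  \<comment> \<open>This is \<psi>/I, written in the form provided by
    \<open>test_fun_lc\<close>.\<close>
  have "test_fun (- h) h (\<lambda>x. \<psi> x + (1 / I - 1) * \<psi> x)" by (rule test_fun_lc[OF \<psi>(1) \<psi>(1)])
  moreover have "L2_form h (\<lambda>x. \<psi> x + (1 / I - 1) * \<psi> x) (\<lambda>x. 1) = 1"
    using L2.lin[OF s s sq_int_const[of 1 h], of "1 / I - 1"] \<open>I \<noteq> 0\<close> by (simp add: I_def[symmetric] field_simps)
  ultimately show ?thesis by (rule that)
qed

text \<open>Proved by duality, without an absolutely continuous representative: subtracting J
  \<psi>0 gives a test function mean zero, so it is the derivative of a test function \<phi>, and
  the weak identity transfers the pairing to k. By density of test functions, w - c itself can be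
  inserted for \<psi>.\<close>

lemma weak_Poincare:
  assumes h: "h > 0"
  obtains C where "C \<ge> 0"
    "\<And>w k. w \<in> sq_int h \<Longrightarrow> k \<in> sq_int h \<Longrightarrow> weak_real h w k \<Longrightarrow>
       \<exists>c. L2_form h (\<lambda>x. w x - c) (\<lambda>x. w x - c) \<le> C * L2_form h k k"
proof -
  obtain \<psi>0 where \<psi>0: "test_fun (- h) h \<psi>0" "L2_form h \<psi>0 (\<lambda>x. 1) = 1"
    using normalized_test_fun[OF h] by blast
  note s0 = test_fun_sq_int(1)[OF \<psi>0(1)]
  define N0 where "N0 = L2_form h \<psi>0 \<psi>0"
  have N0: "N0 \<ge> 0" unfolding N0_def by (rule L2.pos[OF s0])
  \<comment> \<open>In squared L^2 norms, (2h)^2 bounds \<phi> by \<theta>, and 2 + 2(2h) N0 bounds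
    \<theta> by \<psi>, using that J^2 is at most 2h times the squared norm of \<psi>.\<close>
  define C where "C = (2 * h)\<^sup>2 * (2 + 2 * (2 * h) * N0)"
  have one: "(\<lambda>x. 1) \<in> sq_int h" by (rule sq_int_const)
  show ?thesis
  proof (rule that[of C])
    show "C \<ge> 0" unfolding C_def using N0 h by auto
    fix w k assume w: "w \<in> sq_int h" and k: "k \<in> sq_int h" and wk: "weak_real h w k"
    \<comment> \<open>The average of w weighted by \<psi>0, chosen so that pairing \<psi> with w - c
      equals pairing \<theta> = \<psi> - J \<psi>0 with w.\<close>
    define c where "c = L2_form h \<psi>0 w"
    define v where "v x = w x - c" for x
    have v: "v \<in> sq_int h" unfolding v_def[abs_def] by (intro sq_int_diff w sq_int_const)
    have key: "(L2_form h \<psi> v)\<^sup>2 \<le> C * L2_form h \<psi> \<psi> * L2_form h k k" if \<psi>: "test_fun (- h) h \<psi>" for \<psi>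
    proof -
      note s = test_fun_sq_int(1)[OF \<psi>]
      define J where "J = L2_form h \<psi> (\<lambda>x. 1)"
      define \<theta> where "\<theta> x = \<psi> x + (- J) * \<psi>0 x" for x
      have t\<theta>: "test_fun (- h) h \<theta>" unfolding \<theta>_def[abs_def] by (rule test_fun_lc[OF \<psi> \<psi>0(1)])
      have th: "L2_form h \<theta> g = L2_form h \<psi> g - J * L2_form h \<psi>0 g" if "g \<in> sq_int h" for g
        using L2.lin[OF s s0 that, of "- J"] by (simp add: \<theta>_def[abs_def])
      have "(LINT x|mu_on h. \<theta> x) = 0"
        using th[OF one] \<psi>0(2) by (simp add: J_def L2_form_const)
      then obtain \<phi> where \<phi>: "test_fun (- h) h \<phi>" "deriv \<phi> = \<theta>"
        "\<And>x. x \<in> {-h<..<h} \<Longrightarrow> \<bar>\<phi> x\<bar> \<le> sqrt (2 * h) * sqrt (L2_form h \<theta> \<theta>)"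
        using test_fun_antiderivative[OF t\<theta> h] by blast
      note s\<phi> = test_fun_sq_int(1)[OF \<phi>(1)] and s\<theta> = test_fun_sq_int(1)[OF t\<theta>]
      have "L2_form h \<psi> v = L2_form h \<psi> w - c * J"
        using L2.lin[OF w one s, of "- c"] L2.sym[OF v s] L2.sym[OF w s] L2.sym[OF one s]
        by (simp add: v_def[abs_def] J_def)
      also have "\<dots> = L2_form h \<theta> w" unfolding th[OF w] by (simp add: c_def)
      also have "\<dots> = - L2_form h \<phi> k" using wk \<phi>(1) unfolding weak_real_def \<phi>(2)[symmetric] by blast
      finally have "\<bar>L2_form h \<psi> v\<bar> = \<bar>L2_form h \<phi> k\<bar>" by simp
      also have "\<dots> \<le> sqrt (L2_form h \<phi> \<phi>) * sqrt (L2_form h k k)" by (rule L2.Cauchy_Schwarz[OF s\<phi> k])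
      finally have "(L2_form h \<psi> v)\<^sup>2 \<le> (sqrt (L2_form h \<phi> \<phi>) * sqrt (L2_form h k k))\<^sup>2"
        using power_mono[of "\<bar>L2_form h \<psi> v\<bar>" _ 2] by simp
      also have "\<dots> = L2_form h \<phi> \<phi> * L2_form h k k"
        using L2.pos[OF s\<phi>] L2.pos[OF k] by (simp add: power_mult_distrib)
      also have "L2_form h \<phi> \<phi> \<le> C * L2_form h \<psi> \<psi>"
      proof -
        have "L2_form h \<phi> \<phi> \<le> 2 * h * (sqrt (2 * h) * sqrt (L2_form h \<theta> \<theta>))\<^sup>2"
          by (rule L2_form_le_sup[OF h s\<phi> \<phi>(3)])
        also have "\<dots> = (2 * h)\<^sup>2 * L2_form h \<theta> \<theta>"
          using h L2.pos[OF s\<theta>] by (simp add: power_mult_distrib power2_eq_square[of h])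
        also have "L2_form h \<theta> \<theta> \<le> 2 * L2_form h \<psi> \<psi> + 2 * (J\<^sup>2 * N0)"
        proof -
          have z: "(\<lambda>x. 0) \<in> sq_int h" by (rule sq_int_const)
          have s0': "(\<lambda>x. 0 + (- J) *\<^sub>R \<psi>0 x) \<in> sq_int h" by (rule sq_int_lc[OF z s0])
          have "L2_form h (\<lambda>x. 0 + (- J) *\<^sub>R \<psi>0 x) (\<lambda>x. 0 + (- J) *\<^sub>R \<psi>0 x) = J\<^sup>2 * N0"
            using L2.expand[OF z s0, of "- J"] by (simp add: N0_def L2_form_def)
          thus ?thesis using L2_form_sum_le[OF s s0'] by (simp add: \<theta>_def[abs_def])
        qed
        also have "J\<^sup>2 \<le> 2 * h * L2_form h \<psi> \<psi>"
        proof -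
          have "\<bar>J\<bar> \<le> sqrt (L2_form h \<psi> \<psi>) * sqrt (2 * h)"
            using L2.Cauchy_Schwarz[OF s one] L2_form_one[OF h] by (simp add: J_def)
          hence "\<bar>J\<bar>\<^sup>2 \<le> (sqrt (L2_form h \<psi> \<psi>) * sqrt (2 * h))\<^sup>2" by (intro power_mono) auto
          thus ?thesis using L2.pos[OF s] h by (simp add: power_mult_distrib mult_ac)
        qed
        also have "(2 * h)\<^sup>2 * (2 * L2_form h \<psi> \<psi> + 2 * (2 * h * L2_form h \<psi> \<psi> * N0)) = C * L2_form h \<psi> \<psi>"
          by (simp add: C_def algebra_simps)
        finally show ?thesis using h N0 by (simp add: mult_left_mono mult_right_mono)
      qed
      finally show ?thesis using L2.pos[OF k] by (simp add: mult_right_mono)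
    qed
    have "\<exists>\<psi>. test_fun (- h) h \<psi> \<and> L2_form h (\<lambda>x. v x - \<psi> x) (\<lambda>x. v x - \<psi> x) < 1 / real (Suc n)" for n
      by (rule L2_approx_test[OF h v]) auto
    then obtain \<Psi> where \<Psi>: "\<And>n. test_fun (- h) h (\<Psi> n)"
      "\<And>n. L2_form h (\<lambda>x. v x - \<Psi> n x) (\<lambda>x. v x - \<Psi> n x) < 1 / real (Suc n)" by metis
    note s\<Psi> = test_fun_sq_int(1)[OF \<Psi>(1)]
    define \<eta> where "\<eta> n = L2_form h (\<lambda>x. v x - \<Psi> n x) (\<lambda>x. v x - \<Psi> n x)" for n
    have \<eta>: "\<eta> \<longlonglongrightarrow> 0"
    proof (rule tendsto_sandwich[OF _ _ tendsto_const LIMSEQ_inverse_real_of_nat])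
      show "\<forall>\<^sub>F n in sequentially. 0 \<le> \<eta> n" "\<forall>\<^sub>F n in sequentially. \<eta> n \<le> inverse (real (Suc n))"
        using L2.pos[OF sq_int_diff[OF v s\<Psi>]] \<Psi>(2)
        by (auto simp: \<eta>_def inverse_eq_divide intro!: always_eventually less_imp_le)
    qed
    have ds: "L2_form h (\<lambda>x. v x - \<Psi> n x) g = L2_form h v g - L2_form h (\<Psi> n) g" if "g \<in> sq_int h" for g n
      using L2.lin[OF v s\<Psi> that, of "- 1"] by simp
    have lim1: "(\<lambda>n. L2_form h (\<Psi> n) v) \<longlonglongrightarrow> L2_form h v v"
    proof -
      have "(\<lambda>n. L2_form h (\<lambda>x. v x - \<Psi> n x) v) \<longlonglongrightarrow> 0"
      proof (rule Lim_null_comparison)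
        show "\<forall>\<^sub>F n in sequentially. norm (L2_form h (\<lambda>x. v x - \<Psi> n x) v) \<le> sqrt (\<eta> n) * sqrt (L2_form h v v)"
          using L2.Cauchy_Schwarz[OF sq_int_diff[OF v s\<Psi>] v] by (auto simp: \<eta>_def)
        show "(\<lambda>n. sqrt (\<eta> n) * sqrt (L2_form h v v)) \<longlonglongrightarrow> 0"
          using tendsto_mult[OF tendsto_real_sqrt[OF \<eta>] tendsto_const[of "sqrt (L2_form h v v)"]] by simp
      qed
      from tendsto_diff[OF tendsto_const[of "L2_form h v v"] this] show ?thesis by (simp add: ds[OF v])
    qed
    have lim2: "(\<lambda>n. L2_form h (\<Psi> n) (\<Psi> n)) \<longlonglongrightarrow> L2_form h v v"
    proof -
      have "L2_form h (\<Psi> n) (\<Psi> n) = \<eta> n + 2 * L2_form h (\<Psi> n) v - L2_form h v v" for n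
        unfolding \<eta>_def using ds[OF sq_int_diff[OF v s\<Psi>], of n n] ds[OF v, of n] ds[OF s\<Psi>, of n n]
          L2.sym[OF v sq_int_diff[OF v s\<Psi>], of n] L2.sym[OF s\<Psi> sq_int_diff[OF v s\<Psi>], of n n] L2.sym[OF v s\<Psi>, of n]
        by simp
      moreover have "(\<lambda>n. \<eta> n + 2 * L2_form h (\<Psi> n) v - L2_form h v v) \<longlonglongrightarrow> 0 + 2 * L2_form h v v - L2_form h v v"
        by (intro tendsto_intros \<eta> lim1)
      ultimately show ?thesis by simp
    qed
    have "(L2_form h v v)\<^sup>2 \<le> C * L2_form h v v * L2_form h k k"
    proof (rule LIMSEQ_le)
      show "(\<lambda>n. (L2_form h (\<Psi> n) v)\<^sup>2) \<longlonglongrightarrow> (L2_form h v v)\<^sup>2" by (intro tendsto_intros lim1)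
      show "(\<lambda>n. C * L2_form h (\<Psi> n) (\<Psi> n) * L2_form h k k) \<longlonglongrightarrow> C * L2_form h v v * L2_form h k k"
        by (intro tendsto_intros lim2)
    qed (use key[OF \<Psi>(1)] in auto)
    hence "L2_form h v v * L2_form h v v \<le> L2_form h v v * (C * L2_form h k k)"
      by (simp add: power2_eq_square mult_ac)
    hence "L2_form h v v \<le> C * L2_form h k k"
    proof (cases "L2_form h v v = 0")
      case True
      thus ?thesis using \<open>C \<ge> 0\<close> L2.pos[OF k] by simp
    next
      case False
      hence "L2_form h v v > 0" using L2.pos[OF v] by simp
      thus ?thesis using \<open>L2_form h v v * L2_form h v v \<le> _\<close> by (simp only: mult_le_cancel_left_pos)
    qed
    thus "\<exists>c. L2_form h (\<lambda>x. w x - c) (\<lambda>x. w x - c) \<le> C * L2_form h k k"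
      unfolding v_def[abs_def] by blast
  qed
qed

lemma weak_real_C1:
  assumes "h > 0" "\<And>x. (P has_real_derivative p x) (at x)" "continuous_on UNIV p"
  shows "weak_real h P p"
  unfolding weak_real_def
proof (intro allI impI)
  fix \<phi> assume t: "test_fun (- h) h \<phi>"
  note \<phi> = test_fun_smooth[OF t]
  have cP: "continuous_on UNIV P" using assms(2) by (meson DERIV_continuous continuous_at_imp_continuous_on)
  have c: "continuous_on UNIV (\<lambda>x. deriv \<phi> x * P x)" "continuous_on UNIV (\<lambda>x. \<phi> x * p x)"
    by (intro continuous_intros \<phi> cP assms)+
  have "((\<lambda>x. deriv \<phi> x * P x + p x * \<phi> x) has_integral (\<phi> h * P h - \<phi> (- h) * P (- h))) {-h..h}"
  proof (rule fundamental_theorem_of_calculus)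
    fix x
    have "((\<lambda>x. \<phi> x * P x) has_real_derivative deriv \<phi> x * P x + p x * \<phi> x) (at x)"
      by (rule DERIV_mult[OF \<phi>(1) assms(2)])
    thus "((\<lambda>x. \<phi> x * P x) has_vector_derivative deriv \<phi> x * P x + p x * \<phi> x) (at x within {-h..h})"
      by (simp add: has_real_derivative_iff_has_vector_derivative has_vector_derivative_at_within)
  qed (use assms in auto)
  hence "integral {-h..h} (\<lambda>x. deriv \<phi> x * P x + \<phi> x * p x) = 0"
    using \<phi>(4,5) assms(1) by (simp add: has_integral_iff mult.commute)
  moreover have "integral {-h..h} (\<lambda>x. deriv \<phi> x * P x + \<phi> x * p x)
      = integral {-h..h} (\<lambda>x. deriv \<phi> x * P x) + integral {-h..h} (\<lambda>x. \<phi> x * p x)"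
    by (rule integral_add) (use c in \<open>auto intro!: integrable_continuous_interval intro: continuous_on_subset\<close>)
  ultimately show "L2_form h (deriv \<phi>) P = - L2_form h \<phi> p"
    unfolding L2_form_def integral_mu_on set_integral_continuous[OF c(1)] set_integral_continuous[OF c(2)] by simp
qed

lemma rpoly_antiderivative:
  obtains b where "\<And>x. (rpoly b (Suc n) has_real_derivative rpoly a n x) (at x)" "b 0 = c"
proof -
  define b where "b i = (if i = 0 then c else a (i - 1) / real i)" for i
  have "rpoly b (Suc n) x = c + (\<Sum>i\<le>n. a i / real (Suc i) * x ^ Suc i)" for x
    unfolding rpoly_def by (subst sum.atMost_Suc_shift) (simp add: b_def)
  hence eq: "rpoly b (Suc n) = (\<lambda>x. c + (\<Sum>i\<le>n. a i / real (Suc i) * x ^ Suc i))" by (rule ext)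
  have "((\<lambda>x. c + (\<Sum>i\<le>n. a i / real (Suc i) * x ^ Suc i)) has_real_derivative rpoly a n x) (at x)" for x
    unfolding rpoly_def by (auto intro!: derivative_eq_intros sum.cong simp del: of_nat_Suc power_Suc)
  hence "(rpoly b (Suc n) has_real_derivative rpoly a n x) (at x)" for x
    unfolding eq .
  thus ?thesis using that[of b] by (simp add: b_def)
qed

text \<open>Approximating the weak derivative by a polynomial suffices: by the Poincare inequality a
  polynomial antiderivative differs from F by nearly a constant, and this constant becomes the
  coefficient of degree 0.\<close>

lemma scalar_H1_approx:
  assumes h: "h > 0" and F: "F \<in> sq_int h" and G: "G \<in> sq_int h" and FG: "weak_real h F G" and e: "\<epsilon> > 0"
  shows "\<exists>b a n. (\<forall>x. (rpoly b (Suc n) has_real_derivative rpoly a n x) (at x)) \<and>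
     L2_form h (\<lambda>x. F x - rpoly b (Suc n) x) (\<lambda>x. F x - rpoly b (Suc n) x) < \<epsilon> \<and>
     L2_form h (\<lambda>x. G x - rpoly a n x) (\<lambda>x. G x - rpoly a n x) < \<epsilon>"
proof -
  obtain C where C: "C \<ge> 0"
    "\<And>w k. w \<in> sq_int h \<Longrightarrow> k \<in> sq_int h \<Longrightarrow> weak_real h w k \<Longrightarrow>
       \<exists>c. L2_form h (\<lambda>x. w x - c) (\<lambda>x. w x - c) \<le> C * L2_form h k k"
    using weak_Poincare[OF h] by blast
  define \<delta> where "\<delta> = \<epsilon> / (C + 1)"
  have \<delta>: "\<delta> > 0" "\<delta> \<le> \<epsilon>" "C * \<delta> < \<epsilon>" using e C by (auto simp: \<delta>_def field_simps)
  obtain a n where an: "L2_form h (\<lambda>x. G x - rpoly a n x) (\<lambda>x. G x - rpoly a n x) < \<delta>"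
    using L2_approx_poly[OF h G \<delta>(1)] by blast
  obtain b0 where b0: "\<And>x. (rpoly b0 (Suc n) has_real_derivative rpoly a n x) (at x)" "b0 0 = 0"
    using rpoly_antiderivative[of n a 0] by blast
  have s: "rpoly b m \<in> sq_int h" for b m by (intro sq_int_continuous continuous_on_rpoly)
  have wP: "weak_real h (rpoly b0 (Suc n)) (rpoly a n)" by (rule weak_real_C1[OF h b0(1) continuous_on_rpoly])
  have "weak_real h (\<lambda>x. F x - rpoly b0 (Suc n) x) (\<lambda>x. G x - rpoly a n x)"
    unfolding weak_real_def
  proof (intro allI impI)
    fix \<phi> assume t: "test_fun (- h) h \<phi>"
    note st = test_fun_sq_int[OF t]
    have "L2_form h (deriv \<phi>) (\<lambda>x. F x - rpoly b0 (Suc n) x) = L2_form h (deriv \<phi>) F - L2_form h (deriv \<phi>) (rpoly b0 (Suc n))"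
      using L2.lin[OF F s st(2), of "- 1"] L2.sym[OF sq_int_diff[OF F s] st(2)] L2.sym[OF F st(2)] L2.sym[OF s st(2)] by simp
    moreover have "L2_form h \<phi> (\<lambda>x. G x - rpoly a n x) = L2_form h \<phi> G - L2_form h \<phi> (rpoly a n)"
      using L2.lin[OF G s st(1), of "- 1"] L2.sym[OF sq_int_diff[OF G s] st(1)] L2.sym[OF G st(1)] L2.sym[OF s st(1)] by simp
    ultimately show "L2_form h (deriv \<phi>) (\<lambda>x. F x - rpoly b0 (Suc n) x) = - L2_form h \<phi> (\<lambda>x. G x - rpoly a n x)"
      using FG wP t unfolding weak_real_def by simp
  qed
  from C(2)[OF sq_int_diff[OF F s] sq_int_diff[OF G s] this] obtain c where
    c: "L2_form h (\<lambda>x. F x - rpoly b0 (Suc n) x - c) (\<lambda>x. F x - rpoly b0 (Suc n) x - c)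
      \<le> C * L2_form h (\<lambda>x. G x - rpoly a n x) (\<lambda>x. G x - rpoly a n x)" by blast
  define b where "b = b0(0 := c)"
  have bc: "rpoly b (Suc n) x = rpoly b0 (Suc n) x + c" for x
    unfolding rpoly_def by (subst (1 2) sum.atMost_Suc_shift) (simp add: b_def b0(2))
  have "(rpoly b (Suc n) has_real_derivative rpoly a n x) (at x)" for x
  proof -
    have "((\<lambda>x. rpoly b0 (Suc n) x + c) has_real_derivative rpoly a n x + 0) (at x)"
      by (intro DERIV_add b0 DERIV_const)
    thus ?thesis by (simp flip: bc)
  qed
  moreover have "L2_form h (\<lambda>x. F x - rpoly b (Suc n) x) (\<lambda>x. F x - rpoly b (Suc n) x) < \<epsilon>"
  proof -
    have "C * L2_form h (\<lambda>x. G x - rpoly a n x) (\<lambda>x. G x - rpoly a n x) \<le> C * \<delta>"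
      using C an by (intro mult_left_mono) auto
    thus ?thesis using c \<delta>(3) by (simp add: bc diff_diff_eq)
  qed
  ultimately show ?thesis using an \<delta>(2) by (intro exI[of _ b] exI[of _ a] exI[of _ n]) auto
qed

section \<open>From scalar to vector-valued functions\<close>

lemma L2_on_mu: "L2_on (- h) h f \<longleftrightarrow> f \<in> borel_measurable (mu_on h) \<and> integrable (mu_on h) (\<lambda>x. (norm (f x))\<^sup>2)"
  unfolding L2_on_def measurable_mu_on integrable_mu_on ..

lemma L2_normsq_mu: "L2_normsq (- h) h f = (LINT x|mu_on h. (norm (f x))\<^sup>2)"
  unfolding L2_normsq_def integral_mu_on ..

lemma norm_add_sq_le: "(norm (u + v))\<^sup>2 \<le> 2 * (norm u)\<^sup>2 + 2 * (norm v)\<^sup>2" for u v :: "'a :: real_inner"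
proof -
  have "0 \<le> (norm (u - v))\<^sup>2" by simp
  thus ?thesis by (simp add: power2_norm_eq_inner inner_add inner_diff inner_commute)
qed

lemma L2_on_add:
  assumes "L2_on (- h) h u" "L2_on (- h) h v"
  shows "L2_on (- h) h (\<lambda>x. u x + v x)"
    "L2_normsq (- h) h (\<lambda>x. u x + v x) \<le> 2 * L2_normsq (- h) h u + 2 * L2_normsq (- h) h v"
proof -
  have [measurable]: "u \<in> borel_measurable (mu_on h)" "v \<in> borel_measurable (mu_on h)"
    and i: "integrable (mu_on h) (\<lambda>x. (norm (u x))\<^sup>2)" "integrable (mu_on h) (\<lambda>x. (norm (v x))\<^sup>2)"
    using assms unfolding L2_on_mu by auto
  have i2: "integrable (mu_on h) (\<lambda>x. 2 * (norm (u x))\<^sup>2 + 2 * (norm (v x))\<^sup>2)" using i by auto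
  have i3: "integrable (mu_on h) (\<lambda>x. (norm (u x + v x))\<^sup>2)"
    by (rule Bochner_Integration.integrable_bound[OF i2]) (use norm_add_sq_le in auto)
  show "L2_on (- h) h (\<lambda>x. u x + v x)" unfolding L2_on_mu using i3 by simp
  have "L2_normsq (- h) h (\<lambda>x. u x + v x) \<le> (LINT x|mu_on h. 2 * (norm (u x))\<^sup>2 + 2 * (norm (v x))\<^sup>2)"
    unfolding L2_normsq_mu by (rule integral_mono[OF i3 i2]) (rule norm_add_sq_le)
  also have "\<dots> = 2 * L2_normsq (- h) h u + 2 * L2_normsq (- h) h v"
    unfolding L2_normsq_mu using i by simp
  finally show "L2_normsq (- h) h (\<lambda>x. u x + v x) \<le> 2 * L2_normsq (- h) h u + 2 * L2_normsq (- h) h v" .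
qed

lemma L2_on_diff:
  assumes "L2_on (- h) h u" "L2_on (- h) h v"
  shows "L2_on (- h) h (\<lambda>x. u x - v x)"
proof -
  have "L2_on (- h) h (\<lambda>x. - v x)" using assms(2) unfolding L2_on_mu by auto
  from L2_on_add(1)[OF assms(1) this] show ?thesis by simp
qed

lemma integrable_scaleR_L2:
  assumes f: "L2_on (- h) h f" and \<phi>: "continuous_on UNIV \<phi>"
  shows "integrable (mu_on h) (\<lambda>x. \<phi> x *\<^sub>R f x)"
proof (rule Bochner_Integration.integrable_bound)
  have [measurable]: "f \<in> borel_measurable (mu_on h)" using f unfolding L2_on_mu by auto
  have [measurable]: "\<phi> \<in> borel_measurable (mu_on h)" using sq_int_continuous[OF \<phi>] by (auto simp: sq_int_def)
  show "integrable (mu_on h) (\<lambda>x. (\<phi> x)\<^sup>2 + (norm (f x))\<^sup>2)"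
    using f sq_int_continuous[OF \<phi>, of h] unfolding L2_on_mu sq_int_def by auto
  show "(\<lambda>x. \<phi> x *\<^sub>R f x) \<in> borel_measurable (mu_on h)" by measurable
  have "u * v \<le> u\<^sup>2 + v\<^sup>2" if "u \<ge> 0" "v \<ge> 0" for u v :: real
    using sum_squares_bound[of u v] mult_nonneg_nonneg[OF that] by linarith
  from this[OF abs_ge_zero norm_ge_zero]
  show "AE x in mu_on h. norm (\<phi> x *\<^sub>R f x) \<le> norm ((\<phi> x)\<^sup>2 + (norm (f x))\<^sup>2)" by auto
qed

lemma weak_deriv_on_mu: "weak_deriv_on (- h) h f g \<longleftrightarrow>
    (\<forall>\<phi>. test_fun (- h) h \<phi> \<longrightarrow> (LINT x|mu_on h. deriv \<phi> x *\<^sub>R f x) = - (LINT x|mu_on h. \<phi> x *\<^sub>R g x))"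
  unfolding weak_deriv_on_def integral_mu_on ..

lemma weak_deriv_on_diff:
  assumes "L2_on (- h) h f" "L2_on (- h) h g" "L2_on (- h) h u" "L2_on (- h) h u1"
    and "weak_deriv_on (- h) h f g" "weak_deriv_on (- h) h u u1"
  shows "weak_deriv_on (- h) h (\<lambda>x. f x - u x) (\<lambda>x. g x - u1 x)"
  unfolding weak_deriv_on_mu
proof (intro allI impI)
  fix \<phi> assume t: "test_fun (- h) h \<phi>"
  note \<phi> = test_fun_smooth(2,3)[OF t]
  show "(LINT x|mu_on h. deriv \<phi> x *\<^sub>R (f x - u x)) = - (LINT x|mu_on h. \<phi> x *\<^sub>R (g x - u1 x))"
    using assms(5,6) t unfolding weak_deriv_on_mu scaleR_diff_right
    by (simp add: integrable_scaleR_L2 assms \<phi>)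
qed

lemma component_sq_int:
  assumes f: "L2_on (- h) h f" and b: "b \<in> Basis"
  shows "(\<lambda>x. f x \<bullet> b) \<in> sq_int h"
proof -
  have [measurable]: "f \<in> borel_measurable (mu_on h)" using f unfolding L2_on_mu by auto
  have m: "(\<lambda>x. f x \<bullet> b) \<in> borel_measurable (mu_on h)" by measurable
  have "integrable (mu_on h) (\<lambda>x. (f x \<bullet> b)\<^sup>2)"
  proof (rule Bochner_Integration.integrable_bound)
    show "integrable (mu_on h) (\<lambda>x. (norm (f x))\<^sup>2)" using f unfolding L2_on_mu by auto
    show "AE x in mu_on h. norm ((f x \<bullet> b)\<^sup>2) \<le> norm ((norm (f x))\<^sup>2)"
      using power_mono[OF Basis_le_norm[OF b] abs_ge_zero, of _ 2] by auto
  qed measurable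
  thus ?thesis using m by (simp add: sq_int_def)
qed

lemma component_weak_real:
  assumes "L2_on (- h) h f" "L2_on (- h) h g" "weak_deriv_on (- h) h f g"
  shows "weak_real h (\<lambda>x. f x \<bullet> b) (\<lambda>x. g x \<bullet> b)"
  unfolding weak_real_def
proof (intro allI impI)
  fix \<phi> assume t: "test_fun (- h) h \<phi>"
  note \<phi> = test_fun_smooth(2,3)[OF t]
  have "(LINT x|mu_on h. deriv \<phi> x *\<^sub>R f x) \<bullet> b = - ((LINT x|mu_on h. \<phi> x *\<^sub>R g x) \<bullet> b)"
    using assms(3) t unfolding weak_deriv_on_mu by simp
  moreover have "(LINT x|mu_on h. deriv \<phi> x *\<^sub>R f x) \<bullet> b = L2_form h (deriv \<phi>) (\<lambda>x. f x \<bullet> b)"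
    unfolding L2_form_def by (subst integral_inner_left[symmetric]) (use integrable_scaleR_L2[OF assms(1) \<phi>(2)] in auto)
  moreover have "(LINT x|mu_on h. \<phi> x *\<^sub>R g x) \<bullet> b = L2_form h \<phi> (\<lambda>x. g x \<bullet> b)"
    unfolding L2_form_def by (subst integral_inner_left[symmetric]) (use integrable_scaleR_L2[OF assms(2) \<phi>(1)] in auto)
  ultimately show "L2_form h (deriv \<phi>) (\<lambda>x. f x \<bullet> b) = - L2_form h \<phi> (\<lambda>x. g x \<bullet> b)" by simp
qed

lemma L2_normsq_components:
  assumes "L2_on (- h) h f"
  shows "L2_normsq (- h) h f = (\<Sum>b\<in>Basis. L2_form h (\<lambda>x. f x \<bullet> b) (\<lambda>x. f x \<bullet> b))"
proof -
  have "(norm (f x))\<^sup>2 = (\<Sum>b\<in>Basis. (f x \<bullet> b) * (f x \<bullet> b))" for x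
    by (simp add: power2_norm_eq_inner euclidean_inner[of "f x" "f x"])
  thus ?thesis unfolding L2_normsq_mu L2_form_def
    using integrable_mult_sq_int[OF component_sq_int[OF assms] component_sq_int[OF assms]]
    by (simp add: Bochner_Integration.integral_sum)
qed

lemma entire_coeffs_finite:
  assumes "\<And>n. n > m \<Longrightarrow> c n = 0"
  shows "entire_coeffs c"
  unfolding entire_coeffs_def
proof (rule exI[of _ "\<Sum>i\<le>m. norm (c i) * fact i"], rule exI[of _ 1], intro conjI allI)
  fix n
  show "norm (c n) \<le> (\<Sum>i\<le>m. norm (c i) * fact i) * 1 ^ n / fact n"
  proof (cases "n \<le> m")
    case True
    have "norm (c n) * fact n \<le> (\<Sum>i\<le>m. norm (c i) * fact i)"
      by (rule member_le_sum) (use True in auto)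
    thus ?thesis by (simp add: field_simps)
  qed (use assms in \<open>auto intro!: sum_nonneg divide_nonneg_pos\<close>)
qed (auto intro!: sum_nonneg)

text \<open>\<open>Basis\<close> is the real basis of C^2, formed by e_i and i e_i. The real
  polynomials attached to its elements are regrouped into two complex coefficient sequences.\<close>

lemma polynomial_pvec:
  fixes \<beta> :: "cvec \<Rightarrow> nat \<Rightarrow> real" and N :: "cvec \<Rightarrow> nat"
  obtains c d where "entire_coeffs c" "entire_coeffs d"
    "pvec c d = (\<lambda>x. \<Sum>b\<in>Basis. rpoly (\<beta> b) (N b) x *\<^sub>R b)"
proof -
  define m where "m = (\<Sum>b\<in>(Basis :: cvec set). N b)"
  have m: "N b \<le> m" if "b \<in> Basis" for b unfolding m_def by (rule member_le_sum) (use that in auto)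
  define c where "c i n = (\<Sum>b\<in>(Basis :: cvec set). if n \<le> N b then of_real (\<beta> b n) * b $ i else 0)" for i n
  have c0: "c i n = 0" if "n > m" for i n
    unfolding c_def using m that by (intro sum.neutral) fastforce
  have "pser (c i) x = (\<Sum>b\<in>Basis. rpoly (\<beta> b) (N b) x *\<^sub>R b) $ i" for i x
  proof -
    have "pser (c i) x = (\<Sum>n\<le>m. c i n * of_real x ^ n)"
      unfolding pser_def pairing_def by (rule suminf_finite) (use c0 in auto)
    also have "\<dots> = (\<Sum>b\<in>Basis. \<Sum>n\<le>m. (if n \<le> N b then of_real (\<beta> b n) * b $ i else 0) * of_real x ^ n)"
      unfolding c_def sum_distrib_right by (rule sum.swap)
    also have "\<dots> = (\<Sum>b\<in>Basis. \<Sum>n\<le>N b. of_real (\<beta> b n * x ^ n) * b $ i)"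
    proof (rule sum.cong[OF refl])
      fix b :: cvec assume "b \<in> Basis"
      hence "(\<Sum>n\<le>N b. of_real (\<beta> b n * x ^ n) * b $ i) = (\<Sum>n\<le>m. if n \<le> N b then of_real (\<beta> b n * x ^ n) * b $ i else 0)"
        using m by (intro sum.mono_neutral_cong_left) auto
      also have "\<dots> = (\<Sum>n\<le>m. (if n \<le> N b then of_real (\<beta> b n) * b $ i else 0) * of_real x ^ n)"
        by (rule sum.cong) auto
      finally show "(\<Sum>n\<le>m. (if n \<le> N b then of_real (\<beta> b n) * b $ i else 0) * of_real x ^ n) = (\<Sum>n\<le>N b. of_real (\<beta> b n * x ^ n) * b $ i)" ..
    qed
    also have "\<dots> = (\<Sum>b\<in>Basis. rpoly (\<beta> b) (N b) x *\<^sub>R b) $ i"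
      unfolding sum_component vector_scaleR_component rpoly_def
      by (simp add: scaleR_conv_of_real sum_distrib_right)
    finally show ?thesis .
  qed
  hence "pvec (c 1) (c 2) = (\<lambda>x. \<Sum>b\<in>Basis. rpoly (\<beta> b) (N b) x *\<^sub>R b)"
    by (auto simp: pvec_def cvec_eq_iff)
  moreover have "entire_coeffs (c i)" for i by (rule entire_coeffs_finite[OF c0])
  ultimately show ?thesis using that by blast
qed

lemma H1_approx_polynomial:
  assumes h: "h > 0" and f: "L2_on (- h) h f" and g: "L2_on (- h) h g" and w: "weak_deriv_on (- h) h f g" and e: "\<epsilon> > 0"
  obtains c d where "entire_coeffs c" "entire_coeffs d"
    "L2_normsq (- h) h (\<lambda>x. f x - pvec c d x) < \<epsilon>"
    "L2_normsq (- h) h (\<lambda>x. g x - vector_derivative (pvec c d) (at x)) < \<epsilon>"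
proof -
  \<comment> \<open>The squared norm is the sum over the real components, so each receives an equal
    share of \<epsilon>.\<close>
  define \<delta> where "\<delta> = \<epsilon> / real (DIM(cvec))"
  have \<delta>: "\<delta> > 0" using e by (simp add: \<delta>_def)
  have "\<forall>b\<in>Basis. \<exists>\<beta> \<alpha> n. (\<forall>x. (rpoly \<beta> (Suc n) has_real_derivative rpoly \<alpha> n x) (at x)) \<and>
     L2_form h (\<lambda>x. f x \<bullet> b - rpoly \<beta> (Suc n) x) (\<lambda>x. f x \<bullet> b - rpoly \<beta> (Suc n) x) < \<delta> \<and>
     L2_form h (\<lambda>x. g x \<bullet> b - rpoly \<alpha> n x) (\<lambda>x. g x \<bullet> b - rpoly \<alpha> n x) < \<delta>"
    using scalar_H1_approx[OF h component_sq_int[OF f] component_sq_int[OF g] component_weak_real[OF f g w] \<delta>] by blast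
  from bchoice[OF this] obtain \<beta> where "\<forall>b\<in>Basis. \<exists>\<alpha> n. (\<forall>x. (rpoly (\<beta> b) (Suc n) has_real_derivative rpoly \<alpha> n x) (at x)) \<and>
     L2_form h (\<lambda>x. f x \<bullet> b - rpoly (\<beta> b) (Suc n) x) (\<lambda>x. f x \<bullet> b - rpoly (\<beta> b) (Suc n) x) < \<delta> \<and>
     L2_form h (\<lambda>x. g x \<bullet> b - rpoly \<alpha> n x) (\<lambda>x. g x \<bullet> b - rpoly \<alpha> n x) < \<delta>" ..
  from bchoice[OF this] obtain \<alpha> where "\<forall>b\<in>Basis. \<exists>n. (\<forall>x. (rpoly (\<beta> b) (Suc n) has_real_derivative rpoly (\<alpha> b) n x) (at x)) \<and>
     L2_form h (\<lambda>x. f x \<bullet> b - rpoly (\<beta> b) (Suc n) x) (\<lambda>x. f x \<bullet> b - rpoly (\<beta> b) (Suc n) x) < \<delta> \<and>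
     L2_form h (\<lambda>x. g x \<bullet> b - rpoly (\<alpha> b) n x) (\<lambda>x. g x \<bullet> b - rpoly (\<alpha> b) n x) < \<delta>" ..
  from bchoice[OF this] obtain N where N: "\<forall>b\<in>Basis. (\<forall>x. (rpoly (\<beta> b) (Suc (N b)) has_real_derivative rpoly (\<alpha> b) (N b) x) (at x)) \<and>
     L2_form h (\<lambda>x. f x \<bullet> b - rpoly (\<beta> b) (Suc (N b)) x) (\<lambda>x. f x \<bullet> b - rpoly (\<beta> b) (Suc (N b)) x) < \<delta> \<and>
     L2_form h (\<lambda>x. g x \<bullet> b - rpoly (\<alpha> b) (N b) x) (\<lambda>x. g x \<bullet> b - rpoly (\<alpha> b) (N b) x) < \<delta>" ..
  have ap: "(rpoly (\<beta> b) (Suc (N b)) has_real_derivative rpoly (\<alpha> b) (N b) x) (at x)"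
     "L2_form h (\<lambda>x. f x \<bullet> b - rpoly (\<beta> b) (Suc (N b)) x) (\<lambda>x. f x \<bullet> b - rpoly (\<beta> b) (Suc (N b)) x) < \<delta>"
     "L2_form h (\<lambda>x. g x \<bullet> b - rpoly (\<alpha> b) (N b) x) (\<lambda>x. g x \<bullet> b - rpoly (\<alpha> b) (N b) x) < \<delta>" if "b \<in> Basis" for b x
    using bspec[OF N that] by blast+
  obtain c d where cd: "entire_coeffs c" "entire_coeffs d"
    "pvec c d = (\<lambda>x. \<Sum>b\<in>Basis. rpoly (\<beta> b) (Suc (N b)) x *\<^sub>R b)"
    using polynomial_pvec[of \<beta> "\<lambda>b. Suc (N b)"] by blast
  have vd: "vector_derivative (pvec c d) (at x) = (\<Sum>b\<in>Basis. rpoly (\<alpha> b) (N b) x *\<^sub>R b)" for x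
    unfolding cd(3)
  proof (rule vector_derivative_at, rule has_vector_derivative_sum)
    fix b :: cvec assume b: "b \<in> Basis"
    have "(rpoly (\<beta> b) (Suc (N b)) has_vector_derivative rpoly (\<alpha> b) (N b) x) (at x)"
      using ap(1)[OF b] by (simp add: has_real_derivative_iff_has_vector_derivative)
    from bounded_linear.has_vector_derivative[OF bounded_linear_scaleR_left this]
    show "((\<lambda>x. rpoly (\<beta> b) (Suc (N b)) x *\<^sub>R b) has_vector_derivative rpoly (\<alpha> b) (N b) x *\<^sub>R b) (at x)" .
  qed
  have L: "L2_on (- h) h (\<lambda>x. f x - pvec c d x)" "L2_on (- h) h (\<lambda>x. g x - vector_derivative (pvec c d) (at x))"
    using C1_funD(2,3)[OF pvec_C1(1)[OF cd(1,2)], of UNIV] by (intro L2_on_diff f g L2_on_continuous; simp)+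
  have card: "real (DIM(cvec)) * \<delta> = \<epsilon>" by (simp add: \<delta>_def)
  have "L2_normsq (- h) h (\<lambda>x. f x - pvec c d x) < (\<Sum>b\<in>(Basis :: cvec set). \<delta>)"
    unfolding L2_normsq_components[OF L(1)]
    by (rule sum_strict_mono) (use ap(2) in \<open>auto simp: cd(3) inner_diff_left\<close>)
  moreover have "L2_normsq (- h) h (\<lambda>x. g x - vector_derivative (pvec c d) (at x)) < (\<Sum>b\<in>(Basis :: cvec set). \<delta>)"
    unfolding L2_normsq_components[OF L(2)]
    by (rule sum_strict_mono) (use ap(3) in \<open>auto simp: vd inner_diff_left\<close>)
  ultimately show ?thesis using that[OF cd(1,2)] card by simp
qed

lemma L2_normsq_H1_form:
  assumes "r \<in> C1_fun"
  shows "L2_normsq (- h) h r + L2_normsq (- h) h (\<lambda>x. vector_derivative r (at x)) = H1_form h r r"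
proof -
  have c: "continuous_on UNIV (\<lambda>x. (norm (r x))\<^sup>2)" "continuous_on UNIV (\<lambda>x. (norm (vector_derivative r (at x)))\<^sup>2)"
    by (intro continuous_intros C1_funD[OF assms])+
  have "H1_form h r r = integral {-h..h} (\<lambda>x. (norm (r x))\<^sup>2 + (norm (vector_derivative r (at x)))\<^sup>2)"
    by (simp add: H1_form_def power2_norm_eq_inner)
  also have "\<dots> = integral {-h..h} (\<lambda>x. (norm (r x))\<^sup>2) + integral {-h..h} (\<lambda>x. (norm (vector_derivative r (at x)))\<^sup>2)"
    by (rule integral_add) (use c in \<open>auto intro!: integrable_continuous_interval intro: continuous_on_subset\<close>)
  finally show ?thesis
    unfolding L2_normsq_def set_integral_continuous[OF c(1)] set_integral_continuous[OF c(2)] by simp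
qed

theorem theorem4:
  fixes h lam mu rho om :: real
  assumes "h > 0" and "mu > 0" and "3 * lam + 2 * mu > 0" and "rho > 0" and "om > 0"
  shows "complete_in_H1 (-h) h (lamb_modes h lam mu rho om)"
  unfolding complete_in_H1_def
proof (intro allI impI)
  fix f and \<epsilon> :: real assume "H1_on (- h) h f" and e: "\<epsilon> > 0"
  then obtain g where f: "L2_on (- h) h f" and g: "L2_on (- h) h g" and w: "weak_deriv_on (- h) h f g"
    unfolding H1_on_def by blast
  \<comment> \<open>The inequality |u + v|^2 <= 2|u|^2 + 2|v|^2 is used for the function and for its
    derivative, which gives a total below 6\<epsilon>/8.\<close>
  have e8: "\<epsilon> / 8 > 0" using e by simp
  obtain c d where cd: "entire_coeffs c" "entire_coeffs d"
    and n1: "L2_normsq (- h) h (\<lambda>x. f x - pvec c d x) < \<epsilon> / 8"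
    and n2: "L2_normsq (- h) h (\<lambda>x. g x - vector_derivative (pvec c d) (at x)) < \<epsilon> / 8"
    using H1_approx_polynomial[OF assms(1) f g w e8] by blast
  let ?P = "pvec c d" and ?P1 = "\<lambda>x. vector_derivative (pvec c d) (at x)"
  obtain u where u: "u \<in> cspan_fun (smooth_modes h lam mu rho om)" "H1_form h (\<lambda>x. ?P x - u x) (\<lambda>x. ?P x - u x) < \<epsilon> / 8"
    using modes_approximate_entire[OF assms cd e8] by blast
  have uC: "u \<in> C1_fun" using u(1) cspan_smooth_modes_C1 by blast
  have PC: "?P \<in> C1_fun" by (rule pvec_C1(1)[OF cd])
  let ?u1 = "\<lambda>x. vector_derivative u (at x)"
  have r: "(\<lambda>x. ?P x - u x) \<in> C1_fun" "vector_derivative (\<lambda>x. ?P x - u x) (at x) = ?P1 x - ?u1 x" for x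
    using C1_fun_lc[OF PC uC, of "- 1"] by simp_all
  have L: "L2_on (- h) h u" "L2_on (- h) h ?u1" "L2_on (- h) h ?P" "L2_on (- h) h ?P1"
    by (intro L2_on_continuous C1_funD uC PC)+
  have "L2_normsq (- h) h (\<lambda>x. ?P x - u x) + L2_normsq (- h) h (\<lambda>x. ?P1 x - ?u1 x) < \<epsilon> / 8"
    using L2_normsq_H1_form[OF r(1), of h] u(2) by (simp add: r(2))
  moreover have "L2_normsq (- h) h (\<lambda>x. f x - u x) \<le> 2 * L2_normsq (- h) h (\<lambda>x. f x - ?P x) + 2 * L2_normsq (- h) h (\<lambda>x. ?P x - u x)"
    using L2_on_add(2)[OF L2_on_diff[OF f L(3)] L2_on_diff[OF L(3) L(1)]] by simp
  moreover have "L2_normsq (- h) h (\<lambda>x. g x - ?u1 x) \<le> 2 * L2_normsq (- h) h (\<lambda>x. g x - ?P1 x) + 2 * L2_normsq (- h) h (\<lambda>x. ?P1 x - ?u1 x)"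
    using L2_on_add(2)[OF L2_on_diff[OF g L(4)] L2_on_diff[OF L(4) L(2)]] by simp
  ultimately have small: "L2_normsq (- h) h (\<lambda>x. f x - u x) + L2_normsq (- h) h (\<lambda>x. g x - ?u1 x) < \<epsilon>"
    using n1 n2 e by linarith
  have "u \<in> cspan_fun (lamb_modes h lam mu rho om)"
    using u(1) unfolding cspan_fun_def smooth_modes_def by blast
  moreover have "weak_deriv_on (- h) h (\<lambda>x. f x - u x) (\<lambda>x. g x - ?u1 x)"
    by (rule weak_deriv_on_diff[OF f g L(1,2) w weak_deriv_on_C1[OF C1_funD(1,2)[OF uC]]])
  ultimately show "\<exists>u\<in>cspan_fun (lamb_modes h lam mu rho om). \<exists>g. L2_on (- h) h (\<lambda>x. f x - u x) \<and>
      L2_on (- h) h g \<and> weak_deriv_on (- h) h (\<lambda>x. f x - u x) g \<and>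
      L2_normsq (- h) h (\<lambda>x. f x - u x) + L2_normsq (- h) h g < \<epsilon>"
    using small L2_on_diff[OF f L(1)] L2_on_diff[OF g L(2)] by blast
qed

end
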